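(* Let $I\subseteq\mathbb{R}$ be a closed interval and let $m,d\in\mathbb{N}$. Assume that the Smolyak operator $\mathcal{A}_{Q(p,d)}$ is built using a local polynomial reproduction process of degree $m-1$. Assume further that the univariate point sets $X^{(\ell)}\subseteq I$, $\ell\in\mathbb{N}$, are quasi-uniform with $N_1=1$ and $N_\ell=2^{\ell-1}+1$, $\ell\ge2$, points and thus $h_\ell\sim2^{-\ell+1}$. Let $N$ be the number of points in the sparse grid $H(p,d)$ with a fixed $p\ge d$. Then there are constants $C_d^{(1)},C_d^{(2)},C_d^{(3)},C_d^{(4)}>0$ such that $$\|f\|_{L_2(I^d)}\le p^{d-1}\left[C_d^{(1)}2^{-(p-d)m}\|f\|_{H^m_{\mathrm{mix}}(I^d)}+C_d^{(3)}2^{-(p-d)/2}\|f\|_{\ell_2(H(p,d))}\right]$$ $$\le C_d^{(2)}(\log N)^{(m+1)(d-1)}N^{-m}\|f\|_{H^m_{\mathrm{mix}}(I^d)}+C_d^{(4)}(\log N)^{3(d-1)/2}N^{-1/2}\|f\|_{\ell_2(H(p,d))}$$ for all $f\in H^m_{\mathrm{mix}}(I^d)$. Both $C_d^{(1)}$ and $C_d^{(3)}$ are of the form $c^d/(d-1)!$.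
   Context: Here $\mathbb{N}=\{1,2,\dots\}$ and $|\boldsymbol{\ell}|=\ell_1+\dots+\ell_d$ for $\boldsymbol{\ell}\in\mathbb{N}^d$. The subscript $d$ of the constants indicates their dependence on $d$. For a finite set $X=\{x_1,\dots,x_N\}\subseteq I$: $h_X=\sup_{x\in I}\min_j|x-x_j|$, $q_X=\frac12\min_{j\ne k}|x_j-x_k|$, $\rho_X=h_X/q_X$. Local polynomial reproduction process of degree $k$: to every finite $X=\{x_1,\dots,x_N\}\subseteq I$ there are assigned functions $a_j:I\to\mathbb{R}$, $1\le j\le N$, and one sets $A_Xf=\sum_{j=1}^N a_j f(x_j)$ for $f\in C(I)$; there are constants $h_0,c_1,c_2>0$ such that for all finite $X\subseteq I$ with $h_X\le h_0$: (1) $A_Xg=g$ for all polynomials $g$ of degree at most $k$; (2) $\sum_{j}|a_j(x)|\le c_1$ for all $x\in I$; (3) $a_j(x)=0$ whenever $|x-x_j|>c_2h_X$. $N_\ell=|X^{(\ell)}|$, $h_\ell=h_{X^{(\ell)}}$, $\rho_\ell=\rho_{X^{(\ell)}}$, $A^{(\ell)}=A_{X^{(\ell)}}$. Quasi-uniformity means that the ratios $\rho_\ell$ are bounded uniformly in $\ell$. For $p\ge d$ let $P(p,d)=\{\boldsymbol{\ell}\in\mathbb{N}^d: p-d+1\le|\boldsymbol{\ell}|\le p\}$. The sparse grid is $H(p,d)=\bigcup_{\boldsymbol{\ell}\in P(p,d)}X^{(\ell_1)}\times\cdots\times X^{(\ell_d)}$. The Smolyak operator is $\mathcal{A}_{Q(p,d)}=\sum_{\boldsymbol{\ell}\in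 P(p,d)}(-1)^{p-|\boldsymbol{\ell}|}\binom{d-1}{p-|\boldsymbol{\ell}|}A^{(\ell_1)}\otimes\cdots\otimes A^{(\ell_d)}$. $H^m_{\mathrm{mix}}(I^d)=\{f\in L_2(I^d): D^{\boldsymbol\alpha}f\in L_2(I^d)\text{ for all }\boldsymbol\alpha\in\mathbb{N}_0^d,\ \|\boldsymbol\alpha\|_\infty\le m\}$ with $\|f\|^2_{H^m_{\mathrm{mix}}(I^d)}=\sum_{\|\boldsymbol\alpha\|_\infty\le m}\|D^{\boldsymbol\alpha}f\|^2_{L_2(I^d)}$; it embeds into $C(I^d)$. $\|f\|_{\ell_2(Z)}=(\sum_{z\in Z}|f(z)|^2)^{1/2}$ for finite $Z$.
   Formalization: The second inequality is claimed only for d = 1 or p > d, because for p = d ≥ 2 the sparse grid has one point, so log N = 0 and the printed right-hand side vanishes while the middle term is positive for nonzero f. *)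

theory Defs
  imports "HOL-Analysis.Analysis" "HOL-Computational_Algebra.Polynomial"
begin

section \<open>Univariate point sets and local polynomial reproduction\<close>

definition fill_distance :: "real set \<Rightarrow> real set \<Rightarrow> real" where
  "fill_distance I X = (SUP x\<in>I. MIN y\<in>X. \<bar>x - y\<bar>)"

definition separation_distance :: "real set \<Rightarrow> real" where
  "separation_distance X = (1/2) * Min {\<bar>y - z\<bar> | y z. y \<in> X \<and> z \<in> X \<and> y \<noteq> z}"

definition mesh_ratio :: "real set \<Rightarrow> real set \<Rightarrow> real" where
  "mesh_ratio I X = fill_distance I X / separation_distance X"

text \<open>For a one-point set the minimum in the separation distance ranges over the empty set
  (the convention being infinite separation, hence mesh ratio 0), so such sets impose no condition.\<close>

definition quasi_uniform :: "real set \<Rightarrow> (nat \<Rightarrow> real set) \<Rightarrow> bool" where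
  "quasi_uniform I X \<longleftrightarrow>
     (\<exists>K. \<forall>l\<ge>1. card (X l) \<ge> 2 \<longrightarrow> mesh_ratio I (X l) \<le> K)"

text \<open>A process \<open>a\<close> assigns to a finite point set \<open>X\<close> and a node \<open>y \<in> X\<close> the function \<open>a X y\<close>;
  the functions are thus indexed by the nodes themselves instead of by an enumeration of them.\<close>

type_synonym process = "real set \<Rightarrow> real \<Rightarrow> real \<Rightarrow> real"

definition process_op :: "process \<Rightarrow> real set \<Rightarrow> (real \<Rightarrow> real) \<Rightarrow> real \<Rightarrow> real" where
  "process_op a X f x = (\<Sum>y\<in>X. a X y x * f y)"

definition local_poly_reproduction :: "real set \<Rightarrow> nat \<Rightarrow> process \<Rightarrow> bool" where
  "local_poly_reproduction I k a \<longleftrightarrow>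
     (\<exists>h0>0. \<exists>c1>0. \<exists>c2>0. \<forall>X. finite X \<and> X \<noteq> {} \<and> X \<subseteq> I \<and> fill_distance I X \<le> h0 \<longrightarrow>
        (\<forall>g. degree g \<le> k \<longrightarrow> (\<forall>x\<in>I. process_op a X (poly g) x = poly g x)) \<and>
        (\<forall>x\<in>I. (\<Sum>y\<in>X. \<bar>a X y x\<bar>) \<le> c1) \<and>
        (\<forall>x\<in>I. \<forall>y\<in>X. \<bar>x - y\<bar> > c2 * fill_distance I X \<longrightarrow> a X y x = 0))"

section \<open>Sparse grids and the Smolyak operator\<close>

text \<open>The dimension \<open>d\<close> varies inside the theorem, so points of \<open>d\<close>-dimensional space and multi-indices
  are extensional functions on \<open>{..<d}\<close>.\<close>

definition cube :: "real set \<Rightarrow> nat \<Rightarrow> (nat \<Rightarrow> real) set" where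
  "cube I d = {..<d} \<rightarrow>\<^sub>E I"

definition level_set :: "nat \<Rightarrow> nat \<Rightarrow> (nat \<Rightarrow> nat) set" where
  "level_set p d = {l \<in> {..<d} \<rightarrow>\<^sub>E {1..}. p - d + 1 \<le> (\<Sum>i<d. l i) \<and> (\<Sum>i<d. l i) \<le> p}"

definition sparse_grid :: "(nat \<Rightarrow> real set) \<Rightarrow> nat \<Rightarrow> nat \<Rightarrow> (nat \<Rightarrow> real) set" where
  "sparse_grid X p d = (\<Union>l\<in>level_set p d. \<Pi>\<^sub>E i\<in>{..<d}. X (l i))"

definition tensor_op ::
  "process \<Rightarrow> (nat \<Rightarrow> real set) \<Rightarrow> nat \<Rightarrow> (nat \<Rightarrow> nat) \<Rightarrow> ((nat \<Rightarrow> real) \<Rightarrow> real) \<Rightarrow> (nat \<Rightarrow> real) \<Rightarrow> real"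
  where
  "tensor_op a X d l f x =
     (\<Sum>z\<in>(\<Pi>\<^sub>E i\<in>{..<d}. X (l i)). (\<Prod>i<d. a (X (l i)) (z i) (x i)) * f z)"

definition smolyak_op ::
  "process \<Rightarrow> (nat \<Rightarrow> real set) \<Rightarrow> nat \<Rightarrow> nat \<Rightarrow> ((nat \<Rightarrow> real) \<Rightarrow> real) \<Rightarrow> (nat \<Rightarrow> real) \<Rightarrow> real"
  where
  "smolyak_op a X p d f x =
     (\<Sum>l\<in>level_set p d. (-1) ^ (p - (\<Sum>i<d. l i)) * real ((d - 1) choose (p - (\<Sum>i<d. l i)))
        * tensor_op a X d l f x)"

definition discrete_norm :: "(nat \<Rightarrow> real) set \<Rightarrow> ((nat \<Rightarrow> real) \<Rightarrow> real) \<Rightarrow> real" where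
  "discrete_norm Z f = sqrt (\<Sum>z\<in>Z. \<bar>f z\<bar>\<^sup>2)"

section \<open>Mixed Sobolev spaces\<close>

definition cube_measure :: "real set \<Rightarrow> nat \<Rightarrow> (nat \<Rightarrow> real) measure" where
  "cube_measure I d = Pi\<^sub>M {..<d} (\<lambda>_. restrict_space lborel I)"

definition square_integrable :: "real set \<Rightarrow> nat \<Rightarrow> ((nat \<Rightarrow> real) \<Rightarrow> real) \<Rightarrow> bool" where
  "square_integrable I d f \<longleftrightarrow>
     f \<in> borel_measurable (cube_measure I d) \<and> integrable (cube_measure I d) (\<lambda>x. \<bar>f x\<bar>\<^sup>2)"

definition L2_cube_norm :: "real set \<Rightarrow> nat \<Rightarrow> ((nat \<Rightarrow> real) \<Rightarrow> real) \<Rightarrow> real" where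
  "L2_cube_norm I d f = sqrt (\<integral>x. \<bar>f x\<bar>\<^sup>2 \<partial>cube_measure I d)"

definition partial_deriv :: "nat \<Rightarrow> ((nat \<Rightarrow> real) \<Rightarrow> real) \<Rightarrow> (nat \<Rightarrow> real) \<Rightarrow> real" where
  "partial_deriv i u x = deriv (\<lambda>t. u (x(i := t))) (x i)"

definition multi_deriv ::
  "nat \<Rightarrow> (nat \<Rightarrow> nat) \<Rightarrow> ((nat \<Rightarrow> real) \<Rightarrow> real) \<Rightarrow> (nat \<Rightarrow> real) \<Rightarrow> real" where
  "multi_deriv d \<alpha> u = foldr (\<lambda>i. partial_deriv i ^^ \<alpha> i) [0..<d] u"

text \<open>Smoothness on \<open>cube UNIV d\<close>: all iterated partial derivatives, in any order, exist and are
  continuous (the product topology on functions induces the Euclidean topology there).\<close>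

definition smooth :: "nat \<Rightarrow> ((nat \<Rightarrow> real) \<Rightarrow> real) \<Rightarrow> bool" where
  "smooth d u \<longleftrightarrow>
     (\<forall>js. set js \<subseteq> {..<d} \<longrightarrow>
        continuous_on (cube UNIV d) (foldr partial_deriv js u) \<and>
        (\<forall>x\<in>cube UNIV d. \<forall>i<d.
           (\<lambda>t. foldr partial_deriv js u (x(i := t))) differentiable at (x i)))"

definition test_function :: "real set \<Rightarrow> nat \<Rightarrow> ((nat \<Rightarrow> real) \<Rightarrow> real) \<Rightarrow> bool" where
  "test_function I d u \<longleftrightarrow>
     smooth d u \<and>
     (\<exists>K. compact K \<and> K \<subseteq> cube (interior I) d \<and> (\<forall>x\<in>cube UNIV d - K. u x = 0))"

definition weak_deriv ::
  "real set \<Rightarrow> nat \<Rightarrow> (nat \<Rightarrow> nat) \<Rightarrow> ((nat \<Rightarrow> real) \<Rightarrow> real) \<Rightarrow> ((nat \<Rightarrow> real) \<Rightarrow> real) \<Rightarrow> bool"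
  where
  "weak_deriv I d \<alpha> f g \<longleftrightarrow>
     (\<forall>u. test_function I d u \<longrightarrow>
        (\<integral>x. f x * multi_deriv d \<alpha> u x \<partial>cube_measure I d)
          = (-1) ^ (\<Sum>i<d. \<alpha> i) * (\<integral>x. g x * u x \<partial>cube_measure I d))"

definition multi_indices :: "nat \<Rightarrow> nat \<Rightarrow> (nat \<Rightarrow> nat) set" where
  "multi_indices d m = {..<d} \<rightarrow>\<^sub>E {..m}"

text \<open>For \<open>m \<ge> 1\<close> every class in the mixed Sobolev space has a unique continuous representative on the
  closed cube. Since point values are needed, an element of the space is given by this representative.\<close>

definition H_mix :: "real set \<Rightarrow> nat \<Rightarrow> nat \<Rightarrow> ((nat \<Rightarrow> real) \<Rightarrow> real) set" where
  "H_mix I d m =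
     {f. continuous_on (cube I d) f \<and> square_integrable I d f \<and>
         (\<forall>\<alpha>\<in>multi_indices d m. \<exists>g. square_integrable I d g \<and> weak_deriv I d \<alpha> f g)}"

text \<open>Weak derivatives are unique up to null sets, so the norm does not depend on the choice.\<close>

definition weak_D ::
  "real set \<Rightarrow> nat \<Rightarrow> (nat \<Rightarrow> nat) \<Rightarrow> ((nat \<Rightarrow> real) \<Rightarrow> real) \<Rightarrow> (nat \<Rightarrow> real) \<Rightarrow> real" where
  "weak_D I d \<alpha> f = (SOME g. square_integrable I d g \<and> weak_deriv I d \<alpha> f g)"

definition H_mix_norm :: "real set \<Rightarrow> nat \<Rightarrow> nat \<Rightarrow> ((nat \<Rightarrow> real) \<Rightarrow> real) \<Rightarrow> real" where
  "H_mix_norm I d m f = sqrt (\<Sum>\<alpha>\<in>multi_indices d m. (L2_cube_norm I d (weak_D I d \<alpha> f))\<^sup>2)"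

end

theory Submission
  imports Defs "HOL-Computational_Algebra.Formal_Power_Series"
begin

text \<open>The conclusion does not mention the operators, so they may be altered on coarse levels: set
  \<open>A\<^sub>l = 0\<close> below the level \<open>L\<close> from which the fill distance is admissible, and let
  \<open>\<Delta>\<^sub>l = A\<^sub>l - A\<^sub>l\<^sub>-\<^sub>1\<close>. Since tensor products of \<open>A\<^sub>k\<close> converge uniformly on continuous functions, \<open>f\<close>
  is the sum of all tensor products of the \<open>\<Delta>\<^sub>l\<close> applied to \<open>f\<close>. The combination formula turns the part with
  \<open>|l| \<le> p\<close> into the Smolyak operator, which only sees the values of \<open>f\<close> on the sparse grid and is local and stable.

  The part with \<open>|l| > p\<close> is estimated by duality. Mollify the point evaluations. For \<open>l > L\<close>
  the functional \<open>\<Delta>\<^sub>l\<close> at \<open>x\<close> annihilates polynomials of degree less than \<open>m\<close>, so its mollification is the \<open>m\<close>-th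
  derivative of a test function of size \<open>2\<^sup>-\<^sup>(\<^sup>m\<^sup>-\<^sup>1\<^sup>)\<^sup>l\<close> supported within \<open>O(2\<^sup>-\<^sup>l)\<close> of \<open>x\<close>; for \<open>l = L\<close> it is a test function plus
  the first derivative of one. The definition of weak derivatives bounds the tensor products applied to \<open>f\<close> pointwise by
  local integrals of weak derivatives, whose \<open>L\<^sub>2\<close> norms are of order \<open>2\<^sup>-\<^sup>m\<^sup>|\<^sup>l\<^sup>|\<close>. Summing over \<open>l\<close>
  costs the number \<open>p\<^sup>d\<^sup>-\<^sup>1/(d-1)!\<close> of levels.\<close>

section \<open>Smooth functions of one variable\<close>


text \<open>Two obstacles shape the proof. \<open>H_mix\<close> offers nothing but a continuous
  function and the integral identities of its weak derivatives, so derivatives of \<open>f\<close>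
  are reached only by writing functionals as derivatives of test functions; no density or embedding
  theorem enters. And the functions \<open>a X y\<close> of the process need not be measurable, so
  the operators cannot be measured in L2 directly: they are dominated pointwise by measurable
  functions, and only these are integrated.

  The shape c^d/(d-1)! of the constants dictates the bookkeeping. All univariate constants are
  independent of \<open>d\<close> and enter as d-th powers; the factorial comes solely from counting
  the vectors l with |l| = q, of which there are at most q^(d-1)/(d-1)!. Beyond p these counts grow
  like (p+j)^(d-1), and the loss against p^(d-1) must again be c^d times the j-th power of a number
  below 2, so that the decay 2^(-j) survives. Setting the operators to zero on coarse levels serves
  the same end: \<open>L\<close> does not depend on \<open>d\<close>, and small \<open>p\<close>
  needs no separate treatment.\<close>

primrec times_diff :: "nat \<Rightarrow> (real \<Rightarrow> real) \<Rightarrow> bool" where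
  "times_diff 0 f = True"
| "times_diff (Suc n) f = (\<exists>f'. (\<forall>x. (f has_real_derivative f' x) (at x)) \<and> times_diff n f')"

definition smooth_real :: "(real \<Rightarrow> real) \<Rightarrow> bool" where
  "smooth_real f \<longleftrightarrow> (\<forall>n. times_diff n f)"

lemma times_diff_SucI:
  "(\<And>x. (f has_real_derivative f' x) (at x)) \<Longrightarrow> times_diff n f' \<Longrightarrow> times_diff (Suc n) f"
  by auto

text \<open>Product and reciprocal rules place \<open>f\<close> beside its derivative, so their
  inductions need \<open>f\<close> itself at the lower order.\<close>

lemma times_diff_Suc_D: "times_diff (Suc n) f \<Longrightarrow> times_diff n f"
proof (induction n arbitrary: f)
  case (Suc n)
  then obtain f' where "\<And>x. (f has_real_derivative f' x) (at x)" "times_diff (Suc n) f'"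
    using times_diff.simps(2)[of "Suc n" f] by blast
  then show ?case using Suc.IH by (intro times_diff_SucI)
qed auto

lemma times_diff_const: "times_diff n (\<lambda>x. c)"
proof (induction n arbitrary: c)
  case (Suc n)
  have "\<forall>x. ((\<lambda>x. c) has_real_derivative 0) (at x)" by auto
  then show ?case using Suc[of 0] by (intro times_diff_SucI) auto
qed auto

lemma times_diff_affine: "times_diff n (\<lambda>x. u * x + v)"
proof (cases n)
  case (Suc k)
  have "\<forall>x. ((\<lambda>x. u * x + v) has_real_derivative u) (at x)"
    by (auto intro!: derivative_eq_intros)
  then show ?thesis unfolding Suc using times_diff_const[of k u] by (intro times_diff_SucI) auto
qed auto

lemma times_diff_add: "times_diff n f \<Longrightarrow> times_diff n g \<Longrightarrow> times_diff n (\<lambda>x. f x + g x)"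
proof (induction n arbitrary: f g)
  case (Suc n)
  then obtain f' g' where "\<forall>x. (f has_real_derivative f' x) (at x)" "times_diff n f'"
    "\<forall>x. (g has_real_derivative g' x) (at x)" "times_diff n g'" by auto
  then have "\<forall>x. ((\<lambda>x. f x + g x) has_real_derivative f' x + g' x) (at x)"
    "times_diff n (\<lambda>x. f' x + g' x)" using Suc.IH by (auto intro!: derivative_intros)
  then show ?case by (intro times_diff_SucI) auto
qed auto

lemma times_diff_mult: "times_diff n f \<Longrightarrow> times_diff n g \<Longrightarrow> times_diff n (\<lambda>x. f x * g x)"
proof (induction n arbitrary: f g)
  case (Suc n)
  then obtain f' g' where d: "\<forall>x. (f has_real_derivative f' x) (at x)" "times_diff n f'"
    "\<forall>x. (g has_real_derivative g' x) (at x)" "times_diff n g'" by auto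
  have "\<forall>x. ((\<lambda>x. f x * g x) has_real_derivative f' x * g x + g' x * f x) (at x)"
    using d by (auto intro!: derivative_eq_intros)
  moreover have "times_diff n (\<lambda>x. f' x * g x + g' x * f x)"
    using Suc d times_diff_Suc_D by (intro times_diff_add Suc.IH) blast+
  ultimately show ?case by (intro times_diff_SucI) auto
qed auto

lemma times_diff_inverse:
  "times_diff n f \<Longrightarrow> (\<And>x. f x \<noteq> 0) \<Longrightarrow> times_diff n (\<lambda>x. inverse (f x))"
proof (induction n arbitrary: f)
  case (Suc n)
  then obtain f' where d: "\<forall>x. (f has_real_derivative f' x) (at x)" "times_diff n f'" by auto
  \<comment> \<open>Written as a product, so that \<open>times_diff_mult\<close> and the induction
    hypothesis for the reciprocal apply.\<close>
  have "\<forall>x. ((\<lambda>x. inverse (f x)) has_real_derivative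
      (- 1) * (f' x * (inverse (f x) * inverse (f x)))) (at x)"
    using d Suc.prems by (auto intro!: derivative_eq_intros)
  moreover have "times_diff n (\<lambda>x. (- 1) * (f' x * (inverse (f x) * inverse (f x))))"
    by (intro times_diff_mult times_diff_const d Suc.IH times_diff_Suc_D[OF Suc.prems(1)] Suc.prems(2))
  ultimately show ?case by (intro times_diff_SucI) auto
qed auto

lemma times_diff_compose_affine: "times_diff n f \<Longrightarrow> times_diff n (\<lambda>x. f (u * x + v))"
proof (induction n arbitrary: f)
  case (Suc n)
  then obtain f' where d: "\<forall>x. (f has_real_derivative f' x) (at x)" "times_diff n f'" by auto
  have "\<forall>x. ((\<lambda>x. f (u * x + v)) has_real_derivative u * f' (u * x + v)) (at x)"
  proof
    fix x
    have "((\<lambda>x. f (u * x + v)) has_real_derivative f' (u * x + v) * u) (at x)"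
      using d(1) by (intro DERIV_chain2[where f = f]) (auto intro!: derivative_eq_intros)
    then show "((\<lambda>x. f (u * x + v)) has_real_derivative u * f' (u * x + v)) (at x)"
      by (simp add: mult.commute)
  qed
  moreover have "times_diff n (\<lambda>x. u * f' (u * x + v))"
    by (intro times_diff_mult times_diff_const Suc.IH d)
  ultimately show ?case by (intro times_diff_SucI) auto
qed auto

lemma times_diff_deriv: "times_diff (Suc n) f \<Longrightarrow> times_diff n (deriv f)"
proof -
  assume "times_diff (Suc n) f"
  then obtain f' where d: "\<forall>x. (f has_real_derivative f' x) (at x)" "times_diff n f'" by auto
  then have "deriv f = f'" by (auto intro: DERIV_imp_deriv)
  then show ?thesis using d by simp
qed

lemma smooth_real_deriv: "smooth_real f \<Longrightarrow> smooth_real (deriv f)"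
  unfolding smooth_real_def using times_diff_deriv by blast

lemma smooth_real_iterated_deriv: "smooth_real f \<Longrightarrow> smooth_real ((deriv ^^ k) f)"
  by (induction k) (auto intro: smooth_real_deriv)

lemma smooth_real_has_deriv: "smooth_real f \<Longrightarrow> (f has_real_derivative deriv f x) (at x)"
proof -
  assume "smooth_real f"
  then have "times_diff (Suc 0) f" unfolding smooth_real_def by blast
  then obtain f' where "(f has_real_derivative f' x) (at x)" by auto
  then show ?thesis using DERIV_imp_deriv by force
qed

lemma smooth_real_iterated_has_deriv:
  "smooth_real f \<Longrightarrow> ((deriv ^^ k) f has_real_derivative (deriv ^^ Suc k) f x) (at x)"
  using smooth_real_has_deriv[OF smooth_real_iterated_deriv] by simp

lemma smooth_real_continuous: "smooth_real f \<Longrightarrow> continuous_on S f"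
  by (meson DERIV_isCont continuous_at_imp_continuous_on smooth_real_has_deriv)

lemma smooth_real_const: "smooth_real (\<lambda>x. c)"
  unfolding smooth_real_def using times_diff_const by blast

lemma smooth_real_add: "smooth_real f \<Longrightarrow> smooth_real g \<Longrightarrow> smooth_real (\<lambda>x. f x + g x)"
  unfolding smooth_real_def using times_diff_add by blast

lemma smooth_real_mult: "smooth_real f \<Longrightarrow> smooth_real g \<Longrightarrow> smooth_real (\<lambda>x. f x * g x)"
  unfolding smooth_real_def using times_diff_mult by blast

lemma smooth_real_inverse:
  "smooth_real f \<Longrightarrow> (\<And>x. f x \<noteq> 0) \<Longrightarrow> smooth_real (\<lambda>x. inverse (f x))"
  unfolding smooth_real_def using times_diff_inverse by blast

lemma smooth_real_affine: "smooth_real (\<lambda>x. u * x + v)"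
  unfolding smooth_real_def using times_diff_affine by blast

lemma smooth_real_compose_affine: "smooth_real f \<Longrightarrow> smooth_real (\<lambda>x. f (u * x + v))"
  unfolding smooth_real_def using times_diff_compose_affine by blast

lemma smooth_real_power: "smooth_real (\<lambda>x. x ^ k)"
proof (induction k)
  case (Suc k)
  then show ?case using smooth_real_mult[OF smooth_real_affine[of 1 0] Suc] by simp
qed (simp add: smooth_real_const)

lemma smooth_real_sum:
  "(\<And>j. j \<in> J \<Longrightarrow> smooth_real (f j)) \<Longrightarrow> smooth_real (\<lambda>x. \<Sum>j\<in>J. f j x)"
  by (induction J rule: infinite_finite_induct) (auto simp: smooth_real_const intro: smooth_real_add)

lemma iterated_deriv_sum:
  assumes "\<And>j. j \<in> J \<Longrightarrow> smooth_real (f j)"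
  shows "(deriv ^^ k) (\<lambda>x. \<Sum>j\<in>J. c j * f j x) = (\<lambda>x. \<Sum>j\<in>J. c j * (deriv ^^ k) (f j) x)"
proof (induction k)
  case (Suc k)
  have "((\<lambda>x. \<Sum>j\<in>J. c j * (deriv ^^ k) (f j) x) has_real_derivative
      (\<Sum>j\<in>J. c j * (deriv ^^ Suc k) (f j) x)) (at x)" for x
    by (intro DERIV_sum DERIV_cmult smooth_real_iterated_has_deriv assms)
  then show ?case using Suc by (auto intro: DERIV_imp_deriv)
qed auto

lemma iterated_deriv_compose_affine:
  assumes "smooth_real f"
  shows "(deriv ^^ k) (\<lambda>x. f (u * x + v)) = (\<lambda>x. u ^ k * (deriv ^^ k) f (u * x + v))"
proof (induction k)
  case (Suc k)
  have "((\<lambda>x. u ^ k * (deriv ^^ k) f (u * x + v)) has_real_derivative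
      u ^ k * ((deriv ^^ Suc k) f (u * x + v) * u)) (at x)" for x
    by (intro DERIV_cmult DERIV_chain2[where f = "(deriv ^^ k) f"] smooth_real_iterated_has_deriv assms)
       (auto intro!: derivative_eq_intros)
  then show ?case using Suc by (auto intro!: DERIV_imp_deriv simp: mult_ac)
qed auto

text \<open>Differentiation is local. This is how the derivatives of \<open>E\<close> are read off
  from its zero and polynomial pieces, where only values are prescribed.\<close>

lemma iterated_deriv_cong_open:
  assumes "open S" "\<And>x. x \<in> S \<Longrightarrow> f x = g x" "x \<in> S"
  shows "(deriv ^^ k) f x = (deriv ^^ k) g x"
  using assms(3)
proof (induction k arbitrary: x)
  case (Suc k)
  have "eventually (\<lambda>y. (deriv ^^ k) f y = (deriv ^^ k) g y) (nhds x)"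
    using eventually_nhds_in_open[OF assms(1) Suc.prems] by eventually_elim (rule Suc.IH)
  then show ?case by (auto intro: deriv_cong_ev)
qed (use assms in auto)

section \<open>Flat functions at 0 and a smooth step\<close>

lemma exp_bump_tendsto: "((\<lambda>x::real. poly p (1/x) * exp (- 1/x)) \<longlongrightarrow> 0) (at_right 0)"
proof -
  \<comment> \<open>With y = 1/x the claim becomes the decay of a polynomial times exp(-y) at
    infinity.\<close>
  have "((\<lambda>y::real. poly p y * exp (- y)) \<longlongrightarrow> 0) at_top"
  proof -
    have "((\<lambda>y::real. \<Sum>i\<le>degree p. coeff p i * (y ^ i / exp y)) \<longlongrightarrow> (\<Sum>i\<le>degree p. coeff p i * 0)) at_top"
      by (intro tendsto_sum tendsto_mult tendsto_const tendsto_power_div_exp_0)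
    then show ?thesis
      by (simp add: poly_altdef sum_distrib_right exp_minus divide_inverse mult.assoc)
  qed
  from filterlim_compose[OF this filterlim_inverse_at_top_right]
  show ?thesis by (simp add: inverse_eq_divide)
qed

text \<open>The polynomial \<open>p\<close> is arbitrary because this family is closed under
  differentiation, which turns smoothness into an induction on the order.\<close>

lemma times_diff_exp_bump:
  "times_diff n (\<lambda>x. if x > 0 then poly p (1/x) * exp (- 1/x) else 0)"
proof (induction n arbitrary: p)
  case (Suc n)
  define G where "G p x = (if x > 0 then poly p (1/x) * exp (- 1/x) else (0::real))" for p and x :: real
  \<comment> \<open>Differentiating p(1/x) exp(-1/x) gives (p - p')(1/x) exp(-1/x) / x^2.\<close>
  define q where "q = [:0, 0, 1:] * (p - pderiv p)"
  have "(G p has_real_derivative G q x) (at x)" for x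
  proof (cases "x = 0")
    case False
    show ?thesis
    proof (cases "x > 0")
      case True
      have "((\<lambda>x. poly p (1/x) * exp (- 1/x)) has_real_derivative G q x) (at x)"
        using True
        by (auto intro!: derivative_eq_intros poly_DERIV[THEN DERIV_chain2]
            simp: G_def q_def field_simps power2_eq_square)
      then show ?thesis
        by (rule has_field_derivative_transform_within_open[where S = "{0<..}"])
           (use True in \<open>auto simp: G_def\<close>)
    next
      case False
      have "((\<lambda>x. 0) has_real_derivative G q x) (at x)"
        using False by (auto simp: G_def)
      then show ?thesis
        by (rule has_field_derivative_transform_within_open[where S = "{..<0}"])
           (use False \<open>x \<noteq> 0\<close> in \<open>auto simp: G_def\<close>)
    qed
  next
    case True
    have r: "((\<lambda>y. (G p y - G p 0) / (y - 0)) \<longlongrightarrow> 0) (at_right 0)"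
    \<comment> \<open>From the right, the difference quotient at 0 is again in the family, with the
      polynomial X p.\<close>
    proof (rule Lim_transform_eventually[OF exp_bump_tendsto[of "[:0,1:] * p"]])
      show "\<forall>\<^sub>F x in at_right 0. poly ([:0, 1:] * p) (1 / x) * exp (- 1 / x) = (G p x - G p 0) / (x - 0)"
        by (auto simp: G_def eventually_at_right_less intro: eventually_mono[OF eventually_at_right_less])
    qed
    have l: "((\<lambda>y. (G p y - G p 0) / (y - 0)) \<longlongrightarrow> 0) (at_left 0)"
      by (rule Lim_transform_eventually[OF tendsto_const])
         (auto simp: G_def eventually_at_filter)
    show ?thesis using True filterlim_split_at_real[OF l r]
      by (auto simp: has_field_derivative_iff G_def)
  qed
  moreover have "times_diff n (G q)" using Suc[of q] unfolding G_def by simp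
  ultimately show ?case unfolding G_def[symmetric] by (intro times_diff_SucI) auto
qed auto

lemma smooth_step_exists:
  "\<exists>H. smooth_real H \<and> (\<forall>t\<le>-1. H t = 0) \<and> (\<forall>t\<ge>1. H t = 1) \<and> (\<forall>t. \<bar>H t\<bar> \<le> 1)"
proof -
  define e where "e = (\<lambda>x::real. if x > 0 then poly 1 (1/x) * exp (- 1/x) else 0)"
  have e: "smooth_real e" unfolding e_def smooth_real_def using times_diff_exp_bump by blast
  have e0: "e x \<ge> 0" "x \<le> 0 \<Longrightarrow> e x = 0" "x > 0 \<Longrightarrow> e x > 0" for x unfolding e_def by auto
  \<comment> \<open>1 + t and 1 - t are never both nonpositive, so the denominator is positive. The
    arguments have the affine form that \<open>smooth_real_compose_affine\<close> expects.\<close>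
  define H where "H t = e (1 * t + 1) * inverse (e (1 * t + 1) + e ((-1) * t + 1))" for t
  have pos: "e (1 * t + 1) + e ((-1) * t + 1) > 0" for t
    using e0(1)[of "1*t+1"] e0(1)[of "(-1)*t+1"] e0(3)[of "1*t+1"] e0(3)[of "(-1)*t+1"]
    by (cases "t > -1") auto
  have "smooth_real H" unfolding H_def
    by (intro smooth_real_mult smooth_real_inverse smooth_real_add smooth_real_compose_affine e)
       (use pos in \<open>metis less_irrefl\<close>)
  moreover have "H t = 0" if "t \<le> -1" for t using that e0(2) by (simp add: H_def)
  moreover have "H t = 1" if "t \<ge> 1" for t using that e0(2)[of "1-t"] e0(3)[of "t+1"] by (simp add: H_def)
  moreover have "\<bar>H t\<bar> \<le> 1" for t
    using pos[of t] e0(1) by (auto simp: H_def abs_mult divide_simps simp flip: divide_inverse)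
  ultimately show ?thesis by blast
qed

section \<open>Mollified point evaluations and their kernels\<close>


lemma iterated_deriv_const_zero: "(deriv ^^ k) (\<lambda>x::real. 0::real) = (\<lambda>x. 0)"
  by (induction k) auto

lemma iterated_deriv_monomial:
  "k \<le> n \<Longrightarrow> (deriv ^^ k) (\<lambda>t::real. t ^ n / fact n) = (\<lambda>t. t ^ (n - k) / fact (n - k))"
proof (induction k)
  case (Suc k)
  then have n: "n - k = Suc (n - Suc k)" by simp
  have "((\<lambda>t::real. t ^ (n - k) / fact (n - k)) has_real_derivative t ^ (n - Suc k) / fact (n - Suc k)) (at t)" for t
    unfolding n by (rule DERIV_cong[OF DERIV_cdivide[OF DERIV_pow]]) (simp add: fact_Suc del: of_nat_Suc)
  then show ?case using Suc by (auto intro!: DERIV_imp_deriv)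
qed auto

text \<open>The mollifier is the \<open>m\<close>-th derivative of \<open>E\<close>: it vanishes outside \<open>[-1, 1]\<close> and has integral 1
  because \<open>E\<close> is a truncated power smoothed near 0. Starting from \<open>E\<close> avoids integrating a bump function \<open>m\<close> times.\<close>

definition mollifier_primitive :: "nat \<Rightarrow> (real \<Rightarrow> real) \<Rightarrow> bool" where
  "mollifier_primitive m E \<longleftrightarrow> smooth_real E \<and> (\<forall>t\<le>-1. E t = 0) \<and>
     (\<forall>t\<ge>1. E t = t ^ (m - 1) / fact (m - 1)) \<and> (\<forall>t. \<bar>E t\<bar> \<le> (1 + \<bar>t\<bar>) ^ (m - 1))"

lemma mollifier_primitive_exists: "\<exists>E. mollifier_primitive m E"
proof -
  obtain H where H: "smooth_real H" "\<And>t. t \<le> -1 \<Longrightarrow> H t = 0" "\<And>t. t \<ge> 1 \<Longrightarrow> H t = 1"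
    "\<And>t. \<bar>H t\<bar> \<le> 1" using smooth_step_exists by blast
  define E where "E t = (1 / fact (m - 1)) * (t ^ (m - 1) * H t)" for t :: real
  have "smooth_real E" unfolding E_def
    by (intro smooth_real_mult smooth_real_const smooth_real_power H)
  moreover have "\<bar>E t\<bar> \<le> (1 + \<bar>t\<bar>) ^ (m - 1)" for t
  proof -
    have "\<bar>t\<bar> ^ (m - 1) * \<bar>H t\<bar> / fact (m - 1) \<le> \<bar>t\<bar> ^ (m - 1) * 1 / 1"
      by (intro frac_le mult_left_mono H) auto
    also have "\<dots> \<le> (1 + \<bar>t\<bar>) ^ (m - 1)" by (simp add: power_mono)
    finally show ?thesis by (simp add: E_def abs_mult power_abs)
  qed
  ultimately show ?thesis
    by (intro exI[of _ E]) (auto simp: mollifier_primitive_def E_def H)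
qed

lemma mollifier_primitive_left:
  assumes "mollifier_primitive m E" "t < -1"
  shows "(deriv ^^ k) E t = 0"
  using iterated_deriv_cong_open[of "{..<-1}" E "\<lambda>_. 0" t k] assms
  by (simp add: mollifier_primitive_def iterated_deriv_const_zero)

lemma mollifier_primitive_right:
  assumes "mollifier_primitive m E" "t > 1" "k \<le> m - 1"
  shows "(deriv ^^ k) E t = t ^ (m - 1 - k) / fact (m - 1 - k)"
  using iterated_deriv_cong_open[of "{1<..}" E "\<lambda>t. t ^ (m - 1) / fact (m - 1)" t k] assms
  by (simp add: mollifier_primitive_def iterated_deriv_monomial)

lemma mollifier_primitive_smooth: "mollifier_primitive m E \<Longrightarrow> smooth_real E"
  by (simp add: mollifier_primitive_def)

lemma mollifier_right:
  assumes "mollifier_primitive m E" "t > 1" "m \<ge> 1"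
  shows "(deriv ^^ m) E t = 0"
proof -
  have m: "m = Suc (m - 1)" using assms by simp
  have "(deriv ^^ Suc (m - 1)) E t = (deriv ^^ Suc (m - 1)) (\<lambda>t. t ^ (m - 1) / fact (m - 1)) t"
    using iterated_deriv_cong_open[of "{1<..}" E "\<lambda>t. t ^ (m - 1) / fact (m - 1)" t "Suc (m - 1)"] assms
    by (simp add: mollifier_primitive_def)
  \<comment> \<open>The monomial formula stops at order \<open>m - 1\<close>, where it yields the
    constant 1; one more derivative gives 0.\<close>
  also have "\<dots> = 0" using iterated_deriv_monomial[of "m - 1" "m - 1"] by simp
  finally show ?thesis using m by simp
qed

lemma continuous_bounded_real:
  fixes f :: "real \<Rightarrow> real"
  assumes "continuous_on {-1..1} f" "\<And>t. t < -1 \<Longrightarrow> \<bar>f t\<bar> \<le> 1" "\<And>t. t > 1 \<Longrightarrow> \<bar>f t\<bar> \<le> 1"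
  shows "\<exists>B>0. \<forall>t. \<bar>f t\<bar> \<le> B"
proof -
  have "bounded (f ` {-1..1})" by (intro compact_imp_bounded compact_continuous_image assms) auto
  then obtain B where B: "\<forall>t\<in>{-1..1}. \<bar>f t\<bar> \<le> B" by (auto simp: bounded_iff)
  have "\<bar>f t\<bar> \<le> max 1 B" for t using B assms(2,3)[of t] by (cases "t \<in> {-1..1}") force+
  then show ?thesis by (intro exI[of _ "max 1 B"]) auto
qed

text \<open>The derivative of order \<open>m - 1\<close> is a primitive of the mollifier, 0 left of
  -1 and 1 right of 1. Its bound serves on the coarsest level, where only one integration is
  possible.\<close>

lemma mollifier_bounded:
  assumes "mollifier_primitive m E" "m \<ge> 1"
  shows "\<exists>B>0. \<forall>t. \<bar>(deriv ^^ m) E t\<bar> \<le> B" "\<exists>B>0. \<forall>t. \<bar>(deriv ^^ (m - 1)) E t\<bar> \<le> B"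
proof -
  have c: "continuous_on {-1..1} ((deriv ^^ k) E)" for k
    by (intro smooth_real_continuous smooth_real_iterated_deriv mollifier_primitive_smooth[OF assms(1)])
  show "\<exists>B>0. \<forall>t. \<bar>(deriv ^^ m) E t\<bar> \<le> B"
    by (intro continuous_bounded_real c)
       (simp_all add: mollifier_primitive_left[OF assms(1)] mollifier_right[OF assms(1) _ assms(2)])
  show "\<exists>B>0. \<forall>t. \<bar>(deriv ^^ (m - 1)) E t\<bar> \<le> B"
    by (intro continuous_bounded_real c)
       (simp_all add: mollifier_primitive_left[OF assms(1)] mollifier_primitive_right[OF assms(1)])
qed

text \<open>The mollifier scaled to radius \<open>\<epsilon>\<close> around \<open>z\<close>, an
  approximate point evaluation. Its argument is (t - z)/\<epsilon>, spelt in the affine form of the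
  composition lemmas.\<close>

definition delta :: "nat \<Rightarrow> (real \<Rightarrow> real) \<Rightarrow> real \<Rightarrow> real \<Rightarrow> real \<Rightarrow> real" where
  "delta m E \<epsilon> z t = (deriv ^^ m) E ((1/\<epsilon>) * t + (- z/\<epsilon>)) / \<epsilon>"

text \<open>Contracts the interval towards its midpoint so that mollifiers of radius \<open>\<epsilon>\<close> stay in its interior;
  being affine, it preserves vanishing moments.\<close>

definition shrink :: "real \<Rightarrow> real \<Rightarrow> real \<Rightarrow> real \<Rightarrow> real" where
  "shrink lo hi \<epsilon> y = y + 2 * \<epsilon> * (lo + hi - 2 * y) / (hi - lo)"

text \<open>The margin 2\<epsilon> is twice the mollifier radius, so a mollifier at a contracted
  node still vanishes within \<epsilon> of the endpoints.\<close>

lemma shrink_bounds: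
  assumes "lo < hi" "y \<in> {lo..hi}" "0 < \<epsilon>" "\<epsilon> \<le> (hi - lo) / 4"
  shows "lo + 2 * \<epsilon> \<le> shrink lo hi \<epsilon> y" "shrink lo hi \<epsilon> y \<le> hi - 2 * \<epsilon>"
    "\<bar>shrink lo hi \<epsilon> y - y\<bar> \<le> 2 * \<epsilon>"
proof -
  have "shrink lo hi \<epsilon> y - lo - 2 * \<epsilon> = (y - lo) * (1 - 4 * \<epsilon> / (hi - lo))"
    using assms by (simp add: shrink_def field_simps)
  moreover have p: "1 - 4 * \<epsilon> / (hi - lo) \<ge> 0" using assms by (simp add: field_simps)
  moreover have "0 \<le> (y - lo) * (1 - 4 * \<epsilon> / (hi - lo))" using p assms(2) by (intro mult_nonneg_nonneg) auto
  ultimately show "lo + 2 * \<epsilon> \<le> shrink lo hi \<epsilon> y" by linarith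
  have "hi - 2 * \<epsilon> - shrink lo hi \<epsilon> y = (hi - y) * (1 - 4 * \<epsilon> / (hi - lo))"
    using assms by (simp add: shrink_def field_simps)
  moreover have "0 \<le> (hi - y) * (1 - 4 * \<epsilon> / (hi - lo))" using p assms(2) by (intro mult_nonneg_nonneg) auto
  ultimately show "shrink lo hi \<epsilon> y \<le> hi - 2 * \<epsilon>" by linarith
  have "\<bar>lo + hi - 2 * y\<bar> \<le> hi - lo" using assms(2) by auto
  then have "\<bar>lo + hi - 2 * y\<bar> / (hi - lo) \<le> 1" using assms(1) by simp
  then have "2 * \<epsilon> * (\<bar>lo + hi - 2 * y\<bar> / (hi - lo)) \<le> 2 * \<epsilon> * 1" using assms by (intro mult_left_mono) auto
  then show "\<bar>shrink lo hi \<epsilon> y - y\<bar> \<le> 2 * \<epsilon>"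
    using assms by (simp add: shrink_def abs_mult)
qed

text \<open>The derivatives of \<open>W s\<close> carry no bound, since they are to be moved onto
  \<open>f\<close>. The margin \<open>\<delta>\<close> makes tensor products of these functions test
  functions and may shrink with the mollifier radius; \<open>M\<close> and \<open>r\<close> may
  not.\<close>

definition kernel_family ::
  "real \<Rightarrow> real \<Rightarrow> nat \<Rightarrow> real \<Rightarrow> real \<Rightarrow> real \<Rightarrow> (nat \<Rightarrow> real \<Rightarrow> real) \<Rightarrow> bool" where
  "kernel_family lo hi m x r M W \<longleftrightarrow>
     (\<forall>s\<le>m. smooth_real (W s) \<and> (\<exists>\<delta>>0. \<forall>t. t \<notin> {lo + \<delta>..hi - \<delta>} \<longrightarrow> W s t = 0) \<and>
       (\<forall>t. \<bar>W s t\<bar> \<le> M) \<and> (\<forall>t. \<bar>t - x\<bar> > r \<longrightarrow> W s t = 0))"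

text \<open>The mollified functional \<open>f \<mapsto> \<Sum>y\<in>Z. b y * f y\<close> is a sum of derivatives of order at most \<open>m\<close> of test functions
  that are bounded by \<open>M\<close> and live within \<open>r\<close> of \<open>x\<close>, uniformly in \<open>\<epsilon>\<close>.\<close>

definition kernel_bound ::
  "real \<Rightarrow> real \<Rightarrow> nat \<Rightarrow> (real \<Rightarrow> real) \<Rightarrow> real set \<Rightarrow> (real \<Rightarrow> real) \<Rightarrow> real \<Rightarrow> real \<Rightarrow> real \<Rightarrow> bool" where
  "kernel_bound lo hi m E Z b x r M \<longleftrightarrow>
     (\<exists>e0>0. \<forall>\<epsilon>. 0 < \<epsilon> \<and> \<epsilon> < e0 \<longrightarrow>
       (\<exists>W :: nat \<Rightarrow> real \<Rightarrow> real.
         kernel_family lo hi m x r M W \<and>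
         (\<forall>t. (\<Sum>y\<in>Z. b y * delta m E \<epsilon> (shrink lo hi \<epsilon> y) t) = (\<Sum>s\<le>m. (deriv ^^ s) (W s) t))))"

text \<open>Covers the levels below \<open>L\<close>, where the altered operators vanish.\<close>

lemma kernel_bound_zero:
  assumes "lo < hi" "M \<ge> 0" "\<And>y. y \<in> Z \<Longrightarrow> b y = 0"
  shows "kernel_bound lo hi m E Z b x r M"
  unfolding kernel_bound_def
  by (intro exI[of _ 1] conjI allI impI exI[of _ "\<lambda>_ _. 0"])
     (use assms in \<open>auto simp: kernel_family_def smooth_real_const iterated_deriv_const_zero\<close>)

text \<open>By binomial expansion, moments of affinely moved nodes are combinations of the original
  ones. Applied to t minus the contracted node, as an affine function of the node.\<close>

lemma moments_affine:
  assumes "\<And>j. j < m \<Longrightarrow> (\<Sum>y\<in>Z. b y * y ^ j) = (0::real)" "k < m"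
  shows "(\<Sum>y\<in>Z. b y * (u * y + v) ^ k) = 0"
proof -
  have "(\<Sum>y\<in>Z. b y * (u * y + v) ^ k)
      = (\<Sum>y\<in>Z. \<Sum>j\<le>k. (of_nat (k choose j) * u ^ j * v ^ (k - j)) * (b y * y ^ j))"
    by (simp add: binomial_ring sum_distrib_left power_mult_distrib mult_ac)
  also have "\<dots> = (\<Sum>j\<le>k. (of_nat (k choose j) * u ^ j * v ^ (k - j)) * (\<Sum>y\<in>Z. b y * y ^ j))"
    by (subst sum.swap) (simp add: sum_distrib_left)
  also have "\<dots> = 0" using assms by (intro sum.neutral) auto
  finally show ?thesis .
qed

text \<open>A discrete Peano kernel. A combination of shifted copies of \<open>E\<close> vanishes to
  the left of all active nodes because \<open>E\<close> does; to their right it is a combination of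
  (t - node)^(m-1), which the moments annihilate. Hence it has compact support, and its
  \<open>m\<close>-th derivative is the mollified functional.\<close>

lemma kernel_bound_moments:
  assumes I: "lo < hi" "Z \<subseteq> {lo..hi}" and E: "mollifier_primitive m E" and m: "m \<ge> 1"
    and mom: "\<And>j. j < m \<Longrightarrow> (\<Sum>y\<in>Z. b y * y ^ j) = 0"
    and B: "(\<Sum>y\<in>Z. \<bar>b y\<bar>) \<le> B" and r: "r > 0"
    and near: "\<And>y. y \<in> Z \<Longrightarrow> b y \<noteq> 0 \<Longrightarrow> \<bar>y - x\<bar> \<le> r"
  shows "kernel_bound lo hi m E Z b x (4 * r) (B * (8 * r) ^ (m - 1))"
  unfolding kernel_bound_def
\<comment> \<open>\<open>\<epsilon>\<close> below \<open>r\<close> keeps the contracted active nodes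
  within 3r of \<open>x\<close>; below a quarter of the interval it makes
  \<open>shrink_bounds\<close> applicable.\<close>
proof (intro exI[of _ "min r ((hi - lo) / 4)"] conjI allI impI)
  show "0 < min r ((hi - lo) / 4)" using I r by auto
  fix \<epsilon> assume \<epsilon>: "0 < \<epsilon> \<and> \<epsilon> < min r ((hi - lo) / 4)"
  define \<theta> where "\<theta> = shrink lo hi \<epsilon>"
  have \<theta>: "lo + 2 * \<epsilon> \<le> \<theta> y" "\<theta> y \<le> hi - 2 * \<epsilon>" "\<bar>\<theta> y - y\<bar> \<le> 2 * \<epsilon>" if "y \<in> Z" for y
    using shrink_bounds[of lo hi y \<epsilon>] that I \<epsilon> unfolding \<theta>_def by auto
  \<comment> \<open>The factor \<open>\<epsilon> ^ (m - 1)\<close> undoes the scaling of the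
    polynomial piece and keeps \<open>w\<close> bounded as \<open>\<epsilon>\<close> tends to
    0.\<close>
  define w where "w t = (\<Sum>y\<in>Z. (b y * \<epsilon> ^ (m - 1)) * E ((1/\<epsilon>) * t + (- \<theta> y/\<epsilon>)))" for t
  define W where "W s = (if s = m then w else (\<lambda>_. 0))" for s
  have sE: "smooth_real (\<lambda>t. E ((1/\<epsilon>) * t + (- \<theta> y/\<epsilon>)))" for y
    by (intro smooth_real_compose_affine mollifier_primitive_smooth[OF E])
  have smooth: "smooth_real w" unfolding w_def
    by (intro smooth_real_sum smooth_real_mult smooth_real_const sE)
  have arg: "(1/\<epsilon>) * t + (- \<theta> y/\<epsilon>) = (t - \<theta> y) / \<epsilon>" for t y by (simp add: diff_divide_distrib)
  \<comment> \<open>\<open>Z\<close> may contain far nodes with \<open>b y = 0\<close>, so only the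
    active ones are compared with \<open>t\<close>.\<close>
  have left: "w t = 0" if "\<And>y. y \<in> Z \<Longrightarrow> b y \<noteq> 0 \<Longrightarrow> t - \<theta> y \<le> - \<epsilon>" for t
  proof -
    have "b y = 0 \<or> E ((t - \<theta> y) / \<epsilon>) = 0" if "y \<in> Z" for y
    proof (cases "b y = 0")
      case False
      then have "(t - \<theta> y) / \<epsilon> \<le> -1"
        using \<open>y \<in> Z \<Longrightarrow> b y \<noteq> 0 \<Longrightarrow> t - \<theta> y \<le> - \<epsilon>\<close>[OF that] \<epsilon>
        by (simp add: pos_divide_le_eq)
      then show ?thesis using E by (simp add: mollifier_primitive_def)
    qed simp
    then show ?thesis unfolding w_def arg by (intro sum.neutral) auto
  qed
  have right: "w t = 0" if "\<And>y. y \<in> Z \<Longrightarrow> b y \<noteq> 0 \<Longrightarrow> t - \<theta> y \<ge> \<epsilon>" for t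
  proof -
    have *: "b y * \<epsilon> ^ (m - 1) * E ((t - \<theta> y) / \<epsilon>) = (1 / fact (m - 1)) * (b y * (t - \<theta> y) ^ (m - 1))"
      if "y \<in> Z" for y
    proof (cases "b y = 0")
      case False
      then have "E ((t - \<theta> y) / \<epsilon>) = ((t - \<theta> y) / \<epsilon>) ^ (m - 1) / fact (m - 1)"
        using E \<epsilon> \<open>y \<in> Z \<Longrightarrow> b y \<noteq> 0 \<Longrightarrow> t - \<theta> y \<ge> \<epsilon>\<close>[OF that]
        by (auto simp: mollifier_primitive_def)
      then show ?thesis using \<epsilon> by (simp add: power_divide)
    qed simp
    have "w t = (1 / fact (m - 1)) * (\<Sum>y\<in>Z. b y * (t - \<theta> y) ^ (m - 1))"
      unfolding w_def arg sum_distrib_left by (intro sum.cong refl *)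
    also have "(\<Sum>y\<in>Z. b y * (t - \<theta> y) ^ (m - 1)) =
        (\<Sum>y\<in>Z. b y * ((4 * \<epsilon> / (hi - lo) - 1) * y + (t - 2 * \<epsilon> * (lo + hi) / (hi - lo))) ^ (m - 1))"
      using I by (intro sum.cong refl arg_cong2[where f = "(*)"] arg_cong2[where f = "(^)"])
        (simp add: \<theta>_def shrink_def algebra_simps add_divide_distrib diff_divide_distrib)
    also have "\<dots> = 0" using m mom by (intro moments_affine[where m = m]) auto
    finally show ?thesis by simp
  qed
  have sp: "w t = 0" if "t \<notin> {lo + \<epsilon>..hi - \<epsilon>}" for t
  proof (cases "t < lo + \<epsilon>")
    case True
    then show ?thesis using \<theta>(1) \<epsilon> by (intro left) force
  next
    case False
    then show ?thesis using \<theta>(2) that by (intro right) force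
  qed
  have far: "w t = 0" if "\<bar>t - x\<bar> > 4 * r" for t
  proof (cases "t - x > 4 * r")
    case True
    have "t - \<theta> y \<ge> \<epsilon>" if "y \<in> Z" "b y \<noteq> 0" for y using \<theta>(3)[OF that(1)] near[OF that] True \<epsilon> by auto
    then show ?thesis by (rule right)
  next
    case False
    have "t - \<theta> y \<le> - \<epsilon>" if "y \<in> Z" "b y \<noteq> 0" for y
      using \<theta>(3)[OF that(1)] near[OF that] False \<epsilon> \<open>\<bar>t - x\<bar> > 4 * r\<close> by auto
    then show ?thesis by (rule left)
  qed
  have B0: "B \<ge> 0" by (rule order.trans[OF sum_nonneg B]) simp
  have Eb: "\<bar>E t\<bar> \<le> (1 + \<bar>t\<bar>) ^ (m - 1)" for t using E by (simp add: mollifier_primitive_def)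
  have bound: "\<bar>w t\<bar> \<le> B * (8 * r) ^ (m - 1)" for t
  proof (cases "\<bar>t - x\<bar> > 4 * r")
    case False
    have "\<bar>w t\<bar> \<le> (\<Sum>y\<in>Z. \<bar>b y\<bar> * (8 * r) ^ (m - 1))" unfolding w_def arg
    proof (intro order.trans[OF sum_abs] sum_mono)
      fix y assume y: "y \<in> Z"
      show "\<bar>b y * \<epsilon> ^ (m - 1) * E ((t - \<theta> y) / \<epsilon>)\<bar> \<le> \<bar>b y\<bar> * (8 * r) ^ (m - 1)"
      proof (cases "b y = 0")
        case b: False
        have "\<epsilon> ^ (m - 1) * \<bar>E ((t - \<theta> y) / \<epsilon>)\<bar> \<le> \<epsilon> ^ (m - 1) * (1 + \<bar>(t - \<theta> y) / \<epsilon>\<bar>) ^ (m - 1)"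
          by (intro mult_left_mono Eb) (use \<epsilon> in simp)
        also have "\<dots> = (\<epsilon> + \<bar>t - \<theta> y\<bar>) ^ (m - 1)"
          using \<epsilon> by (simp add: power_mult_distrib[symmetric] field_simps)
        \<comment> \<open>\<epsilon> + |t - x| + |x - y| + 2\<epsilon> is at most r + 4r + r +
          2r.\<close>
        also have "\<dots> \<le> (8 * r) ^ (m - 1)"
          using \<theta>(3)[OF y] near[OF y b] False \<epsilon> by (intro power_mono) auto
        finally show ?thesis using \<epsilon> by (simp add: abs_mult mult.assoc mult_left_mono)
      qed simp
    qed
    also have "\<dots> = (\<Sum>y\<in>Z. \<bar>b y\<bar>) * (8 * r) ^ (m - 1)" by (simp add: sum_distrib_right)
    also have "\<dots> \<le> B * (8 * r) ^ (m - 1)" using r by (intro mult_right_mono B) auto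
    finally show ?thesis .
  qed (use far r B0 in auto)
  have der: "(\<Sum>y\<in>Z. b y * delta m E \<epsilon> (shrink lo hi \<epsilon> y) t) = (\<Sum>s\<le>m. (deriv ^^ s) (W s) t)" for t
  proof -
    have "(\<Sum>s\<le>m. (deriv ^^ s) (W s) t) = (\<Sum>s\<le>m. if s = m then (deriv ^^ m) w t else 0)"
      by (intro sum.cong) (auto simp: W_def iterated_deriv_const_zero)
    also have "\<dots> = (deriv ^^ m) w t" by simp
    also have "\<dots> = (\<Sum>y\<in>Z. (b y * \<epsilon> ^ (m - 1)) * ((1/\<epsilon>) ^ m * (deriv ^^ m) E ((1/\<epsilon>) * t + (- \<theta> y/\<epsilon>))))"
      unfolding w_def[abs_def] iterated_deriv_sum[OF sE]
        iterated_deriv_compose_affine[OF mollifier_primitive_smooth[OF E]] by simp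
    also have "\<dots> = (\<Sum>y\<in>Z. b y * delta m E \<epsilon> (\<theta> y) t)"
    proof -
      have "\<epsilon> ^ (m - 1) * (1/\<epsilon>) ^ m = 1 / \<epsilon>" using m \<epsilon>
        by (cases m) (auto simp: power_one_over)
      then have "b y * \<epsilon> ^ (m - 1) * ((1/\<epsilon>) ^ m * v) = b y * (v / \<epsilon>)" for y v
        by (metis (no_types) mult.assoc mult_1 times_divide_eq_left)
      then show ?thesis unfolding delta_def by simp
    qed
    finally show ?thesis unfolding \<theta>_def by simp
  qed
  show "\<exists>W. kernel_family lo hi m x (4 * r) (B * (8 * r) ^ (m - 1)) W \<and>
         (\<forall>t. (\<Sum>y\<in>Z. b y * delta m E \<epsilon> (shrink lo hi \<epsilon> y) t) = (\<Sum>s\<le>m. (deriv ^^ s) (W s) t))"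
  unfolding kernel_family_def
  proof (intro exI[of _ W] conjI allI impI)
    fix s show "smooth_real (W s)" using smooth by (simp add: W_def smooth_real_const)
    show "\<exists>\<delta>>0. \<forall>t. t \<notin> {lo + \<delta>..hi - \<delta>} \<longrightarrow> W s t = 0"
      using sp \<epsilon> by (intro exI[of _ \<epsilon>]) (simp add: W_def)
    fix t show "\<bar>W s t\<bar> \<le> B * (8 * r) ^ (m - 1)" using bound B0 r by (simp add: W_def)
    show "\<bar>t - x\<bar> > 4 * r \<Longrightarrow> W s t = 0" using far by (simp add: W_def)
  qed (rule der)
qed

text \<open>Without vanishing moments the mollified functional need not stay bounded as the radius
  tends to 0, but its primitive does. Compact support of the primitive requires total mass 0, which
  is arranged by splitting off a fixed smooth density. Orders 0 and 1 are both available since m is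
  at least 1.\<close>

lemma kernel_bound_coarse:
  assumes I: "lo < hi" and E: "mollifier_primitive m E" and m: "m \<ge> 1"
  shows "\<exists>C>0. \<forall>Z b x B. Z \<subseteq> {lo..hi} \<and> x \<in> {lo..hi} \<and> (\<Sum>y\<in>Z. \<bar>b y\<bar>) \<le> B \<longrightarrow>
    kernel_bound lo hi m E Z b x (hi - lo) (B * C)"
proof -
  obtain H where "smooth_real H \<and> (\<forall>t\<le>-1. H t = 0) \<and> (\<forall>t\<ge>1. H t = 1) \<and> (\<forall>t. \<bar>H t\<bar> \<le> 1)"
    using smooth_step_exists by blast
  then have H: "smooth_real H" "\<And>t. t \<le> -1 \<Longrightarrow> H t = 0" "\<And>t. t \<ge> 1 \<Longrightarrow> H t = 1" "\<And>t. \<bar>H t\<bar> \<le> 1"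
    and H': "mollifier_primitive 1 H" by (auto simp: mollifier_primitive_def)
  obtain B1 where B1: "B1 > 0" "\<And>t. \<bar>deriv H t\<bar> \<le> B1" using mollifier_bounded(1)[OF H'] by auto
  obtain B2 where B2: "B2 > 0" "\<And>t. \<bar>(deriv ^^ (m - 1)) E t\<bar> \<le> B2"
    using mollifier_bounded(2)[OF E m] by auto
  \<comment> \<open>Half-width of the split-off density, which occupies the middle half of the
    interval.\<close>
  define e where "e = (hi - lo) / 4"
  define c where "c = (lo + hi) / 2"
  have e: "e > 0" using I by (simp add: e_def)
  define C where "C = B1 / e + (B2 + 1)"
  have "C > 0" using B1 B2 e by (auto simp: C_def intro: add_nonneg_pos)
  moreover have "kernel_bound lo hi m E Z b x (hi - lo) (B * C)"
    if Z: "Z \<subseteq> {lo..hi}" "x \<in> {lo..hi}" and B: "(\<Sum>y\<in>Z. \<bar>b y\<bar>) \<le> B" for Z b x B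
    unfolding kernel_bound_def
  proof (intro exI[of _ e] conjI allI impI)
    show "e > 0" by fact
    fix \<epsilon> assume \<epsilon>: "0 < \<epsilon> \<and> \<epsilon> < e"
    define \<theta> where "\<theta> = shrink lo hi \<epsilon>"
    have \<theta>: "lo + 2 * \<epsilon> \<le> \<theta> y" "\<theta> y \<le> hi - 2 * \<epsilon>" if "y \<in> Z" for y
      using shrink_bounds[of lo hi y \<epsilon>] that I \<epsilon> Z unfolding \<theta>_def e_def by auto
    have B0: "B \<ge> 0" by (rule order.trans[OF sum_nonneg B]) simp
    have sb: "\<bar>\<Sum>y\<in>Z. b y\<bar> \<le> B" using B sum_abs[of b Z] by linarith
    define D where "D = (deriv ^^ (m - 1)) E"
    have sD: "smooth_real D" unfolding D_def by (intro smooth_real_iterated_deriv mollifier_primitive_smooth[OF E])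
    have D_left: "D s = 0" if "s < -1" for s using mollifier_primitive_left[OF E that] by (simp add: D_def)
    have D_right: "D s = 1" if "s > 1" for s using mollifier_primitive_right[OF E that] by (simp add: D_def)
    \<comment> \<open>Subtracting a fixed density of the same mass leaves a functional that annihilates constants.\<close>
    define w0 where "w0 t = ((\<Sum>y\<in>Z. b y) / e) * deriv H ((1/e) * t + (- c/e))" for t
    define w1 where "w1 t = (\<Sum>y\<in>Z. b y * (D ((1/\<epsilon>) * t + (- \<theta> y/\<epsilon>)) + (-1) * H ((1/e) * t + (- c/e))))" for t
    define W where "W s = (if s = 0 then w0 else if s = 1 then w1 else (\<lambda>_. 0))" for s :: nat
    have argH: "(1/e) * t + (- c/e) = (t - c) / e" for t by (simp add: diff_divide_distrib)
    have arg: "(1/\<epsilon>) * t + (- \<theta> y/\<epsilon>) = (t - \<theta> y) / \<epsilon>" for t y by (simp add: diff_divide_distrib)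
    have s0: "smooth_real w0" unfolding w0_def
      by (intro smooth_real_mult smooth_real_const smooth_real_compose_affine smooth_real_deriv H)
    have sy: "smooth_real (\<lambda>t. D ((1/\<epsilon>) * t + (- \<theta> y/\<epsilon>)) + (-1) * H ((1/e) * t + (- c/e)))" for y
      by (intro smooth_real_add smooth_real_mult smooth_real_const smooth_real_compose_affine sD H)
    have s1: "smooth_real w1" unfolding w1_def
      by (intro smooth_real_sum smooth_real_mult smooth_real_const sy)
    have b0: "\<bar>w0 t\<bar> \<le> B * C" for t
    proof -
      have "\<bar>w0 t\<bar> = \<bar>\<Sum>y\<in>Z. b y\<bar> * (\<bar>deriv H ((1/e) * t + (- c/e))\<bar> / e)"
        using e by (simp add: w0_def abs_mult)
      also have "\<dots> \<le> B * (B1 / e)" using e by (intro mult_mono divide_right_mono sb B1 B0) auto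
      also have "\<dots> \<le> B * C" using B2 by (intro mult_left_mono B0) (simp add: C_def)
      finally show ?thesis .
    qed
    have b1: "\<bar>w1 t\<bar> \<le> B * C" for t
    proof -
      have "\<bar>w1 t\<bar> \<le> (\<Sum>y\<in>Z. \<bar>b y\<bar> * (B2 + 1))" unfolding w1_def
      proof (intro order.trans[OF sum_abs] sum_mono)
        fix y
        have "\<bar>D ((1/\<epsilon>) * t + (- \<theta> y/\<epsilon>)) + (-1) * H ((1/e) * t + (- c/e))\<bar> \<le> B2 + 1"
          using B2(2)[of "(1/\<epsilon>) * t + (- \<theta> y/\<epsilon>)"] H(4)[of "(1/e) * t + (- c/e)"] unfolding D_def by linarith
        then show "\<bar>b y * (D ((1/\<epsilon>) * t + (- \<theta> y/\<epsilon>)) + (-1) * H ((1/e) * t + (- c/e)))\<bar> \<le> \<bar>b y\<bar> * (B2 + 1)"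
          unfolding abs_mult[of "b y"] by (intro mult_left_mono) auto
      qed
      also have "\<dots> = (\<Sum>y\<in>Z. \<bar>b y\<bar>) * (B2 + 1)" by (simp add: sum_distrib_right)
      also have "\<dots> \<le> B * C" using B1 B2 e B B0 by (intro mult_mono) (auto simp: C_def)
      finally show ?thesis .
    qed
    have out0: "w0 t = 0" if "t \<notin> {lo + \<epsilon>..hi - \<epsilon>}" for t
    proof -
      have "(t - c) / e < -1 \<or> (t - c) / e > 1"
        using that \<epsilon> e by (auto simp: field_simps c_def e_def)
      then have "deriv H ((t - c) / e) = 0"
        using mollifier_primitive_left[OF H', of _ 1] mollifier_right[OF H'] by auto
      then show ?thesis unfolding w0_def argH by simp
    qed
    have out1: "w1 t = 0" if t: "t \<notin> {lo + \<epsilon>..hi - \<epsilon>}" for t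
    proof (cases "t < lo + \<epsilon>")
      case True
      have "H ((t - c) / e) = 0" using True \<epsilon> e by (intro H) (auto simp: field_simps c_def e_def)
      moreover have "D ((t - \<theta> y) / \<epsilon>) = 0" if "y \<in> Z" for y
        using \<theta>(1)[OF that] True \<epsilon> by (intro D_left) (auto simp: field_simps)
      ultimately show ?thesis unfolding w1_def arg argH by simp
    next
      case False
      then have gt: "t > hi - \<epsilon>" using t by auto
      \<comment> \<open>To the right both primitives have reached 1 and cancel.\<close>
      have "H ((t - c) / e) = 1" using gt \<epsilon> e by (intro H) (auto simp: field_simps c_def e_def)
      moreover have "D ((t - \<theta> y) / \<epsilon>) = 1" if "y \<in> Z" for y
        using \<theta>(2)[OF that] gt \<epsilon> by (intro D_right) (auto simp: field_simps)
      ultimately show ?thesis unfolding w1_def arg argH by simp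
    qed
    have far: "t \<notin> {lo + \<epsilon>..hi - \<epsilon>}" if "\<bar>t - x\<bar> > hi - lo" for t using that Z(2) \<epsilon> by auto
    have der: "(\<Sum>y\<in>Z. b y * delta m E \<epsilon> (shrink lo hi \<epsilon> y) t) = (\<Sum>s\<le>m. (deriv ^^ s) (W s) t)" for t
    proof -
      have "{..m} = insert 0 (insert 1 {2..m})" using m by auto
      then have "(\<Sum>s\<le>m. (deriv ^^ s) (W s) t) = w0 t + deriv w1 t"
        by (simp add: W_def iterated_deriv_const_zero)
      also have "deriv w1 t = (\<Sum>y\<in>Z. b y * (deriv D ((1/\<epsilon>) * t + (- \<theta> y/\<epsilon>)) * (1/\<epsilon>) +
          (-1) * (deriv H ((1/e) * t + (- c/e)) * (1/e))))"
        unfolding w1_def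
        by (intro DERIV_imp_deriv DERIV_sum DERIV_cmult DERIV_add
            DERIV_chain2[where f = D] DERIV_chain2[where f = H] smooth_real_has_deriv sD H)
           (use \<epsilon> e in \<open>auto intro!: derivative_eq_intros\<close>)
      also have "deriv D = (deriv ^^ m) E" unfolding D_def using m by (cases m) auto
      also have "w0 t = (\<Sum>y\<in>Z. b y * (deriv H ((1/e) * t + (- c/e)) * (1/e)))"
        unfolding w0_def by (simp add: sum_distrib_right sum_divide_distrib)
      finally have "(\<Sum>s\<le>m. (deriv ^^ s) (W s) t) = (\<Sum>y\<in>Z. b y * ((deriv ^^ m) E ((1/\<epsilon>) * t + (- \<theta> y/\<epsilon>)) * (1/\<epsilon>)))"
        unfolding sum.distrib[symmetric] by (simp only: distrib_left[symmetric]) simp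
      then show ?thesis unfolding \<theta>_def delta_def by simp
    qed
    show "\<exists>W. kernel_family lo hi m x (hi - lo) (B * C) W \<and>
         (\<forall>t. (\<Sum>y\<in>Z. b y * delta m E \<epsilon> (shrink lo hi \<epsilon> y) t) = (\<Sum>s\<le>m. (deriv ^^ s) (W s) t))"
    unfolding kernel_family_def
    proof (intro exI[of _ W] conjI allI impI)
      fix s show "smooth_real (W s)" using s0 s1 by (simp add: W_def smooth_real_const)
      show "\<exists>\<delta>>0. \<forall>t. t \<notin> {lo + \<delta>..hi - \<delta>} \<longrightarrow> W s t = 0"
        using out0 out1 \<epsilon> by (intro exI[of _ \<epsilon>]) (simp add: W_def)
      fix t show "\<bar>W s t\<bar> \<le> B * C" using b0 b1 B0 \<open>C > 0\<close> by (simp add: W_def)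
      show "\<bar>t - x\<bar> > hi - lo \<Longrightarrow> W s t = 0" using far out0 out1 by (simp add: W_def)
    qed (rule der)
  qed
  ultimately show ?thesis by blast
qed

section \<open>Mollification on the cube\<close>


interpretation interval: product_sigma_finite "\<lambda>_::nat. restrict_space lborel {lo..hi::real}" for lo hi
  by (intro product_sigma_finite.intro sigma_finite_measure_restrict_space sigma_finite_lborel) auto

lemma space_cube_measure: "space (cube_measure {lo..hi} d) = cube {lo..hi} d"
  by (simp add: cube_measure_def cube_def space_PiM space_restrict_space)

lemma emeasure_cube_measure_PiE:
  assumes "\<And>i. i < d \<Longrightarrow> A i \<in> sets (restrict_space lborel {lo..hi::real})"
  shows "emeasure (cube_measure {lo..hi} d) (Pi\<^sub>E {..<d} A) = (\<Prod>i<d. emeasure lborel (A i))"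
proof -
  have "emeasure (cube_measure {lo..hi} d) (Pi\<^sub>E {..<d} A)
      = (\<Prod>i<d. emeasure (restrict_space lborel {lo..hi}) (A i))"
    unfolding cube_measure_def using assms by (intro interval.emeasure_PiM) auto
  also have "\<dots> = (\<Prod>i<d. emeasure lborel (A i))"
  proof (intro prod.cong refl)
    fix i assume "i \<in> {..<d}"
    then have "A i \<subseteq> {lo..hi}" using sets.sets_into_space[OF assms[of i]] by (simp add: space_restrict_space)
    then show "emeasure (restrict_space lborel {lo..hi}) (A i) = emeasure lborel (A i)"
      by (intro emeasure_restrict_space) auto
  qed
  finally show ?thesis .
qed

lemma finite_measure_cube_measure: "finite_measure (cube_measure {lo..hi} d)"
proof
  have "emeasure (cube_measure {lo..hi} d) (Pi\<^sub>E {..<d} (\<lambda>_. {lo..hi})) = (\<Prod>i<d. emeasure lborel {lo..hi})"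
    by (intro emeasure_cube_measure_PiE) (simp add: sets_restrict_space_iff)
  also have "\<dots> < \<infinity>"
    by (cases "lo \<le> hi") (auto simp: ennreal_prod_eq_top less_top[symmetric] power_eq_top_ennreal)
  finally show "emeasure (cube_measure {lo..hi} d) (space (cube_measure {lo..hi} d)) \<noteq> \<infinity>"
    by (simp add: space_cube_measure cube_def)
qed

lemma measurable_cube_component:
  assumes "g \<in> borel_measurable borel" "i < d"
  shows "(\<lambda>x. g (x i)) \<in> borel_measurable (cube_measure {lo..hi::real} d)"
proof -
  have "(\<lambda>x. x i) \<in> measurable (cube_measure {lo..hi} d) (restrict_space lborel {lo..hi})"
    unfolding cube_measure_def using assms(2) by (intro measurable_component_singleton) auto
  moreover have "g \<in> borel_measurable (restrict_space lborel {lo..hi})"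
    using assms(1) by (intro measurable_restrict_space1) simp
  ultimately show ?thesis by (rule measurable_compose)
qed

lemma measurable_cube_prod:
  fixes g :: "nat \<Rightarrow> real \<Rightarrow> real"
  assumes "\<And>i. i < d \<Longrightarrow> continuous_on UNIV (g i)"
  shows "(\<lambda>x. \<Prod>i<d. g i (x i)) \<in> borel_measurable (cube_measure {lo..hi::real} d)"
  using assms by (intro borel_measurable_prod measurable_cube_component borel_measurable_continuous_onI) auto

text \<open>Tychonoff: an extensional function is a point of the full product whose factors beyond
  \<open>d\<close> are the singleton \<open>{undefined}\<close>.\<close>

lemma compact_cube:
  assumes "\<And>i. i < d \<Longrightarrow> compact (S i)"
  shows "compact (Pi\<^sub>E {..<d::nat} S :: (nat \<Rightarrow> real) set)"
proof -
  define T where "T i = (if i < d then S i else {undefined})" for i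
  have "Pi\<^sub>E {..<d} S = Pi\<^sub>E UNIV T"
    by (auto simp: T_def PiE_def Pi_def extensional_def split: if_splits)
  moreover have "compactin (product_topology (\<lambda>i. euclidean) UNIV) (Pi\<^sub>E UNIV T)"
    unfolding compactin_PiE using assms by (auto simp: T_def)
  ultimately show ?thesis by (simp add: euclidean_product_topology)
qed

lemma cube_bounded:
  assumes "continuous_on (cube {lo..hi} d) f"
  shows "\<exists>B>0. \<forall>x\<in>cube {lo..hi} d. \<bar>f x\<bar> \<le> (B::real)"
proof -
  have "compact (cube {lo..hi} d)" unfolding cube_def by (intro compact_cube) auto
  then have "bounded (f ` cube {lo..hi} d)" using assms by (intro compact_imp_bounded compact_continuous_image)
  then show ?thesis by (auto simp: bounded_pos)
qed

text \<open>The metric on functions is a series with weights 2^(-n), whose sum gives the factor 2;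
  coordinates beyond \<open>d\<close> agree by extensionality. It converts uniform continuity in
  this metric into a coordinatewise statement.\<close>

lemma dist_cube_le:
  assumes "x \<in> cube I d" "y \<in> cube I d" "\<And>i. i < d \<Longrightarrow> \<bar>x i - y i\<bar> \<le> \<delta>" "\<delta> \<ge> 0"
  shows "dist x y \<le> 2 * \<delta>"
proof -
  have le: "dist (x n) (y n) \<le> \<delta>" for n
    using assms by (cases "n < d") (auto simp: cube_def PiE_def extensional_def dist_real_def)
  have sm: "summable (\<lambda>n. (1/2::real) ^ n * \<delta>)" by (intro summable_mult2) auto
  have t: "(1/2::real) ^ n * min (dist (x (from_nat n)) (y (from_nat n))) 1 \<le> (1/2) ^ n * \<delta>" for n
    using le[of "from_nat n"] by (intro mult_left_mono) auto
  have "summable (\<lambda>n. (1/2::real) ^ n * min (dist (x (from_nat n)) (y (from_nat n))) 1)"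
    by (rule summable_comparison_test'[OF sm]) (use t in auto)
  then have "dist x y \<le> (\<Sum>n. (1/2::real) ^ n * \<delta>)" unfolding dist_fun_def by (intro suminf_le t sm)
  also have "\<dots> = 2 * \<delta>" by (subst suminf_mult2[symmetric]) (auto simp: suminf_geometric)
  finally show ?thesis .
qed

lemma cube_uniformly_continuous:
  assumes "continuous_on (cube {lo..hi} d) f" "e > 0"
  shows "\<exists>\<delta>>0. \<forall>x\<in>cube {lo..hi} d. \<forall>y\<in>cube {lo..hi} d.
    (\<forall>i<d. \<bar>x i - y i\<bar> \<le> \<delta>) \<longrightarrow> \<bar>f x - f y\<bar> < (e::real)"
proof -
  have "compact (cube {lo..hi} d)" unfolding cube_def by (intro compact_cube) auto
  then have "uniformly_continuous_on (cube {lo..hi} d) f" using assms(1) by (intro compact_uniformly_continuous)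
  then obtain \<delta> where \<delta>: "\<delta> > 0" "\<forall>x\<in>cube {lo..hi} d. \<forall>y\<in>cube {lo..hi} d. dist y x < \<delta> \<longrightarrow> dist (f y) (f x) < e"
    using assms(2) by (auto simp: uniformly_continuous_on_def)
  have "\<bar>f x - f y\<bar> < e" if "x \<in> cube {lo..hi} d" "y \<in> cube {lo..hi} d" "\<forall>i<d. \<bar>x i - y i\<bar> \<le> \<delta> / 3" for x y
    using dist_cube_le[of x "{lo..hi}" d y "\<delta> / 3"] that \<delta> by (auto simp: dist_real_def)
  then show ?thesis using \<delta>(1) by (intro exI[of _ "\<delta> / 3"]) auto
qed

lemma integrable_continuous_interval:
  fixes g :: "real \<Rightarrow> real"
  assumes "continuous_on UNIV g"
  shows "integrable (restrict_space lborel {lo..hi}) g"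
  using borel_integrable_atLeastAtMost'[of lo hi g] assms
  by (subst integrable_restrict_space) (auto simp: set_integrable_def intro: continuous_on_subset)

section \<open>Support, mass and absolute mass of the mollifiers\<close>

lemma delta_continuous:
  assumes "mollifier_primitive m E"
  shows "continuous_on S (delta m E \<epsilon> z)"
proof -
  have "smooth_real (\<lambda>t. (1/\<epsilon>) * (deriv ^^ m) E ((1/\<epsilon>) * t + (- z/\<epsilon>)))"
    by (intro smooth_real_mult smooth_real_const smooth_real_compose_affine smooth_real_iterated_deriv
        mollifier_primitive_smooth[OF assms])
  then have "continuous_on S (\<lambda>t. (1/\<epsilon>) * (deriv ^^ m) E ((1/\<epsilon>) * t + (- z/\<epsilon>)))"
    by (rule smooth_real_continuous)
  then show ?thesis unfolding delta_def by simp
qed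

lemma delta_support:
  assumes "mollifier_primitive m E" "m \<ge> 1" "\<epsilon> > 0" "\<bar>t - z\<bar> > \<epsilon>"
  shows "delta m E \<epsilon> z t = 0"
proof -
  have "(t - z) / \<epsilon> < -1 \<or> (t - z) / \<epsilon> > 1" using assms(3,4) by (auto simp: field_simps)
  then have "(deriv ^^ m) E ((t - z) / \<epsilon>) = 0"
    using mollifier_primitive_left[OF assms(1)] mollifier_right[OF assms(1) _ assms(2)] by blast
  then show ?thesis by (simp add: delta_def diff_divide_distrib)
qed

text \<open>The primitive \<open>F\<close> of the mollifier rises from 0 at \<open>lo\<close> to 1
  at \<open>hi\<close>, because the margin 2\<epsilon> exceeds the mollifier radius.\<close>

lemma delta_integral:
  assumes "mollifier_primitive m E" "m \<ge> 1" "\<epsilon> > 0" "lo + 2 * \<epsilon> \<le> z" "z \<le> hi - 2 * \<epsilon>"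
  shows "(\<integral>t. delta m E \<epsilon> z t \<partial>restrict_space lborel {lo..hi}) = 1"
proof -
  define F where "F t = (deriv ^^ (m - 1)) E ((1/\<epsilon>) * t + (- z/\<epsilon>))" for t
  have m: "Suc (m - 1) = m" using assms by simp
  have "(\<integral>t. delta m E \<epsilon> z t \<partial>restrict_space lborel {lo..hi}) = (\<integral>t. delta m E \<epsilon> z t * indicator {lo..hi} t \<partial>lborel)"
    by (subst integral_restrict_space) (auto simp: mult.commute)
  also have "\<dots> = F hi - F lo"
  proof (rule integral_FTC_Icc_real)
    show "lo \<le> hi" using assms by linarith
    fix t
    have "(F has_real_derivative (deriv ^^ Suc (m - 1)) E ((1/\<epsilon>) * t + (- z/\<epsilon>)) * (1/\<epsilon>)) (at t)"
      unfolding F_def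
      by (rule DERIV_chain2[OF smooth_real_iterated_has_deriv[OF mollifier_primitive_smooth[OF assms(1)]]])
         (use assms in \<open>auto intro!: derivative_eq_intros\<close>)
    then show "(F has_real_derivative delta m E \<epsilon> z t) (at t)" unfolding m by (simp add: delta_def)
    show "isCont (delta m E \<epsilon> z) t"
      using delta_continuous[OF assms(1), of UNIV] by (simp add: continuous_on_eq_continuous_at)
  qed
  also have "F hi = 1"
  proof -
    have "(hi - z) / \<epsilon> > 1" using assms by (simp add: field_simps)
    then show ?thesis using mollifier_primitive_right[OF assms(1), of "(hi - z) / \<epsilon>" "m - 1"]
      by (simp add: F_def diff_divide_distrib)
  qed
  also have "F lo = 0"
  proof -
    have "(lo - z) / \<epsilon> < -1" using assms by (simp add: field_simps)
    then show ?thesis using mollifier_primitive_left[OF assms(1), of "(lo - z) / \<epsilon>" "m - 1"]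
      by (simp add: F_def diff_divide_distrib)
  qed
  finally show ?thesis by simp
qed

text \<open>The mollifier is not known to be nonnegative, so mass 1 does not control the absolute
  mass; height B/\<epsilon> times support length 2\<epsilon> does, uniformly in \<epsilon>.\<close>

lemma delta_abs_integral:
  assumes "mollifier_primitive m E" "m \<ge> 1" "\<epsilon> > 0" "\<And>t. \<bar>(deriv ^^ m) E t\<bar> \<le> B" "B > 0"
  shows "(\<integral>t. \<bar>delta m E \<epsilon> z t\<bar> \<partial>restrict_space lborel {lo..hi}) \<le> 2 * B"
proof -
  have int: "integrable lborel (\<lambda>t. indicator {lo..hi} t *\<^sub>R \<bar>delta m E \<epsilon> z t\<bar>)"
  proof -
    have "integrable (restrict_space lborel {lo..hi}) (\<lambda>t. \<bar>delta m E \<epsilon> z t\<bar>)"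
      by (intro integrable_continuous_interval continuous_intros delta_continuous assms)
    then show ?thesis by (simp add: integrable_restrict_space)
  qed
  have "(\<integral>t. \<bar>delta m E \<epsilon> z t\<bar> \<partial>restrict_space lborel {lo..hi})
      = (\<integral>t. indicator {lo..hi} t *\<^sub>R \<bar>delta m E \<epsilon> z t\<bar> \<partial>lborel)"
    by (subst integral_restrict_space) auto
  also have "\<dots> \<le> (\<integral>t. (B / \<epsilon>) * indicator {z - \<epsilon>..z + \<epsilon>} t \<partial>lborel)"
  proof (rule integral_mono[OF int])
    show "integrable lborel (\<lambda>t. (B / \<epsilon>) * indicator {z - \<epsilon>..z + \<epsilon>} t)"
      using assms(3) by (intro integrable_mult_right) (auto simp: integrable_indicator_iff)
    fix t
    show "indicator {lo..hi} t *\<^sub>R \<bar>delta m E \<epsilon> z t\<bar> \<le> (B / \<epsilon>) * indicator {z - \<epsilon>..z + \<epsilon>} t"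
    proof (cases "\<bar>t - z\<bar> > \<epsilon>")
      case True
      then show ?thesis using delta_support[OF assms(1-3) True] assms(3,5) by (auto simp: indicator_def)
    next
      case False
      then have "t \<in> {z - \<epsilon>..z + \<epsilon>}" by auto
      moreover have "\<bar>delta m E \<epsilon> z t\<bar> \<le> B / \<epsilon>"
        using assms(3,4) by (simp add: delta_def divide_right_mono)
      moreover have "B / \<epsilon> \<ge> 0" using assms by simp
      ultimately show ?thesis by (auto simp: indicator_def)
    qed
  qed
  also have "\<dots> = 2 * B" using assms(3) by (simp add: field_simps)
  finally show ?thesis .
qed

lemma integrable_cube_prod:
  assumes "\<And>i. i < d \<Longrightarrow> continuous_on UNIV (g i)"
  shows "integrable (cube_measure {lo..hi::real} d) (\<lambda>x. \<Prod>i<d. g i (x i) :: real)"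
proof -
  show ?thesis unfolding cube_measure_def
    using assms by (intro interval.product_integrable_prod integrable_continuous_interval) auto
qed

lemma integral_cube_prod:
  assumes "\<And>i. i < d \<Longrightarrow> continuous_on UNIV (g i)"
  shows "(\<integral>x. (\<Prod>i<d. g i (x i) :: real) \<partial>cube_measure {lo..hi::real} d)
     = (\<Prod>i<d. \<integral>t. g i t \<partial>restrict_space lborel {lo..hi})"
proof -
  show ?thesis unfolding cube_measure_def
    using assms by (intro interval.product_integral_prod integrable_continuous_interval) auto
qed

lemma integrable_cube_mult_prod:
  assumes "continuous_on (cube {lo..hi} d) f" "f \<in> borel_measurable (cube_measure {lo..hi} d)"
    and "\<And>i. i < d \<Longrightarrow> continuous_on UNIV (g i)"
  shows "integrable (cube_measure {lo..hi::real} d) (\<lambda>x. f x * (\<Prod>i<d. g i (x i) :: real))"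
proof -
  obtain B where B: "\<And>x. x \<in> cube {lo..hi} d \<Longrightarrow> \<bar>f x\<bar> \<le> B" using cube_bounded[OF assms(1)] by blast
  have bd: "norm (f x * (\<Prod>i<d. g i (x i))) \<le> norm (B * (\<Prod>i<d. g i (x i)))"
    if "x \<in> space (cube_measure {lo..hi} d)" for x
  proof -
    have "\<bar>f x\<bar> \<le> \<bar>B\<bar>" using B[of x] that by (simp add: space_cube_measure)
    then show ?thesis by (simp add: abs_mult mult_right_mono del: abs_prod)
  qed
  show ?thesis
    by (rule Bochner_Integration.integrable_bound[OF integrable_mult_right[OF integrable_cube_prod[of d g lo hi], of B]])
       (use assms bd in \<open>auto intro!: borel_measurable_times measurable_cube_prod\<close>)
qed

definition box_ind :: "nat \<Rightarrow> (nat \<Rightarrow> real) \<Rightarrow> (nat \<Rightarrow> real) \<Rightarrow> (nat \<Rightarrow> real) \<Rightarrow> real" where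
  "box_ind d r x t = (if \<forall>i<d. \<bar>t i - x i\<bar> \<le> r i then 1 else 0)"

lemma box_ind_commute: "box_ind d r x t = box_ind d r t x"
  by (simp add: box_ind_def abs_minus_commute)

lemma box_ind_square: "(box_ind d r x t)\<^sup>2 = box_ind d r x t"
  by (simp add: box_ind_def)

lemma box_ind_nonneg: "0 \<le> box_ind d r x t"
  by (simp add: box_ind_def)

text \<open>Both points may move, so that a fixed centre and the pair measure of Tonelli's theorem
  are covered at once.\<close>

lemma box_ind_measurable:
  assumes "\<And>i. i < d \<Longrightarrow> (\<lambda>p. \<bar>u p i - v p i\<bar>) \<in> borel_measurable M"
  shows "(\<lambda>p. box_ind d r (v p) (u p)) \<in> borel_measurable M"
  unfolding box_ind_def
proof (rule measurable_If)
  have "Measurable.pred M (\<lambda>p. \<bar>u p i - v p i\<bar> \<le> r i)" if "i < d" for i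
    unfolding pred_def by (rule borel_measurable_le) (auto intro!: assms that)
  then have "Measurable.pred M (\<lambda>p. \<forall>i\<in>{..<d}. \<bar>u p i - v p i\<bar> \<le> r i)"
    by (intro pred_intros_finite) auto
  then show "{p \<in> space M. \<forall>i<d. \<bar>u p i - v p i\<bar> \<le> r i} \<in> sets M"
    unfolding pred_def Ball_def lessThan_iff .
qed auto

lemma box_ind_measurable_cube:
  "(\<lambda>t. box_ind d r x t) \<in> borel_measurable (cube_measure {lo..hi} d)"
  by (intro box_ind_measurable measurable_cube_component[of "\<lambda>s. \<bar>s - x _\<bar>"]) auto

section \<open>Tensor kernels and weak derivatives\<close>


text \<open>An approximate identity up to the boundary: thanks to \<open>shrink\<close> the mass is
  exactly 1 even if \<open>z\<close> lies on a face of the cube. Possible sign changes of the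
  mollifier cost the factor \<open>K\<close>.\<close>

lemma mollified_tendsto:
  assumes I: "lo < hi" and E: "mollifier_primitive m E" and m: "m \<ge> 1"
    and f: "continuous_on (cube {lo..hi} d) f" "f \<in> borel_measurable (cube_measure {lo..hi} d)"
    and z: "z \<in> cube {lo..hi} d"
  shows "((\<lambda>\<epsilon>. \<integral>t. f t * (\<Prod>i<d. delta m E \<epsilon> (shrink lo hi \<epsilon> (z i)) (t i)) \<partial>cube_measure {lo..hi} d)
    \<longlongrightarrow> f z) (at_right 0)"
proof (rule tendstoI)
  fix e :: real assume e: "e > 0"
  let ?C = "cube_measure {lo..hi} d"
  obtain B where B: "B > 0" "\<And>t. \<bar>(deriv ^^ m) E t\<bar> \<le> B" using mollifier_bounded(1)[OF E m] by auto
  define K where "K = (2 * B) ^ d"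
  have K: "K > 0" using B by (simp add: K_def)
  obtain \<delta> where \<delta>: "\<delta> > 0" "\<And>x y. x \<in> cube {lo..hi} d \<Longrightarrow> y \<in> cube {lo..hi} d \<Longrightarrow>
    (\<And>i. i < d \<Longrightarrow> \<bar>x i - y i\<bar> \<le> \<delta>) \<Longrightarrow> \<bar>f x - f y\<bar> < e / (2 * K)"
    using cube_uniformly_continuous[OF f(1), of "e / (2 * K)"] e K by auto
  \<comment> \<open>The radius \<epsilon> plus the displacement 2\<epsilon> of the node stays below
    \<delta>, hence the third.\<close>
  have "dist (\<integral>t. f t * (\<Prod>i<d. delta m E \<epsilon> (shrink lo hi \<epsilon> (z i)) (t i)) \<partial>?C) (f z) < e"
    if \<epsilon>: "0 < \<epsilon>" "\<epsilon> < min (\<delta> / 3) ((hi - lo) / 4)" for \<epsilon>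
  proof -
    define D where "D i = delta m E \<epsilon> (shrink lo hi \<epsilon> (z i))" for i
    have zi: "z i \<in> {lo..hi}" if "i < d" for i using z that by (auto simp: cube_def PiE_def)
    have \<theta>: "lo + 2 * \<epsilon> \<le> shrink lo hi \<epsilon> (z i)" "shrink lo hi \<epsilon> (z i) \<le> hi - 2 * \<epsilon>"
      "\<bar>shrink lo hi \<epsilon> (z i) - z i\<bar> \<le> 2 * \<epsilon>" if "i < d" for i
      using shrink_bounds[of lo hi "z i" \<epsilon>] zi[OF that] I \<epsilon> by auto
    let ?P = "\<lambda>t. \<Prod>i<d. D i (t i)"
    have cD: "continuous_on UNIV (D i)" for i unfolding D_def by (rule delta_continuous[OF E])
    have iP: "integrable ?C ?P" by (intro integrable_cube_prod cD)
    have iA: "integrable ?C (\<lambda>t. \<Prod>i<d. \<bar>D i (t i)\<bar>)"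
      using integrable_cube_prod[of d "\<lambda>i t. \<bar>D i t\<bar>" lo hi] cD by (simp add: continuous_on_rabs)
    have ifP: "integrable ?C (\<lambda>t. f t * ?P t)" by (intro integrable_cube_mult_prod f cD)
    have one: "(\<integral>t. ?P t \<partial>?C) = 1"
      using delta_integral[OF E m \<epsilon>(1) \<theta>(1,2)] by (subst integral_cube_prod) (auto simp: cD, simp add: D_def)
    have abs: "(\<integral>t. (\<Prod>i<d. \<bar>D i (t i)\<bar>) \<partial>?C) \<le> K"
    proof -
      have "(\<integral>t. (\<Prod>i<d. \<bar>D i (t i)\<bar>) \<partial>?C) = (\<Prod>i<d. \<integral>t. \<bar>D i t\<bar> \<partial>restrict_space lborel {lo..hi})"
        using integral_cube_prod[of d "\<lambda>i t. \<bar>D i t\<bar>" lo hi] cD by (simp add: continuous_on_rabs)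
      also have "\<dots> \<le> (\<Prod>i<d. 2 * B)"
        unfolding D_def by (intro prod_mono conjI delta_abs_integral[OF E m \<epsilon>(1) B(2,1)] integral_nonneg_AE) auto
      finally show ?thesis by (simp add: K_def)
    qed
    have "(\<integral>t. f t * ?P t \<partial>?C) - f z
        = (\<integral>t. f t * ?P t \<partial>?C) - (\<integral>t. f z * ?P t \<partial>?C)"
      using one by simp
    also have "\<dots> = (\<integral>t. (f t - f z) * ?P t \<partial>?C)"
      using ifP iP by (subst Bochner_Integration.integral_diff[symmetric]) (auto simp: left_diff_distrib)
    finally have eq: "(\<integral>t. f t * ?P t \<partial>?C) - f z = (\<integral>t. (f t - f z) * ?P t \<partial>?C)" .
    have "\<bar>\<integral>t. (f t - f z) * ?P t \<partial>?C\<bar> \<le> (\<integral>t. \<bar>(f t - f z) * ?P t\<bar> \<partial>?C)"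
      by (rule integral_abs_bound)
    also have "\<dots> \<le> (\<integral>t. e / (2 * K) * (\<Prod>i<d. \<bar>D i (t i)\<bar>) \<partial>?C)"
    proof (rule integral_mono)
      show "integrable ?C (\<lambda>t. \<bar>(f t - f z) * ?P t\<bar>)"
        using Bochner_Integration.integrable_diff[OF ifP integrable_mult_right[OF iP, of "f z"]]
        by (intro integrable_abs) (auto simp: left_diff_distrib)
      show "integrable ?C (\<lambda>t. e / (2 * K) * (\<Prod>i<d. \<bar>D i (t i)\<bar>))" by (intro integrable_mult_right iA)
      fix t assume "t \<in> space ?C"
      then have t: "t \<in> cube {lo..hi} d" by (simp add: space_cube_measure)
      show "\<bar>(f t - f z) * ?P t\<bar> \<le> e / (2 * K) * (\<Prod>i<d. \<bar>D i (t i)\<bar>)"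
      proof (cases "\<forall>i<d. \<bar>t i - z i\<bar> \<le> \<delta>")
        case True
        then have "\<bar>f t - f z\<bar> \<le> e / (2 * K)" using \<delta>(2)[OF t z] by force
        then show ?thesis unfolding abs_mult abs_prod by (intro mult_right_mono prod_nonneg) auto
      next
        case False
        then obtain i where i: "i < d" "\<bar>t i - z i\<bar> > \<delta>" by force
        then have "\<bar>t i - shrink lo hi \<epsilon> (z i)\<bar> > \<epsilon>" using \<theta>(3)[OF i(1)] \<epsilon> by auto
        then have "D i (t i) = 0" unfolding D_def by (rule delta_support[OF E m \<epsilon>(1)])
        then have p0: "?P t = 0" using i(1) by auto
        have "0 \<le> e / (2 * K) * (\<Prod>i<d. \<bar>D i (t i)\<bar>)"
          by (intro mult_nonneg_nonneg prod_nonneg) (use e K in auto)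
        then show ?thesis unfolding p0 mult_zero_right abs_zero .
      qed
    qed
    also have "\<dots> \<le> e / (2 * K) * K" unfolding integral_mult_right_zero by (intro mult_left_mono[OF abs]) (use e K in simp)
    also have "\<dots> < e" using e K by simp
    finally show ?thesis using eq unfolding D_def dist_real_def by simp
  qed
  then show "\<forall>\<^sub>F \<epsilon> in at_right 0. dist (\<integral>t. f t * (\<Prod>i<d. delta m E \<epsilon> (shrink lo hi \<epsilon> (z i)) (t i)) \<partial>?C) (f z) < e"
    using \<delta>(1) I unfolding eventually_at_right_field
    by (intro exI[of _ "min (\<delta> / 3) ((hi - lo) / 4)"]) auto
qed

section \<open>Tensor products of smooth functions as test functions\<close>

definition tensor_fun :: "nat \<Rightarrow> (nat \<Rightarrow> real \<Rightarrow> real) \<Rightarrow> (nat \<Rightarrow> real) \<Rightarrow> real" where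
  "tensor_fun d \<phi> x = (\<Prod>i<d. \<phi> i (x i))"

lemma tensor_fun_has_partial_deriv:
  assumes "smooth_real (\<phi> j)" "j < d"
  shows "((\<lambda>t. tensor_fun d \<phi> (x(j := t))) has_real_derivative
    tensor_fun d (\<phi>(j := deriv (\<phi> j))) (x(j := s))) (at s)"
proof -
  have split: "tensor_fun d \<psi> (x(j := t)) = \<psi> j t * (\<Prod>i\<in>{..<d} - {j}. \<psi> i (x i))" for \<psi> t
    unfolding tensor_fun_def using assms(2) by (subst prod.remove[of _ j]) (auto intro!: prod.cong)
  have c: "(\<Prod>i\<in>{..<d} - {j}. (\<phi>(j := deriv (\<phi> j))) i (x i)) = (\<Prod>i\<in>{..<d} - {j}. \<phi> i (x i))"
    by (intro prod.cong) auto
  show ?thesis unfolding split c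
    using DERIV_cmult_right[OF smooth_real_has_deriv[OF assms(1)]] by simp
qed

lemma partial_deriv_tensor_fun:
  assumes "smooth_real (\<phi> j)" "j < d"
  shows "partial_deriv j (tensor_fun d \<phi>) = tensor_fun d (\<phi>(j := deriv (\<phi> j)))"
proof
  fix x
  show "partial_deriv j (tensor_fun d \<phi>) x = tensor_fun d (\<phi>(j := deriv (\<phi> j))) x"
    using DERIV_imp_deriv[OF tensor_fun_has_partial_deriv[of \<phi> j d x "x j", OF assms]]
    by (simp add: partial_deriv_def)
qed

lemma iterated_partial_deriv_tensor_fun:
  assumes "smooth_real (\<phi> j)" "j < d"
  shows "(partial_deriv j ^^ k) (tensor_fun d \<phi>) = tensor_fun d (\<phi>(j := (deriv ^^ k) (\<phi> j)))"
proof (induction k)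
  case (Suc k)
  let ?\<psi> = "\<phi>(j := (deriv ^^ k) (\<phi> j))"
  have "?\<psi>(j := deriv (?\<psi> j)) = \<phi>(j := (deriv ^^ Suc k) (\<phi> j))" by (auto simp: fun_eq_iff)
  moreover have "(partial_deriv j ^^ Suc k) (tensor_fun d \<phi>) = partial_deriv j (tensor_fun d ?\<psi>)"
    using Suc by (simp only: funpow.simps o_apply)
  moreover have "smooth_real (?\<psi> j)" using smooth_real_iterated_deriv[OF assms(1), of k] by simp
  ultimately show ?case using partial_deriv_tensor_fun[of ?\<psi> j d] assms(2) by (simp only:)
qed simp

text \<open>\<open>smooth\<close> quantifies over partial derivatives taken in any order; tensor
  products remain tensor products under each of them.\<close>

lemma foldr_partial_deriv_tensor_fun:
  assumes "\<And>i. smooth_real (\<phi> i)" "set js \<subseteq> {..<d}"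
  shows "\<exists>\<psi>. (\<forall>i. smooth_real (\<psi> i)) \<and> foldr partial_deriv js (tensor_fun d \<phi>) = tensor_fun d \<psi>"
  using assms(2)
proof (induction js)
  case (Cons j js)
  then obtain \<psi> where "\<And>i. smooth_real (\<psi> i)" "foldr partial_deriv js (tensor_fun d \<phi>) = tensor_fun d \<psi>" by auto
  then show ?case using partial_deriv_tensor_fun[of \<psi> j d] Cons.prems smooth_real_deriv
    by (intro exI[of _ "\<psi>(j := deriv (\<psi> j))"]) (auto simp: fun_upd_def)
qed (use assms in auto)

lemma multi_deriv_tensor_fun:
  assumes "\<And>i. smooth_real (\<phi> i)"
  shows "multi_deriv d \<alpha> (tensor_fun d \<phi>) = tensor_fun d (\<lambda>i. (deriv ^^ \<alpha> i) (\<phi> i))"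
proof -
  have "foldr (\<lambda>i. partial_deriv i ^^ \<alpha> i) js (tensor_fun d \<phi>)
      = tensor_fun d (\<lambda>i. if i \<in> set js then (deriv ^^ \<alpha> i) (\<phi> i) else \<phi> i)"
    if "distinct js" "set js \<subseteq> {..<d}" for js
    using that
  proof (induction js)
    case (Cons j js)
    let ?\<psi> = "\<lambda>i. if i \<in> set js then (deriv ^^ \<alpha> i) (\<phi> i) else \<phi> i"
    have "foldr (\<lambda>i. partial_deriv i ^^ \<alpha> i) (j # js) (tensor_fun d \<phi>)
        = tensor_fun d (?\<psi>(j := (deriv ^^ \<alpha> j) (?\<psi> j)))"
      using Cons assms iterated_partial_deriv_tensor_fun[of ?\<psi> j d "\<alpha> j"] by auto
    also have "?\<psi>(j := (deriv ^^ \<alpha> j) (?\<psi> j)) = (\<lambda>i. if i \<in> set (j # js) then (deriv ^^ \<alpha> i) (\<phi> i) else \<phi> i)"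
      using Cons.prems by auto
    finally show ?case .
  qed simp
  from this[of "[0..<d]"] have "multi_deriv d \<alpha> (tensor_fun d \<phi>)
      = tensor_fun d (\<lambda>i. if i \<in> set [0..<d] then (deriv ^^ \<alpha> i) (\<phi> i) else \<phi> i)"
    unfolding multi_deriv_def by (simp add: lessThan_atLeast0)
  then show ?thesis by (auto simp: tensor_fun_def fun_eq_iff intro!: prod.cong)
qed

lemma test_function_tensor_fun:
  assumes "\<And>i. smooth_real (\<phi> i)" "\<And>i. i < d \<Longrightarrow> \<exists>\<delta>>0. \<forall>t. t \<notin> {lo + \<delta>..hi - \<delta>} \<longrightarrow> \<phi> i t = 0"
  shows "test_function {lo..hi} d (tensor_fun d \<phi>)"
  unfolding test_function_def
proof
  show "smooth d (tensor_fun d \<phi>)" unfolding smooth_def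
  proof (intro allI impI)
    fix js :: "nat list" assume "set js \<subseteq> {..<d}"
    then obtain \<psi> where \<psi>: "\<And>i. smooth_real (\<psi> i)" "foldr partial_deriv js (tensor_fun d \<phi>) = tensor_fun d \<psi>"
      using foldr_partial_deriv_tensor_fun assms(1) by metis
    have "continuous_on S (tensor_fun d \<psi>)" for S
      unfolding tensor_fun_def
      by (intro continuous_on_prod continuous_on_compose2[OF smooth_real_continuous[OF \<psi>(1), of UNIV]]
          continuous_on_subset[OF continuous_on_product_coordinates]) auto
    then show "continuous_on (cube UNIV d) (foldr partial_deriv js (tensor_fun d \<phi>)) \<and>
        (\<forall>x\<in>cube UNIV d. \<forall>i<d. (\<lambda>t. foldr partial_deriv js (tensor_fun d \<phi>) (x(i := t))) differentiable at (x i))"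
      unfolding \<psi>(2) real_differentiable_def using tensor_fun_has_partial_deriv[of \<psi>, OF \<psi>(1)] by blast
  qed
  obtain \<delta> where \<delta>: "\<And>i. i < d \<Longrightarrow> \<delta> i > 0 \<and> (\<forall>t. t \<notin> {lo + \<delta> i..hi - \<delta> i} \<longrightarrow> \<phi> i t = 0)"
    using assms(2) by metis
  show "\<exists>K. compact K \<and> K \<subseteq> cube (interior {lo..hi}) d \<and> (\<forall>x\<in>cube UNIV d - K. tensor_fun d \<phi> x = 0)"
  proof (intro exI conjI ballI)
    show "compact (Pi\<^sub>E {..<d} (\<lambda>i. {lo + \<delta> i..hi - \<delta> i}))" by (intro compact_cube) auto
    show "Pi\<^sub>E {..<d} (\<lambda>i. {lo + \<delta> i..hi - \<delta> i}) \<subseteq> cube (interior {lo..hi}) d"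
      unfolding cube_def using \<delta> by (intro PiE_mono) force
    fix x assume "x \<in> cube UNIV d - Pi\<^sub>E {..<d} (\<lambda>i. {lo + \<delta> i..hi - \<delta> i})"
    then obtain i where "i < d" "x i \<notin> {lo + \<delta> i..hi - \<delta> i}" by (auto simp: cube_def PiE_iff simp del: atLeastAtMost_iff)
    then have "i < d" "\<phi> i (x i) = 0" using \<delta> by blast+
    then show "tensor_fun d \<phi> x = 0" by (auto simp: tensor_fun_def)
  qed
qed

lemma weak_D_properties:
  assumes "f \<in> H_mix I d m" "\<alpha> \<in> multi_indices d m"
  shows "square_integrable I d (weak_D I d \<alpha> f)" "weak_deriv I d \<alpha> f (weak_D I d \<alpha> f)"
proof -
  have "\<exists>g. square_integrable I d g \<and> weak_deriv I d \<alpha> f g" using assms by (simp add: H_mix_def)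
  from someI_ex[OF this]
  show "square_integrable I d (weak_D I d \<alpha> f)" "weak_deriv I d \<alpha> f (weak_D I d \<alpha> f)"
    by (simp_all add: weak_D_def)
qed

text \<open>An extended nonnegative integral, so that it can appear as a bound before finiteness or
  measurability in \<open>x\<close> is settled.\<close>

definition local_mass ::
  "real \<Rightarrow> real \<Rightarrow> nat \<Rightarrow> (nat \<Rightarrow> real) \<Rightarrow> (nat \<Rightarrow> real) \<Rightarrow> ((nat \<Rightarrow> real) \<Rightarrow> real) \<Rightarrow> ennreal" where
  "local_mass lo hi d r x g =
     (\<integral>\<^sup>+t. ennreal (box_ind d r x t * \<bar>g t\<bar>) \<partial>cube_measure {lo..hi} d)"

lemma finite_multi_indices: "finite (multi_indices d m)"
  unfolding multi_indices_def by (intro finite_PiE) auto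

text \<open>The duality argument. After mollification the functional is a product over the
  coordinates of sums of derivatives; expanding it gives mixed derivatives of tensor test functions,
  which the definition of weak derivatives moves onto \<open>f\<close>. The resulting bound does not
  contain \<open>\<epsilon>\<close>, so it survives the limit.\<close>

lemma tensor_kernel_bound:
  assumes I: "lo < hi" and E: "mollifier_primitive m E" and m: "m \<ge> 1"
    and f: "f \<in> H_mix {lo..hi} d m" and Z: "finite Z" "Z \<subseteq> {lo..hi}"
    and ker: "\<And>i. i < d \<Longrightarrow> kernel_bound lo hi m E Z (b i) (x i) (r i) (M i)"
  shows "ennreal \<bar>\<Sum>z\<in>{..<d} \<rightarrow>\<^sub>E Z. (\<Prod>i<d. b i (z i)) * f z\<bar>
    \<le> (\<Sum>\<alpha>\<in>multi_indices d m. ennreal (\<Prod>i<d. M i) * local_mass lo hi d r x (weak_D {lo..hi} d \<alpha> f))"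
    (is "_ \<le> ?rhs")
proof -
  let ?C = "cube_measure {lo..hi} d"
  let ?D = "\<lambda>\<epsilon> y. delta m E \<epsilon> (shrink lo hi \<epsilon> y)"
  have fc: "continuous_on (cube {lo..hi} d) f" and fm: "f \<in> borel_measurable ?C"
    using f by (auto simp: H_mix_def square_integrable_def)
  define S where "S \<epsilon> = (\<Sum>z\<in>{..<d} \<rightarrow>\<^sub>E Z. (\<Prod>i<d. b i (z i)) * (\<integral>t. f t * (\<Prod>i<d. ?D \<epsilon> (z i) (t i)) \<partial>?C))" for \<epsilon>
  have lim: "(S \<longlongrightarrow> (\<Sum>z\<in>{..<d} \<rightarrow>\<^sub>E Z. (\<Prod>i<d. b i (z i)) * f z)) (at_right 0)"
    unfolding S_def
    by (intro tendsto_sum tendsto_mult tendsto_const mollified_tendsto[OF I E m fc fm])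
       (use Z in \<open>auto simp: cube_def PiE_def\<close>)
  let ?P = "\<lambda>\<epsilon> i W. kernel_family lo hi m (x i) (r i) (M i) W \<and>
         (\<forall>t. (\<Sum>y\<in>Z. b i y * ?D \<epsilon> y t) = (\<Sum>s\<le>m. (deriv ^^ s) (W s) t))"
  \<comment> \<open>Finitely many coordinates share one threshold for
    \<open>\<epsilon>\<close>.\<close>
  have "\<forall>\<^sub>F \<epsilon> in at_right 0. \<forall>i\<in>{..<d}. \<exists>W. ?P \<epsilon> i W"
  proof (intro eventually_ball_finite ballI)
    fix i assume "i \<in> {..<d}"
    then have "kernel_bound lo hi m E Z (b i) (x i) (r i) (M i)" by (intro ker) simp
    then show "\<forall>\<^sub>F \<epsilon> in at_right 0. \<exists>W. ?P \<epsilon> i W"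
      unfolding kernel_bound_def eventually_at_right_field imp_conjL .
  qed simp
  then have "\<forall>\<^sub>F \<epsilon> in at_right 0. ennreal \<bar>S \<epsilon>\<bar> \<le> ?rhs"
  proof eventually_elim
    case (elim \<epsilon>)
    from bchoice[OF this] obtain W where "\<forall>i\<in>{..<d}. ?P \<epsilon> i (W i)" by (elim exE)
    then have W: "?P \<epsilon> i (W i)" if "i < d" for i using that by (elim ballE) auto
    have fW: "kernel_family lo hi m (x i) (r i) (M i) (W i)" if "i < d" for i using W[OF that] by (elim conjE)
    have sW: "smooth_real (W i s)" and zW: "\<exists>\<delta>>0. \<forall>t. t \<notin> {lo + \<delta>..hi - \<delta>} \<longrightarrow> W i s t = 0"
      and bW: "\<bar>W i s t\<bar> \<le> M i" and rW: "\<bar>t - x i\<bar> > r i \<Longrightarrow> W i s t = 0"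
      if "i < d" "s \<le> m" for i s t
      using fW[OF that(1)] that(2) unfolding kernel_family_def by blast+
    have dW: "(\<Sum>y\<in>Z. b i y * ?D \<epsilon> y t) = (\<Sum>s\<le>m. (deriv ^^ s) (W i s) t)" if "i < d" for i t
      using W[OF that] by (elim conjE) (rule spec)
    \<comment> \<open>Padding by 0 beyond \<open>d\<close> makes every factor smooth, as the lemmas
      on tensor products ask.\<close>
    define \<phi> where "\<phi> \<alpha> i = (if i < d then W i (\<alpha> i) else (\<lambda>_. 0))" for \<alpha> :: "nat \<Rightarrow> nat" and i
    define u where "u \<alpha> = tensor_fun d (\<phi> \<alpha>)" for \<alpha>
    have \<alpha>: "\<alpha> i \<le> m" if "\<alpha> \<in> multi_indices d m" "i < d" for \<alpha> i using that by (auto simp: multi_indices_def PiE_def)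
    have s\<phi>: "smooth_real (\<phi> \<alpha> i)" if "\<alpha> \<in> multi_indices d m" for \<alpha> i
      using sW \<alpha>[OF that] by (simp add: \<phi>_def smooth_real_const)
    have u_test: "test_function {lo..hi} d (u \<alpha>)" if "\<alpha> \<in> multi_indices d m" for \<alpha>
      unfolding u_def using s\<phi>[OF that] zW \<alpha>[OF that] by (intro test_function_tensor_fun) (auto simp: \<phi>_def)
    have u_deriv: "multi_deriv d \<alpha> (u \<alpha>) = (\<lambda>t. \<Prod>i<d. (deriv ^^ \<alpha> i) (W i (\<alpha> i)) (t i))"
      if "\<alpha> \<in> multi_indices d m" for \<alpha>
      unfolding u_def multi_deriv_tensor_fun[of "\<phi> \<alpha>", OF s\<phi>[OF that]]
      by (auto simp: tensor_fun_def \<phi>_def fun_eq_iff intro!: prod.cong)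
    let ?J = "\<lambda>\<alpha>. \<integral>t. f t * multi_deriv d \<alpha> (u \<alpha>) t \<partial>?C"
    have int: "integrable ?C (\<lambda>t. f t * multi_deriv d \<alpha> (u \<alpha>) t)" if "\<alpha> \<in> multi_indices d m" for \<alpha>
      unfolding u_deriv[OF that] using sW \<alpha>[OF that]
      by (intro integrable_cube_mult_prod fc fm smooth_real_continuous smooth_real_iterated_deriv) auto
    have "S \<epsilon> = (\<integral>t. (\<Sum>z\<in>{..<d} \<rightarrow>\<^sub>E Z. (\<Prod>i<d. b i (z i)) * (f t * (\<Prod>i<d. ?D \<epsilon> (z i) (t i)))) \<partial>?C)"
      unfolding S_def
      by (subst Bochner_Integration.integral_sum)
         (auto intro!: integrable_mult_right integrable_cube_mult_prod fc fm delta_continuous[OF E])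
    also have "\<dots> = (\<integral>t. (\<Sum>\<alpha>\<in>multi_indices d m. f t * multi_deriv d \<alpha> (u \<alpha>) t) \<partial>?C)"
    proof (intro Bochner_Integration.integral_cong refl)
      fix t
      have "(\<Sum>z\<in>{..<d} \<rightarrow>\<^sub>E Z. (\<Prod>i<d. b i (z i)) * (f t * (\<Prod>i<d. ?D \<epsilon> (z i) (t i))))
          = f t * (\<Sum>z\<in>{..<d} \<rightarrow>\<^sub>E Z. \<Prod>i<d. b i (z i) * ?D \<epsilon> (z i) (t i))"
        by (simp add: sum_distrib_left prod.distrib mult_ac)
      also have "(\<Sum>z\<in>{..<d} \<rightarrow>\<^sub>E Z. \<Prod>i<d. b i (z i) * ?D \<epsilon> (z i) (t i)) = (\<Prod>i<d. \<Sum>y\<in>Z. b i y * ?D \<epsilon> y (t i))"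
        using Z by (subst prod_sum_PiE) auto
      also have "\<dots> = (\<Prod>i<d. \<Sum>s\<le>m. (deriv ^^ s) (W i s) (t i))"
        using dW by (intro prod.cong) auto
      \<comment> \<open>Choosing an order of differentiation in each coordinate is choosing a
        multi-index.\<close>
      also have "\<dots> = (\<Sum>\<alpha>\<in>multi_indices d m. \<Prod>i<d. (deriv ^^ \<alpha> i) (W i (\<alpha> i)) (t i))"
        unfolding multi_indices_def by (subst prod_sum_PiE) auto
      finally show "(\<Sum>z\<in>{..<d} \<rightarrow>\<^sub>E Z. (\<Prod>i<d. b i (z i)) * (f t * (\<Prod>i<d. ?D \<epsilon> (z i) (t i))))
          = (\<Sum>\<alpha>\<in>multi_indices d m. f t * multi_deriv d \<alpha> (u \<alpha>) t)"
        by (simp add: sum_distrib_left u_deriv cong: sum.cong)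
    qed
    also have "\<dots> = (\<Sum>\<alpha>\<in>multi_indices d m. ?J \<alpha>)"
      by (intro Bochner_Integration.integral_sum int)
    finally have "\<bar>S \<epsilon>\<bar> \<le> (\<Sum>\<alpha>\<in>multi_indices d m. \<bar>?J \<alpha>\<bar>)"
      by (simp add: sum_abs)
    then have "ennreal \<bar>S \<epsilon>\<bar> \<le> ennreal (\<Sum>\<alpha>\<in>multi_indices d m. \<bar>?J \<alpha>\<bar>)"
      by (rule ennreal_leI)
    also have "\<dots> = (\<Sum>\<alpha>\<in>multi_indices d m. ennreal \<bar>?J \<alpha>\<bar>)"
      by (intro sum_ennreal[symmetric]) auto
    also have "\<dots> \<le> ?rhs"
    proof (rule sum_mono)
      fix \<alpha> assume a: "\<alpha> \<in> multi_indices d m"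
      define g where "g = weak_D {lo..hi} d \<alpha> f"
      have g: "square_integrable {lo..hi} d g" "weak_deriv {lo..hi} d \<alpha> f g"
        using weak_D_properties[OF f a] by (auto simp: g_def)
      have ub: "\<bar>g t * u \<alpha> t\<bar> \<le> (\<Prod>i<d. M i) * (box_ind d r x t * \<bar>g t\<bar>)" for t
      proof (cases "\<forall>i<d. \<bar>t i - x i\<bar> \<le> r i")
        case True
        have "\<bar>u \<alpha> t\<bar> \<le> (\<Prod>i<d. M i)"
          unfolding u_def tensor_fun_def abs_prod using bW \<alpha>[OF a] by (intro prod_mono) (auto simp: \<phi>_def)
        then show ?thesis unfolding box_ind_def if_P[OF True]
          by (simp add: abs_mult mult.commute[of "prod M _"] mult_left_mono)
      next
        case False
        then obtain i where i: "i < d" "\<bar>t i - x i\<bar> > r i" by force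
        then have "\<phi> \<alpha> i (t i) = 0" using rW[OF i(1) \<alpha>[OF a i(1)] i(2)] by (simp add: \<phi>_def)
        then have "u \<alpha> t = 0" using i(1) by (auto simp: u_def tensor_fun_def)
        then show ?thesis unfolding box_ind_def if_not_P[OF False] by simp
      qed
      have M: "(\<Prod>i<d. M i) \<ge> 0"
        using bW[of _ 0] by (intro prod_nonneg) (meson abs_ge_zero le0 lessThan_iff order.trans)
      have "\<bar>?J \<alpha>\<bar> = \<bar>\<integral>t. g t * u \<alpha> t \<partial>?C\<bar>"
        using g(2) u_test[OF a] unfolding weak_deriv_def by (simp add: abs_mult power_abs)
      also have "ennreal \<dots> \<le> (\<integral>\<^sup>+t. ennreal \<bar>g t * u \<alpha> t\<bar> \<partial>?C)"
      \<comment> \<open>The Bochner integral of a non-integrable function is 0 by convention, and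
        then the bound is trivial.\<close>
      proof (cases "integrable ?C (\<lambda>t. g t * u \<alpha> t)")
        case True
        then show ?thesis using integral_norm_bound_ennreal[OF True] by simp
      qed (simp add: not_integrable_integral_eq)
      also have "\<dots> \<le> (\<integral>\<^sup>+t. ennreal (\<Prod>i<d. M i) * ennreal (box_ind d r x t * \<bar>g t\<bar>) \<partial>?C)"
        using ub M by (intro nn_integral_mono) (simp add: ennreal_mult[symmetric] ennreal_leI box_ind_nonneg del: ennreal_le_iff)
      also have "\<dots> = ennreal (\<Prod>i<d. M i) * local_mass lo hi d r x g"
      proof -
        have [measurable]: "g \<in> borel_measurable ?C" using g(1) by (simp add: square_integrable_def)
        have "(\<lambda>t. ennreal (box_ind d r x t * \<bar>g t\<bar>)) \<in> borel_measurable ?C"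
          using box_ind_measurable_cube[of d r x lo hi] by measurable
        then show ?thesis unfolding local_mass_def by (rule nn_integral_cmult)
      qed
      finally show "ennreal \<bar>?J \<alpha>\<bar>
          \<le> ennreal (\<Prod>i<d. M i) * local_mass lo hi d r x (weak_D {lo..hi} d \<alpha> f)" unfolding g_def .
    qed
    finally show ?case .
  qed
  then show ?thesis
    by (rule tendsto_upperbound[OF tendsto_ennrealI[OF tendsto_rabs[OF lim]]]) simp
qed

section \<open>Bounds in the L2 norm\<close>


text \<open>Intended for majorants: values in \<open>ennreal\<close> allow sums to be integrated
  before their finiteness is known.\<close>

definition L2_le :: "'a measure \<Rightarrow> ('a \<Rightarrow> ennreal) \<Rightarrow> real \<Rightarrow> bool" where
  "L2_le M f w \<longleftrightarrow> f \<in> borel_measurable M \<and> 0 \<le> w \<and> (\<integral>\<^sup>+x. (f x)\<^sup>2 \<partial>M) \<le> ennreal (w\<^sup>2)"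

lemma ennreal_le_of_power2_le:
  assumes "(x::ennreal)\<^sup>2 \<le> ennreal (w\<^sup>2)" "w \<ge> 0"
  shows "x \<le> ennreal w"
proof (cases x)
  case (real r)
  then have "r\<^sup>2 \<le> w\<^sup>2" using assms by (simp add: ennreal_power ennreal_le_iff)
  then show ?thesis using real assms power2_le_imp_le[of r w] by (simp add: ennreal_leI)
next
  case top
  then show ?thesis using assms by (simp add: ennreal_top_eq_mult_iff power2_eq_square top_unique)
qed

text \<open>Minkowski's inequality, from the Cauchy-Schwarz bound of the mixed term.\<close>

lemma L2_le_add:
  assumes "L2_le M f a" "L2_le M g b"
  shows "L2_le M (\<lambda>x. f x + g x) (a + b)"
proof -
  have [measurable]: "f \<in> borel_measurable M" "g \<in> borel_measurable M"
    and ab: "a \<ge> 0" "b \<ge> 0" and fa: "(\<integral>\<^sup>+x. (f x)\<^sup>2 \<partial>M) \<le> ennreal (a\<^sup>2)" and gb: "(\<integral>\<^sup>+x. (g x)\<^sup>2 \<partial>M) \<le> ennreal (b\<^sup>2)"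
    using assms by (auto simp: L2_le_def)
  have "(\<integral>\<^sup>+x. f x * g x \<partial>M)\<^sup>2 \<le> (\<integral>\<^sup>+x. (f x)\<^sup>2 \<partial>M) * (\<integral>\<^sup>+x. (g x)\<^sup>2 \<partial>M)"
    by (rule Cauchy_Schwarz_nn_integral) measurable
  also have "\<dots> \<le> ennreal (a\<^sup>2) * ennreal (b\<^sup>2)" by (intro mult_mono fa gb) auto
  also have "\<dots> = ennreal ((a * b)\<^sup>2)" by (simp add: ennreal_mult power_mult_distrib)
  finally have fg: "(\<integral>\<^sup>+x. f x * g x \<partial>M) \<le> ennreal (a * b)"
    by (rule ennreal_le_of_power2_le) (use ab in simp)
  have "(\<integral>\<^sup>+x. (f x + g x)\<^sup>2 \<partial>M) = (\<integral>\<^sup>+x. (f x)\<^sup>2 + 2 * (f x * g x) + (g x)\<^sup>2 \<partial>M)"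
    by (simp add: power2_sum algebra_simps)
  also have "\<dots> = (\<integral>\<^sup>+x. (f x)\<^sup>2 \<partial>M) + 2 * (\<integral>\<^sup>+x. f x * g x \<partial>M) + (\<integral>\<^sup>+x. (g x)\<^sup>2 \<partial>M)"
    by (simp add: nn_integral_add nn_integral_cmult)
  also have "\<dots> \<le> ennreal (a\<^sup>2) + 2 * ennreal (a * b) + ennreal (b\<^sup>2)"
    by (intro add_mono mult_left_mono fa gb fg) auto
  also have "\<dots> = ennreal ((a + b)\<^sup>2)"
  proof -
    have "2 * ennreal (a * b) = ennreal (2 * (a * b))" using ab by (simp add: ennreal_mult)
    then show ?thesis using ab by (simp add: power2_sum ennreal_plus[symmetric] algebra_simps del: ennreal_plus)
  qed
  finally show ?thesis using ab by (simp add: L2_le_def)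
qed

lemma L2_le_zero: "L2_le M (\<lambda>x. 0) 0"
  by (simp add: L2_le_def)

lemma L2_le_sum:
  assumes "finite A" "\<And>k. k \<in> A \<Longrightarrow> L2_le M (f k) (w k)"
  shows "L2_le M (\<lambda>x. \<Sum>k\<in>A. f k x) (\<Sum>k\<in>A. w k)"
  using assms by (induction A rule: finite_induct) (auto simp: L2_le_zero intro: L2_le_add)

lemma L2_le_cmult:
  assumes "L2_le M f w" "c \<ge> 0"
  shows "L2_le M (\<lambda>x. ennreal c * f x) (c * w)"
proof -
  have [measurable]: "f \<in> borel_measurable M" and w: "w \<ge> 0" and fw: "(\<integral>\<^sup>+x. (f x)\<^sup>2 \<partial>M) \<le> ennreal (w\<^sup>2)"
    using assms by (auto simp: L2_le_def)
  have "(\<integral>\<^sup>+x. (ennreal c * f x)\<^sup>2 \<partial>M) = ennreal (c\<^sup>2) * (\<integral>\<^sup>+x. (f x)\<^sup>2 \<partial>M)"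
    using assms(2) by (simp add: power_mult_distrib ennreal_power nn_integral_cmult)
  also have "\<dots> \<le> ennreal (c\<^sup>2) * ennreal (w\<^sup>2)" by (intro mult_left_mono fw) auto
  also have "\<dots> = ennreal ((c * w)\<^sup>2)" by (simp add: ennreal_mult power_mult_distrib)
  finally show ?thesis using w assms(2) by (simp add: L2_le_def)
qed

lemma L2_le_weaken: "L2_le M f w \<Longrightarrow> w \<le> w' \<Longrightarrow> L2_le M f w'"
  unfolding L2_le_def by (auto elim!: order.trans intro!: ennreal_leI power_mono)

lemma L2_le_const: "\<exists>K\<ge>0. \<forall>e\<ge>0. L2_le (cube_measure {lo..hi} d) (\<lambda>x. ennreal e) (e * K)"
proof -
  interpret finite_measure "cube_measure {lo..hi} d" by (rule finite_measure_cube_measure)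
  let ?C = "cube_measure {lo..hi} d"
  have "L2_le ?C (\<lambda>x. ennreal e) (e * sqrt (measure ?C (space ?C)))" if "e \<ge> 0" for e
    using that by (simp add: L2_le_def emeasure_eq_measure ennreal_power power_mult_distrib ennreal_mult)
  then show ?thesis by (intro exI[of _ "sqrt (measure ?C (space ?C))"]) auto
qed

text \<open>The passage to a measurable majorant: the operators that stand between \<open>f\<close>
  and \<open>S\<close> in the pointwise estimate are never integrated.\<close>

lemma L2_cube_norm_le:
  assumes "square_integrable {lo..hi} d f" "L2_le (cube_measure {lo..hi} d) S w"
    and "\<And>x. x \<in> cube {lo..hi} d \<Longrightarrow> ennreal \<bar>f x\<bar> \<le> S x"
  shows "L2_cube_norm {lo..hi} d f \<le> w"
proof -
  let ?C = "cube_measure {lo..hi} d"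
  have "ennreal (\<integral>x. \<bar>f x\<bar>\<^sup>2 \<partial>?C) = (\<integral>\<^sup>+x. ennreal (\<bar>f x\<bar>\<^sup>2) \<partial>?C)"
    using assms(1) by (intro nn_integral_eq_integral[symmetric]) (auto simp: square_integrable_def)
  also have "\<dots> \<le> (\<integral>\<^sup>+x. (S x)\<^sup>2 \<partial>?C)"
  proof (rule nn_integral_mono)
    fix x assume "x \<in> space ?C"
    then have "(ennreal \<bar>f x\<bar>)\<^sup>2 \<le> (S x)\<^sup>2" by (intro power_mono assms(3)) (auto simp: space_cube_measure)
    then show "ennreal (\<bar>f x\<bar>\<^sup>2) \<le> (S x)\<^sup>2" by (simp add: ennreal_power del: power2_abs)
  qed
  also have "\<dots> \<le> ennreal (w\<^sup>2)" using assms(2) by (simp add: L2_le_def)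
  finally have "(\<integral>x. \<bar>f x\<bar>\<^sup>2 \<partial>?C) \<le> w\<^sup>2" by (simp add: ennreal_le_iff)
  then show ?thesis using assms(2) unfolding L2_cube_norm_def L2_le_def
    by (intro real_le_lsqrt) auto
qed

lemma prod_mono_ennreal_fun:
  fixes u v :: "'a \<Rightarrow> ennreal"
  assumes "\<And>i. i \<in> A \<Longrightarrow> u i \<le> v i"
  shows "prod u A \<le> prod v A"
  using assms by (induction A rule: infinite_finite_induct) (auto intro: mult_mono)

lemma box_ind_mass:
  assumes "\<And>i. i < d \<Longrightarrow> r i \<ge> 0"
  shows "(\<integral>\<^sup>+t. ennreal (box_ind d r x t) \<partial>cube_measure {lo..hi} d) \<le> ennreal (\<Prod>i<d. 2 * r i)"
proof -
  let ?C = "cube_measure {lo..hi} d"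
  let ?A = "\<lambda>i. {lo..hi} \<inter> {x i - r i..x i + r i}"
  have A: "?A i \<in> sets (restrict_space lborel {lo..hi})" for i by (auto simp: sets_restrict_space_iff)
  have sA: "Pi\<^sub>E {..<d} ?A \<in> sets ?C" unfolding cube_measure_def by (intro sets_PiM_I_finite A) auto
  have "(\<integral>\<^sup>+t. ennreal (box_ind d r x t) \<partial>?C) = (\<integral>\<^sup>+t. indicator (Pi\<^sub>E {..<d} ?A) t \<partial>?C)"
  proof (rule nn_integral_cong)
    fix t assume "t \<in> space ?C"
    then have t: "t \<in> {..<d} \<rightarrow>\<^sub>E {lo..hi}" by (simp add: space_cube_measure cube_def)
    have "(\<forall>i<d. \<bar>t i - x i\<bar> \<le> r i) \<longleftrightarrow> t \<in> Pi\<^sub>E {..<d} ?A"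
      using t unfolding PiE_iff by (auto simp: abs_le_iff algebra_simps)
    then show "ennreal (box_ind d r x t) = indicator (Pi\<^sub>E {..<d} ?A) t" by (simp add: box_ind_def)
  qed
  also have "\<dots> = (\<Prod>i<d. emeasure lborel (?A i))"
    unfolding nn_integral_indicator[OF sA] by (intro emeasure_cube_measure_PiE A)
  also have "\<dots> \<le> (\<Prod>i<d. ennreal (2 * r i))"
  proof (intro prod_mono_ennreal_fun)
    fix i assume "i \<in> {..<d}"
    have "emeasure lborel (?A i) \<le> emeasure lborel {x i - r i..x i + r i}" by (intro emeasure_mono) auto
    also have "\<dots> = ennreal (2 * r i)" using assms \<open>i \<in> {..<d}\<close> by simp
    finally show "emeasure lborel (?A i) \<le> ennreal (2 * r i)" .
  qed
  also have "\<dots> = ennreal (\<Prod>i<d. 2 * r i)" using assms by (intro prod_ennreal) auto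
  finally show ?thesis .
qed

text \<open>Schur's test for averaging over a box. Cauchy-Schwarz, with the indicator as its own
  square, yields one factor of the box volume; Tonelli and the symmetry of \<open>box_ind\<close>
  yield the other.\<close>

lemma L2_le_local_mass:
  assumes g: "square_integrable {lo..hi} d g" and r: "\<And>i. i < d \<Longrightarrow> r i \<ge> 0"
  shows "L2_le (cube_measure {lo..hi} d) (\<lambda>x. local_mass lo hi d r x g)
    ((\<Prod>i<d. 2 * r i) * L2_cube_norm {lo..hi} d g)"
proof -
  let ?C = "cube_measure {lo..hi} d"
  let ?h = "\<lambda>x t. ennreal (box_ind d r x t * \<bar>g t\<bar>\<^sup>2)"
  let ?R = "\<Prod>i<d. 2 * r i"
  interpret C: finite_measure ?C by (rule finite_measure_cube_measure)
  interpret pair_sigma_finite ?C ?C ..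
  have R: "?R \<ge> 0" using r by (intro prod_nonneg) auto
  have gm[measurable]: "g \<in> borel_measurable ?C" and gi: "integrable ?C (\<lambda>x. \<bar>g x\<bar>\<^sup>2)"
    using g by (auto simp: square_integrable_def)
  have bm[measurable]: "(\<lambda>t. box_ind d r x t) \<in> borel_measurable ?C" for x by (rule box_ind_measurable_cube)
  have pm[measurable]: "(\<lambda>p. box_ind d r (fst p) (snd p)) \<in> borel_measurable (?C \<Otimes>\<^sub>M ?C)"
  proof (rule box_ind_measurable)
    fix i assume "i < d"
    then have [measurable]: "(\<lambda>x. x i) \<in> borel_measurable ?C" by (intro measurable_cube_component[of "\<lambda>s. s"]) auto
    show "(\<lambda>p. \<bar>snd p i - fst p i\<bar>) \<in> borel_measurable (?C \<Otimes>\<^sub>M ?C)" by measurable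
  qed
  have lm: "local_mass lo hi d r x g = (\<integral>\<^sup>+t. ennreal (box_ind d r x t) * ennreal (box_ind d r x t * \<bar>g t\<bar>) \<partial>?C)" for x
    unfolding local_mass_def by (intro nn_integral_cong) (simp add: box_ind_def)
  have mass: "(\<integral>\<^sup>+t. ennreal (box_ind d r x t) \<partial>?C) \<le> ennreal ?R" for x by (intro box_ind_mass r)
  have lm2: "(local_mass lo hi d r x g)\<^sup>2 \<le> ennreal ?R * (\<integral>\<^sup>+t. ?h x t \<partial>?C)" for x
  proof -
    have "(local_mass lo hi d r x g)\<^sup>2 \<le> (\<integral>\<^sup>+t. (ennreal (box_ind d r x t))\<^sup>2 \<partial>?C) * (\<integral>\<^sup>+t. (ennreal (box_ind d r x t * \<bar>g t\<bar>))\<^sup>2 \<partial>?C)"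
      unfolding lm by (rule Cauchy_Schwarz_nn_integral) measurable
    also have "\<dots> = (\<integral>\<^sup>+t. ennreal (box_ind d r x t) \<partial>?C) * (\<integral>\<^sup>+t. ?h x t \<partial>?C)"
      by (simp add: ennreal_power box_ind_nonneg box_ind_square power_mult_distrib del: power2_abs)
    also have "\<dots> \<le> ennreal ?R * (\<integral>\<^sup>+t. ?h x t \<partial>?C)"
      by (intro mult_right_mono mass) auto
    finally show ?thesis .
  qed
  have jm[measurable]: "(\<lambda>p. ennreal (box_ind d r (fst p) (snd p) * \<bar>g (snd p)\<bar>\<^sup>2)) \<in> borel_measurable (?C \<Otimes>\<^sub>M ?C)"
    by measurable
  have meas: "(\<lambda>x. local_mass lo hi d r x g) \<in> borel_measurable ?C"
  proof -
    have "(\<lambda>p. ennreal (box_ind d r (fst p) (snd p)) * ennreal (box_ind d r (fst p) (snd p) * \<bar>g (snd p)\<bar>))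
        \<in> borel_measurable (?C \<Otimes>\<^sub>M ?C)" by measurable
    from C.borel_measurable_nn_integral_fst[OF this] show ?thesis unfolding lm by simp
  qed
  have gI: "(\<integral>\<^sup>+t. ennreal (\<bar>g t\<bar>\<^sup>2) \<partial>?C) = ennreal ((L2_cube_norm {lo..hi} d g)\<^sup>2)"
    using nn_integral_eq_integral[OF gi] by (simp add: L2_cube_norm_def integral_nonneg_AE)
  have im: "(\<lambda>x. \<integral>\<^sup>+t. ?h x t \<partial>?C) \<in> borel_measurable ?C"
    using C.borel_measurable_nn_integral_fst[OF jm] by simp
  have "(\<integral>\<^sup>+x. \<integral>\<^sup>+t. ?h x t \<partial>?C \<partial>?C) = (\<integral>\<^sup>+t. \<integral>\<^sup>+x. ?h x t \<partial>?C \<partial>?C)"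
    using Fubini'[of ?h] jm by (simp add: case_prod_beta')
  also have "\<dots> \<le> (\<integral>\<^sup>+t. ennreal ?R * ennreal (\<bar>g t\<bar>\<^sup>2) \<partial>?C)"
  proof (rule nn_integral_mono)
    fix t
    have "(\<integral>\<^sup>+x. ?h x t \<partial>?C) = (\<integral>\<^sup>+x. ennreal (box_ind d r t x) * ennreal (\<bar>g t\<bar>\<^sup>2) \<partial>?C)"
      by (simp add: box_ind_commute[of d r t] ennreal_mult box_ind_nonneg)
    also have "\<dots> = (\<integral>\<^sup>+x. ennreal (box_ind d r t x) \<partial>?C) * ennreal (\<bar>g t\<bar>\<^sup>2)"
      by (intro nn_integral_multc) measurable
    also have "\<dots> \<le> ennreal ?R * ennreal (\<bar>g t\<bar>\<^sup>2)" by (intro mult_right_mono mass) auto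
    finally show "(\<integral>\<^sup>+x. ?h x t \<partial>?C) \<le> ennreal ?R * ennreal (\<bar>g t\<bar>\<^sup>2)" .
  qed
  also have "(\<integral>\<^sup>+t. ennreal ?R * ennreal (\<bar>g t\<bar>\<^sup>2) \<partial>?C) = ennreal ?R * ennreal ((L2_cube_norm {lo..hi} d g)\<^sup>2)"
    unfolding gI[symmetric] by (intro nn_integral_cmult) measurable
  finally have "(\<integral>\<^sup>+x. \<integral>\<^sup>+t. ?h x t \<partial>?C \<partial>?C)
      \<le> ennreal ?R * ennreal ((L2_cube_norm {lo..hi} d g)\<^sup>2)" .
  then have double: "ennreal ?R * (\<integral>\<^sup>+x. \<integral>\<^sup>+t. ?h x t \<partial>?C \<partial>?C)
      \<le> ennreal ?R * (ennreal ?R * ennreal ((L2_cube_norm {lo..hi} d g)\<^sup>2))" by (rule mult_left_mono) simp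
  have "(\<integral>\<^sup>+x. (local_mass lo hi d r x g)\<^sup>2 \<partial>?C) \<le> (\<integral>\<^sup>+x. ennreal ?R * (\<integral>\<^sup>+t. ?h x t \<partial>?C) \<partial>?C)"
    by (intro nn_integral_mono lm2)
  also have "\<dots> = ennreal ?R * (\<integral>\<^sup>+x. \<integral>\<^sup>+t. ?h x t \<partial>?C \<partial>?C)"
    by (rule nn_integral_cmult[OF im])
  also note double
  also have "ennreal ?R * (ennreal ?R * ennreal ((L2_cube_norm {lo..hi} d g)\<^sup>2))
      = ennreal ((?R * L2_cube_norm {lo..hi} d g)\<^sup>2)"
  proof -
    define R' where "R' = ?R"
    have "R' \<ge> 0" using R by (simp add: R'_def)
    then have "ennreal R' * (ennreal R' * ennreal ((L2_cube_norm {lo..hi} d g)\<^sup>2))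
        = ennreal (R' * (R' * (L2_cube_norm {lo..hi} d g)\<^sup>2))" by (simp add: ennreal_mult)
    then show ?thesis unfolding R'_def[symmetric] by (simp add: power_mult_distrib power2_eq_square mult_ac)
  qed
  finally have "(\<integral>\<^sup>+x. (local_mass lo hi d r x g)\<^sup>2 \<partial>?C) \<le> ennreal ((?R * L2_cube_norm {lo..hi} d g)\<^sup>2)" .
  then show ?thesis using R meas by (auto simp: L2_le_def L2_cube_norm_def intro!: mult_nonneg_nonneg)
qed

text \<open>Each \<open>x\<close> lies in at most n^d of the boxes, so Cauchy-Schwarz costs n^d, and
  integrating the boxes costs their volume. Quasi-uniformity will provide the overlap bound
  \<open>n\<close>.\<close>

lemma L2_le_local_discrete_sum:
  assumes Y: "\<And>i. i < d \<Longrightarrow> finite (Y i)" and r: "\<And>i. i < d \<Longrightarrow> r i \<ge> 0"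
    and n: "\<And>i s. i < d \<Longrightarrow> real (card {y \<in> Y i. \<bar>s - y\<bar> \<le> r i}) \<le> n" and n0: "n \<ge> 0"
  shows "L2_le (cube_measure {lo..hi} d) (\<lambda>x. ennreal (\<Sum>z\<in>Pi\<^sub>E {..<d} Y. box_ind d r z x * \<bar>f z\<bar>))
    (sqrt (n ^ d * (\<Prod>i<d. 2 * r i)) * discrete_norm (Pi\<^sub>E {..<d} Y) f)"
proof -
  let ?C = "cube_measure {lo..hi} d"
  let ?R = "\<Prod>i<d. 2 * r i"
  let ?Z = "Pi\<^sub>E {..<d} Y"
  have R: "?R \<ge> 0" using r by (intro prod_nonneg) auto
  have fin: "finite ?Z" using Y by (intro finite_PiE) auto
  have bm[measurable]: "(\<lambda>t. box_ind d r x t) \<in> borel_measurable ?C" for x by (rule box_ind_measurable_cube)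
  have cnt: "(\<Sum>z\<in>?Z. box_ind d r z x) \<le> n ^ d" for x
  proof -
    have "(\<Sum>z\<in>?Z. box_ind d r z x) = (\<Sum>z\<in>?Z. if z \<in> Pi\<^sub>E {..<d} (\<lambda>i. {y \<in> Y i. \<bar>x i - y\<bar> \<le> r i}) then 1 else 0)"
      by (intro sum.cong refl) (auto simp: box_ind_def PiE_iff)
    also have "\<dots> = real (card (?Z \<inter> Pi\<^sub>E {..<d} (\<lambda>i. {y \<in> Y i. \<bar>x i - y\<bar> \<le> r i})))"
      using fin by (simp add: sum.If_cases)
    also have "?Z \<inter> Pi\<^sub>E {..<d} (\<lambda>i. {y \<in> Y i. \<bar>x i - y\<bar> \<le> r i}) = Pi\<^sub>E {..<d} (\<lambda>i. {y \<in> Y i. \<bar>x i - y\<bar> \<le> r i})"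
      by (auto simp: PiE_iff)
    also have "real (card \<dots>) = (\<Prod>i<d. real (card {y \<in> Y i. \<bar>x i - y\<bar> \<le> r i}))"
      by (simp add: card_PiE)
    also have "\<dots> \<le> (\<Prod>i<d. n)" using n by (intro prod_mono) auto
    finally show ?thesis by simp
  qed
  have sq: "(\<Sum>z\<in>?Z. box_ind d r z x * \<bar>f z\<bar>)\<^sup>2 \<le> n ^ d * (\<Sum>z\<in>?Z. box_ind d r z x * \<bar>f z\<bar>\<^sup>2)" for x
  proof -
    have "(\<Sum>z\<in>?Z. box_ind d r z x * \<bar>f z\<bar>)\<^sup>2 = (\<Sum>z\<in>?Z. box_ind d r z x * (box_ind d r z x * \<bar>f z\<bar>))\<^sup>2"
      by (simp add: mult.assoc[symmetric] power2_eq_square[symmetric] box_ind_square)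
    also have "\<dots> \<le> (\<Sum>z\<in>?Z. (box_ind d r z x)\<^sup>2) * (\<Sum>z\<in>?Z. (box_ind d r z x * \<bar>f z\<bar>)\<^sup>2)"
      by (rule Cauchy_Schwarz_ineq_sum)
    also have "\<dots> = (\<Sum>z\<in>?Z. box_ind d r z x) * (\<Sum>z\<in>?Z. box_ind d r z x * \<bar>f z\<bar>\<^sup>2)"
      by (simp add: power_mult_distrib box_ind_square)
    also have "\<dots> \<le> n ^ d * (\<Sum>z\<in>?Z. box_ind d r z x * \<bar>f z\<bar>\<^sup>2)"
      by (intro mult_right_mono cnt sum_nonneg) (simp add: box_ind_nonneg)
    finally show ?thesis .
  qed
  have "(\<integral>\<^sup>+x. (ennreal (\<Sum>z\<in>?Z. box_ind d r z x * \<bar>f z\<bar>))\<^sup>2 \<partial>?C)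
      \<le> (\<integral>\<^sup>+x. (\<Sum>z\<in>?Z. ennreal (n ^ d * \<bar>f z\<bar>\<^sup>2) * ennreal (box_ind d r z x)) \<partial>?C)"
  proof (rule nn_integral_mono)
    fix x
    have "(ennreal (\<Sum>z\<in>?Z. box_ind d r z x * \<bar>f z\<bar>))\<^sup>2 = ennreal ((\<Sum>z\<in>?Z. box_ind d r z x * \<bar>f z\<bar>)\<^sup>2)"
      by (intro ennreal_power sum_nonneg) (simp add: box_ind_nonneg)
    also have "\<dots> \<le> ennreal (n ^ d * (\<Sum>z\<in>?Z. box_ind d r z x * \<bar>f z\<bar>\<^sup>2))" by (intro ennreal_leI sq)
    also have "\<dots> = ennreal (\<Sum>z\<in>?Z. (n ^ d * \<bar>f z\<bar>\<^sup>2) * box_ind d r z x)"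
      by (simp add: sum_distrib_left mult_ac)
    also have "\<dots> = (\<Sum>z\<in>?Z. ennreal ((n ^ d * \<bar>f z\<bar>\<^sup>2) * box_ind d r z x))"
      using n0 by (intro sum_ennreal[symmetric]) (simp add: box_ind_nonneg)
    also have "\<dots> = (\<Sum>z\<in>?Z. ennreal (n ^ d * \<bar>f z\<bar>\<^sup>2) * ennreal (box_ind d r z x))"
      using n0 by (intro sum.cong refl ennreal_mult) (simp_all add: box_ind_nonneg)
    finally show "(ennreal (\<Sum>z\<in>?Z. box_ind d r z x * \<bar>f z\<bar>))\<^sup>2
        \<le> (\<Sum>z\<in>?Z. ennreal (n ^ d * \<bar>f z\<bar>\<^sup>2) * ennreal (box_ind d r z x))" .
  qed
  also have "\<dots> = (\<Sum>z\<in>?Z. ennreal (n ^ d * \<bar>f z\<bar>\<^sup>2) * (\<integral>\<^sup>+x. ennreal (box_ind d r z x) \<partial>?C))"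
    by (subst nn_integral_sum) (auto simp: nn_integral_cmult)
  also have "\<dots> \<le> (\<Sum>z\<in>?Z. ennreal (n ^ d * \<bar>f z\<bar>\<^sup>2) * ennreal ?R)"
    by (intro sum_mono mult_left_mono box_ind_mass r) auto
  also have "\<dots> = (\<Sum>z\<in>?Z. ennreal (n ^ d * \<bar>f z\<bar>\<^sup>2 * ?R))"
    using n0 R by (intro sum.cong refl ennreal_mult[symmetric]) auto
  also have "\<dots> = ennreal (\<Sum>z\<in>?Z. n ^ d * \<bar>f z\<bar>\<^sup>2 * ?R)" using n0 R by (intro sum_ennreal) auto
  also have "(\<Sum>z\<in>?Z. n ^ d * \<bar>f z\<bar>\<^sup>2 * ?R) = (sqrt (n ^ d * ?R) * discrete_norm ?Z f)\<^sup>2"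
    using n0 R by (simp add: power_mult_distrib discrete_norm_def sum_nonneg sum_distrib_left sum_distrib_right mult_ac)
  finally show ?thesis using n0 R unfolding L2_le_def
    by (auto simp: discrete_norm_def sum_nonneg intro!: mult_nonneg_nonneg)
qed

section \<open>Point sets and combinatorics of levels\<close>


lemma card_separated_le:
  fixes Y :: "real set"
  assumes "Y \<subseteq> {u..v}" "u \<le> v" "\<delta> > 0" "\<And>y z. y \<in> Y \<Longrightarrow> z \<in> Y \<Longrightarrow> y \<noteq> z \<Longrightarrow> \<bar>y - z\<bar> \<ge> \<delta>"
  shows "real (card Y) \<le> (v - u) / \<delta> + 1"
proof -
  \<comment> \<open>The index of the half-open cell of length \<open>\<delta>\<close>, counted from
    \<open>u\<close>; two points in one cell are closer than \<open>\<delta>\<close>.\<close>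
  define g where "g y = nat \<lfloor>(y - u) / \<delta>\<rfloor>" for y
  have nn: "(y - u) / \<delta> \<ge> 0" if "y \<in> Y" for y using assms that by auto
  have "inj_on g Y"
  proof (rule inj_onI, rule ccontr)
    fix y z assume yz: "y \<in> Y" "z \<in> Y" "g y = g z" "y \<noteq> z"
    then have "\<lfloor>(y - u) / \<delta>\<rfloor> = \<lfloor>(z - u) / \<delta>\<rfloor>" using nn unfolding g_def by (metis eq_nat_nat_iff zero_le_floor)
    then have "\<bar>(y - u) / \<delta> - (z - u) / \<delta>\<bar> < 1" by linarith
    then have "\<bar>y - z\<bar> < \<delta>" using assms(3) by (simp add: diff_divide_distrib[symmetric] abs_divide)
    then show False using assms(4)[OF yz(1,2,4)] by simp
  qed
  moreover have "g ` Y \<subseteq> {..nat \<lfloor>(v - u) / \<delta>\<rfloor>}"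
    using assms unfolding g_def by (auto intro!: nat_mono floor_mono divide_right_mono)
  ultimately have "card Y \<le> card {..nat \<lfloor>(v - u) / \<delta>\<rfloor>}" by (intro card_inj_on_le) auto
  then have "card Y \<le> nat \<lfloor>(v - u) / \<delta>\<rfloor> + 1" by simp
  moreover have "real (nat \<lfloor>(v - u) / \<delta>\<rfloor>) \<le> (v - u) / \<delta>" using assms by simp
  ultimately show ?thesis by linarith
qed

lemma separation_distance_props:
  assumes "finite Y" "card Y \<ge> 2"
  shows "separation_distance Y > 0"
    and "\<And>y z. y \<in> Y \<Longrightarrow> z \<in> Y \<Longrightarrow> y \<noteq> z \<Longrightarrow> \<bar>y - z\<bar> \<ge> 2 * separation_distance Y"
proof -
  define D where "D = {\<bar>y - z\<bar> | y z. y \<in> Y \<and> z \<in> Y \<and> y \<noteq> z}"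
  have "D \<subseteq> (\<lambda>(y, z). \<bar>y - z\<bar>) ` (Y \<times> Y)" by (auto simp: D_def)
  then have fin: "finite D" using assms(1) by (meson finite_SigmaI finite_imageI finite_subset)
  have "\<not> card Y \<le> Suc 0" using assms(2) by simp
  then obtain y z where "y \<in> Y" "z \<in> Y" "y \<noteq> z" unfolding card_le_Suc0_iff_eq[OF assms(1)] by blast
  then have "D \<noteq> {}" by (auto simp: D_def)
  with fin have "Min D \<in> D" by (rule Min_in)
  then show "separation_distance Y > 0" by (auto simp: separation_distance_def D_def)
  fix y z assume "y \<in> Y" "z \<in> Y" "y \<noteq> z"
  then have "\<bar>y - z\<bar> \<in> D" by (auto simp: D_def)
  with fin show "\<bar>y - z\<bar> \<ge> 2 * separation_distance Y" by (simp add: separation_distance_def D_def)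
qed

definition reproducing_level ::
  "real set \<Rightarrow> nat \<Rightarrow> real set \<Rightarrow> (real \<Rightarrow> real \<Rightarrow> real) \<Rightarrow> real \<Rightarrow> real \<Rightarrow> real \<Rightarrow> bool" where
  "reproducing_level I m Y v c r n \<longleftrightarrow>
     (\<forall>x\<in>I. (\<Sum>y\<in>Y. \<bar>v y x\<bar>) \<le> c \<and> (\<forall>j<m. (\<Sum>y\<in>Y. v y x * y ^ j) = x ^ j) \<and>
       (\<forall>y\<in>Y. v y x \<noteq> 0 \<longrightarrow> \<bar>x - y\<bar> \<le> r)) \<and>
     0 \<le> r \<and> (\<forall>s. real (card {y \<in> Y. \<bar>s - y\<bar> \<le> r}) \<le> n)"

text \<open>The order 2^(-l) of the fill distance follows from the cardinality: 2^(l-1)+1 separated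
  points in the interval force a small separation distance, and quasi-uniformity passes this on to
  the fill distance, which thus falls below \<open>h0\<close>. The mesh ratio also bounds the number
  of nodes near a point.\<close>

lemma univariate_levels:
  fixes X :: "nat \<Rightarrow> real set"
  assumes I: "lo < hi" "I = {lo..hi}" and m: "m \<ge> 1"
    and a: "local_poly_reproduction I (m - 1) a"
    and X': "\<forall>l\<ge>1. X l \<subseteq> I" and qu: "quasi_uniform I X"
    and card': "\<forall>l\<ge>2. card (X l) = 2 ^ (l - 1) + 1"
  shows "\<exists>L\<ge>2. \<exists>c\<ge>1. \<exists>n\<ge>1. \<exists>R>0. \<exists>\<rho>. \<forall>l\<ge>L.
    reproducing_level I m (X l) (a (X l)) c (\<rho> l) n \<and> \<rho> l \<le> R / 2 ^ l"
proof -
  have X: "X l \<subseteq> I" if "l \<ge> 1" for l using X' that by blast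
  have card: "card (X l) = 2 ^ (l - 1) + 1" if "l \<ge> 2" for l using card' that by blast
  obtain h0 c1 c2 where h: "h0 > 0" "c1 > 0" "c2 > 0" and
    rep': "\<forall>Y. finite Y \<and> Y \<noteq> {} \<and> Y \<subseteq> I \<and> fill_distance I Y \<le> h0 \<longrightarrow>
        (\<forall>g. degree g \<le> m - 1 \<longrightarrow> (\<forall>x\<in>I. process_op a Y (poly g) x = poly g x)) \<and>
        (\<forall>x\<in>I. (\<Sum>y\<in>Y. \<bar>a Y y x\<bar>) \<le> c1) \<and>
        (\<forall>x\<in>I. \<forall>y\<in>Y. \<bar>x - y\<bar> > c2 * fill_distance I Y \<longrightarrow> a Y y x = 0)"
    using a unfolding local_poly_reproduction_def by (elim exE conjE) (rule that)
  have rep: "(\<forall>g. degree g \<le> m - 1 \<longrightarrow> (\<forall>x\<in>I. process_op a Y (poly g) x = poly g x)) \<and>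
        (\<forall>x\<in>I. (\<Sum>y\<in>Y. \<bar>a Y y x\<bar>) \<le> c1) \<and>
        (\<forall>x\<in>I. \<forall>y\<in>Y. \<bar>x - y\<bar> > c2 * fill_distance I Y \<longrightarrow> a Y y x = 0)"
    if "finite Y" "Y \<noteq> {}" "Y \<subseteq> I" "fill_distance I Y \<le> h0" for Y
    by (rule mp[OF rep'[THEN spec, of Y]]) (intro conjI that)
  obtain K0 where K0: "\<And>l. l \<ge> 1 \<Longrightarrow> card (X l) \<ge> 2 \<Longrightarrow> mesh_ratio I (X l) \<le> K0"
    using qu unfolding quasi_uniform_def by blast
  \<comment> \<open>Makes the bound positive, as multiplications by \<open>K\<close> and the
    positivity of \<open>R\<close> require.\<close>
  define K where "K = max K0 1"
  define q where "q l = separation_distance (X l)" for l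
  define hh where "hh l = fill_distance I (X l)" for l
  \<comment> \<open>\<open>max 0\<close> gives nonnegativity without an argument about the supremum
    in the fill distance.\<close>
  define \<rho> where "\<rho> l = max 0 (c2 * hh l)" for l
  define R where "R = c2 * (K * (hi - lo))"
  have K: "K \<ge> 1" by (simp add: K_def)
  have R: "R > 0" using h I K by (simp add: R_def)
  have lev: "finite (X l)" "card (X l) \<ge> 2" "q l > 0" "hh l \<le> K * q l" "q l \<le> (hi - lo) / 2 ^ l" if l: "l \<ge> 2" for l
  proof -
    show c2: "card (X l) \<ge> 2" using card[OF l] by simp
    then show fin: "finite (X l)" by (metis card.infinite not_numeral_le_zero)
    show q0: "q l > 0" unfolding q_def by (rule separation_distance_props(1)[OF fin c2])
    have "hh l / q l \<le> K" using K0[of l] c2 l by (simp add: mesh_ratio_def hh_def q_def K_def)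
    then show "hh l \<le> K * q l" using q0 by (simp add: field_simps)
    have "real (card (X l)) \<le> (hi - lo) / (2 * q l) + 1"
      using X[of l] l I q0 separation_distance_props(2)[OF fin c2]
      by (intro card_separated_le) (auto simp: q_def)
    then have "2 ^ (l - 1) \<le> (hi - lo) / (2 * q l)" using card[OF l] by simp
    then have "2 * 2 ^ (l - 1) * q l \<le> hi - lo" using q0 by (simp add: field_simps)
    then have "2 ^ l * q l \<le> hi - lo" using l by (cases l) auto
    then show "q l \<le> (hi - lo) / 2 ^ l" by (simp add: field_simps)
  qed
  have hle: "hh l \<le> K * (hi - lo) / 2 ^ l" if "l \<ge> 2" for l
    using lev(4)[OF that] mult_left_mono[OF lev(5)[OF that], of K] K by simp
  have "(\<lambda>l. K * (hi - lo) * (1 / 2) ^ l) \<longlonglongrightarrow> K * (hi - lo) * 0"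
    by (intro tendsto_mult tendsto_const LIMSEQ_power_zero) auto
  then have "eventually (\<lambda>l. K * (hi - lo) * (1 / 2) ^ l < h0) sequentially"
    using h(1) by (intro order_tendstoD(2)) auto
  then obtain L1 where L1: "\<And>l. l \<ge> L1 \<Longrightarrow> K * (hi - lo) * (1 / 2) ^ l < h0"
    by (auto simp: eventually_sequentially)
  \<comment> \<open>Level 1 has a single point, about which quasi-uniformity says nothing; hence the
    maximum with 2.\<close>
  have "\<forall>l\<ge>max L1 2.
    reproducing_level I m (X l) (a (X l)) (max c1 1) (\<rho> l) (c2 * K + 1) \<and> \<rho> l \<le> R / 2 ^ l"
    unfolding reproducing_level_def
  proof (intro conjI allI impI ballI)
    fix l assume l: "l \<ge> max L1 2"
    then have l2: "l \<ge> 2" by simp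
    show "0 \<le> \<rho> l" by (simp add: \<rho>_def)
    have ch: "c2 * hh l \<le> R / 2 ^ l"
      using mult_left_mono[OF hle[OF l2], of c2] h by (simp add: R_def)
    then show "\<rho> l \<le> R / 2 ^ l" using R by (simp add: \<rho>_def)
    fix s
    have "\<rho> l \<le> c2 * K * q l" using mult_left_mono[OF lev(4)[OF l2], of c2] h K lev(3)[OF l2]
      by (simp add: \<rho>_def mult.assoc)
    then have "\<rho> l / q l \<le> c2 * K" using lev(3)[OF l2] by (simp add: field_simps)
    moreover have "real (card {y \<in> X l. \<bar>s - y\<bar> \<le> \<rho> l}) \<le> ((s + \<rho> l) - (s - \<rho> l)) / (2 * q l) + 1"
      using lev(3)[OF l2] separation_distance_props(2)[OF lev(1,2)[OF l2]]
      by (intro card_separated_le) (auto simp: q_def \<rho>_def)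
    ultimately show "real (card {y \<in> X l. \<bar>s - y\<bar> \<le> \<rho> l}) \<le> c2 * K + 1" by simp
  next
    fix l x assume l: "l \<ge> max L1 2" and x: "x \<in> I"
    then have l2: "l \<ge> 2" by simp
    have "fill_distance I (X l) \<le> h0"
    proof -
      have "K * (hi - lo) / 2 ^ l < h0" using L1[of l] l by (simp add: power_one_over)
      then show ?thesis using hle[OF l2] unfolding hh_def by linarith
    qed
    moreover have "X l \<noteq> {}" using lev(2)[OF l2] by auto
    ultimately have r: "\<And>g x. degree g \<le> m - 1 \<Longrightarrow> x \<in> I \<Longrightarrow> process_op a (X l) (poly g) x = poly g x"
      "\<And>x. x \<in> I \<Longrightarrow> (\<Sum>y\<in>X l. \<bar>a (X l) y x\<bar>) \<le> c1"
      "\<And>x y. x \<in> I \<Longrightarrow> y \<in> X l \<Longrightarrow> \<bar>x - y\<bar> > c2 * hh l \<Longrightarrow> a (X l) y x = 0"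
      using rep[of "X l"] lev(1)[OF l2] X[of l] l2 unfolding hh_def by auto
    show "(\<Sum>y\<in>X l. \<bar>a (X l) y x\<bar>) \<le> max c1 1" using r(2)[OF x] by simp
    show "(\<Sum>y\<in>X l. a (X l) y x * y ^ j) = x ^ j" if "j < m" for j
      using r(1)[of "monom 1 j" x] x that by (simp add: process_op_def poly_monom degree_monom_eq)
    show "\<bar>x - y\<bar> \<le> \<rho> l" if "y \<in> X l" "a (X l) y x \<noteq> 0" for y
      
    proof -
      have "\<not> c2 * hh l < \<bar>x - y\<bar>" using r(3)[OF x that(1)] that(2) by blast
      then show ?thesis by (simp add: \<rho>_def le_max_iff_disj)
    qed
  qed
  note main = this
  show ?thesis
  proof (intro exI conjI)
    show "2 \<le> max L1 2" by simp
    show "1 \<le> max c1 1" by simp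
    show "1 \<le> c2 * K + 1" using h K by simp
    show "R > 0" by fact
  qed (rule main)
qed

section \<open>Level vectors and generating functions\<close>

definition compositions :: "nat \<Rightarrow> nat \<Rightarrow> (nat \<Rightarrow> nat) set" where
  "compositions d q = {l \<in> {..<d} \<rightarrow>\<^sub>E {1..}. sum l {..<d} = q}"

lemma compositions_ge_1: "l \<in> compositions d q \<Longrightarrow> i < d \<Longrightarrow> l i \<ge> 1"
  using PiE_mem[of l "{..<d}" "\<lambda>_. {1..}" i] by (simp add: compositions_def)

lemma finite_weak_compositions:
  fixes d :: nat
  shows "finite {l \<in> {..<d} \<rightarrow>\<^sub>E (UNIV :: nat set). sum l {..<d} \<le> q}"
proof (rule finite_subset)
  show "{l \<in> {..<d} \<rightarrow>\<^sub>E (UNIV :: nat set). sum l {..<d} \<le> q} \<subseteq> {..<d} \<rightarrow>\<^sub>E {..q}"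
  proof
    fix l assume l: "l \<in> {l \<in> {..<d} \<rightarrow>\<^sub>E (UNIV :: nat set). sum l {..<d} \<le> q}"
    have "l i \<le> q" if "i < d" for i using member_le_sum[of i "{..<d}" l] that l by auto
    then show "l \<in> {..<d} \<rightarrow>\<^sub>E {..q}" using l by (auto simp: PiE_iff)
  qed
qed (intro finite_PiE, auto)

lemma finite_compositions: "finite (compositions d q)"
  by (rule finite_subset[OF _ finite_weak_compositions[of d q]]) (auto simp: compositions_def PiE_iff)

lemma finite_level_set: "finite (level_set p d)"
  by (rule finite_subset[OF _ finite_weak_compositions[of d p]]) (auto simp: PiE_iff level_set_def)

lemma fps_prod_nth_PiE:
  fixes u :: "nat \<Rightarrow> nat \<Rightarrow> real" and d :: nat
  shows "fps_nth (\<Prod>i<d. Abs_fps (u i)) q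
   = (\<Sum>l | l \<in> {..<d} \<rightarrow>\<^sub>E UNIV \<and> sum l {..<d} = q. \<Prod>i<d. u i (l i))"
proof (induction d arbitrary: q)
  case 0
  have "{l. l \<in> {..<0::nat} \<rightarrow>\<^sub>E (UNIV::nat set) \<and> (\<Sum>i<0. l i) = q} = (if q = 0 then {\<lambda>_. undefined} else {})"
    by auto
  then show ?case by simp
next
  case (Suc d)
  let ?S = "\<lambda>d q. {l. l \<in> {..<d::nat} \<rightarrow>\<^sub>E (UNIV::nat set) \<and> sum l {..<d} = q}"
  have fin: "finite (?S d j)" for d j
    by (rule finite_subset[OF _ finite_weak_compositions[of d j]]) auto
  have "fps_nth (\<Prod>i<Suc d. Abs_fps (u i)) q = (\<Sum>j=0..q. (\<Sum>l\<in>?S d j. \<Prod>i<d. u i (l i)) * u d (q - j))"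
    by (simp add: fps_mult_nth Suc)
  also have "\<dots> = (\<Sum>j=0..q. \<Sum>l\<in>?S d j. (\<Prod>i<d. u i (l i)) * u d (q - j))"
    by (simp add: sum_distrib_right)
  also have "\<dots> = (\<Sum>(j, l)\<in>Sigma {0..q} (?S d). (\<Prod>i<d. u i (l i)) * u d (q - j))"
    using fin by (subst sum.Sigma) auto
  also have "\<dots> = (\<Sum>l\<in>?S (Suc d) q. \<Prod>i<Suc d. u i (l i))"
  \<comment> \<open>The last coordinate is split off; resetting it to \<open>undefined\<close> keeps
    the shorter vector extensional.\<close>
  proof (rule sum.reindex_bij_witness[of _ "\<lambda>l. (q - l d, l(d := undefined))" "\<lambda>(j, l). l(d := q - j)"])
    fix jl assume "jl \<in> Sigma {0..q} (?S d)"
    then obtain j l where jl: "jl = (j, l)" "j \<le> q" "l \<in> {..<d} \<rightarrow>\<^sub>E (UNIV::nat set)" "sum l {..<d} = j" by auto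
    have ld: "l d = undefined" using jl(3) by (auto simp: PiE_iff extensional_def)
    show "(\<lambda>l. (q - l d, l(d := undefined))) ((\<lambda>(j, l). l(d := q - j)) jl) = jl"
      using jl(2) fun_upd_idem[of l d undefined, OF ld] unfolding jl(1) by simp
    have s: "(\<Sum>i<d. (l(d := q - j)) i) = j" using jl(4) by simp
    have "l(d := q - j) \<in> {..<Suc d} \<rightarrow>\<^sub>E UNIV" using jl(3) by (simp add: PiE_iff extensional_def)
    then show "(\<lambda>(j, l). l(d := q - j)) jl \<in> ?S (Suc d) q"
      using jl(1,2) s by (simp add: fun_upd_def)
    show "(\<Prod>i<Suc d. u i (((\<lambda>(j, l). l(d := q - j)) jl) i)) = (case jl of (j, l) \<Rightarrow> (\<Prod>i<d. u i (l i)) * u d (q - j))"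
      using jl by simp
  next
    fix l assume l: "l \<in> ?S (Suc d) q"
    then have q: "sum l {..<d} + l d = q" by simp
    show "(\<lambda>(j, l). l(d := q - j)) (q - l d, l(d := undefined)) = l" using q by auto
    show "(q - l d, l(d := undefined)) \<in> Sigma {0..q} (?S d)"
      using l q by (auto simp: PiE_iff extensional_def)
  qed
  finally show ?case by simp
qed

text \<open>Sequences vanishing at 0 remove every vector with a zero entry, which leaves the levels,
  numbered from 1.\<close>

lemma fps_prod_nth_compositions:
  fixes u :: "nat \<Rightarrow> nat \<Rightarrow> real" and d :: nat
  assumes "\<And>i. i < d \<Longrightarrow> u i 0 = 0"
  shows "fps_nth (\<Prod>i<d. Abs_fps (u i)) q = (\<Sum>l\<in>compositions d q. \<Prod>i<d. u i (l i))"
  unfolding fps_prod_nth_PiE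
proof (rule sum.mono_neutral_right)
  show "finite {l. l \<in> {..<d} \<rightarrow>\<^sub>E (UNIV::nat set) \<and> sum l {..<d} = q}"
    by (rule finite_subset[OF _ finite_weak_compositions[of d q]]) auto
  show "compositions d q \<subseteq> {l. l \<in> {..<d} \<rightarrow>\<^sub>E UNIV \<and> sum l {..<d} = q}"
    by (auto simp: compositions_def PiE_iff)
  show "\<forall>l\<in>{l. l \<in> {..<d} \<rightarrow>\<^sub>E UNIV \<and> sum l {..<d} = q} - compositions d q. (\<Prod>i<d. u i (l i)) = 0"
  proof
    fix l assume "l \<in> {l. l \<in> {..<d} \<rightarrow>\<^sub>E UNIV \<and> sum l {..<d} = q} - compositions d q"
    then obtain i where "i < d" "l i = 0" by (auto simp: compositions_def PiE_iff not_le)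
    then show "(\<Prod>i<d. u i (l i)) = 0" by (intro prod_zero bexI[of _ i]) (use assms[of i] in auto)
  qed
qed

lemma fps_one_minus_X_power_nth: "fps_nth ((1 - fps_X) ^ e) j = (- 1) ^ j * real (e choose j)"
proof (induction e arbitrary: j)
  case 0
  then show ?case by (cases j) auto
next
  case (Suc e)
  have "(1 - fps_X) ^ Suc e = (1 - fps_X) ^ e - fps_X * (1 - fps_X :: real fps) ^ e"
    by (simp add: algebra_simps)
  then have "fps_nth ((1 - fps_X) ^ Suc e) j = fps_nth ((1 - fps_X) ^ e) j - (fps_nth (fps_X * (1 - fps_X) ^ e) j :: real)"
    by (simp only: fps_sub_nth)
  then show ?case by (cases j) (auto simp: Suc algebra_simps)
qed

lemma sum_up_to_group:
  fixes g :: "(nat \<Rightarrow> nat) \<Rightarrow> real"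
  shows "(\<Sum>l | l \<in> {..<d} \<rightarrow>\<^sub>E {1..} \<and> sum l {..<d} \<le> p. g l) = (\<Sum>q\<le>p. \<Sum>l\<in>compositions d q. g l)"
proof -
  let ?T = "{l. l \<in> {..<d} \<rightarrow>\<^sub>E {1..} \<and> sum l {..<d} \<le> p}"
  have "finite ?T"
    by (rule finite_subset[OF _ finite_weak_compositions[of d p]]) (auto simp: PiE_iff)
  then have "(\<Sum>q\<le>p. \<Sum>l\<in>{l \<in> ?T. sum l {..<d} = q}. g l) = (\<Sum>l\<in>?T. g l)"
    by (intro sum.group) auto
  moreover have "{l \<in> ?T. sum l {..<d} = q} = compositions d q" if "q \<le> p" for q
    using that by (auto simp: compositions_def)
  ultimately show ?thesis by simp
qed

lemma level_set_sum:
  assumes "d \<ge> 1" "p \<ge> d"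
  shows "(\<Sum>k\<in>level_set p d. real ((d - 1) choose (p - sum k {..<d})) * g k)
    = (\<Sum>q\<le>p. \<Sum>k\<in>compositions d q. real ((d - 1) choose (p - q)) * g k)"
proof -
  have "(\<Sum>k\<in>level_set p d. real ((d - 1) choose (p - sum k {..<d})) * g k)
      = (\<Sum>k | k \<in> {..<d} \<rightarrow>\<^sub>E {1..} \<and> sum k {..<d} \<le> p. real ((d - 1) choose (p - sum k {..<d})) * g k)"
  proof (rule sum.mono_neutral_left)
    show "finite {k. k \<in> {..<d} \<rightarrow>\<^sub>E {1..} \<and> sum k {..<d} \<le> p}"
      by (rule finite_subset[OF _ finite_weak_compositions[of d p]]) (auto simp: PiE_iff)
    show "level_set p d \<subseteq> {k. k \<in> {..<d} \<rightarrow>\<^sub>E {1..} \<and> sum k {..<d} \<le> p}"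
      by (auto simp: level_set_def)
    show "\<forall>k\<in>{k. k \<in> {..<d} \<rightarrow>\<^sub>E {1..} \<and> sum k {..<d} \<le> p} - level_set p d.
        real ((d - 1) choose (p - sum k {..<d})) * g k = 0"
    proof
      fix k assume "k \<in> {k. k \<in> {..<d} \<rightarrow>\<^sub>E {1..} \<and> sum k {..<d} \<le> p} - level_set p d"
      then have "\<not> p - d + 1 \<le> sum k {..<d}" by (auto simp: level_set_def)
      then have "d - 1 < p - sum k {..<d}" using assms by linarith
      then show "real ((d - 1) choose (p - sum k {..<d})) * g k = 0" by (simp add: binomial_eq_0)
    qed
  qed
  also have "\<dots> = (\<Sum>q\<le>p. \<Sum>k\<in>compositions d q. real ((d - 1) choose (p - q)) * g k)"
    unfolding sum_up_to_group by (intro sum.cong refl) (auto simp: compositions_def)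
  finally show ?thesis .
qed

text \<open>With generating functions, differences multiply by \<open>(1 - X)\<^sup>d\<close> and summation up to \<open>p\<close> divides by \<open>1 - X\<close>.\<close>

lemma combination_formula:
  fixes C :: "nat \<Rightarrow> nat \<Rightarrow> real"
  assumes C: "\<And>i. i < d \<Longrightarrow> C i 0 = 0" and d: "d \<ge> 1" "p \<ge> d"
  shows "(\<Sum>l | l \<in> {..<d} \<rightarrow>\<^sub>E {1..} \<and> sum l {..<d} \<le> p. \<Prod>i<d. C i (l i) - C i (l i - 1))
    = (\<Sum>k\<in>level_set p d. real ((d - 1) choose (p - sum k {..<d})) * ((- 1) ^ (p - sum k {..<d}) * (\<Prod>i<d. C i (k i))))"
proof -
  define U where "U = (\<Prod>i<d. Abs_fps (C i))"
  define A where "A = (Abs_fps (\<lambda>_. 1) :: real fps)"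
  have geo: "(1 - fps_X) * A = 1"
    by (rule fps_ext) (auto simp: A_def left_diff_distrib)
  \<comment> \<open>At \<open>l = 0\<close> truncated subtraction makes the difference 0; this
    agrees with the constant coefficient \<open>C i 0\<close> on the right because that
    vanishes.\<close>
  have dif: "Abs_fps (\<lambda>l. C i l - C i (l - 1)) = (1 - fps_X) * Abs_fps (C i)" if "i < d" for i
    using C[OF that] by (intro fps_ext) (auto simp: left_diff_distrib)
  have "(\<Sum>l | l \<in> {..<d} \<rightarrow>\<^sub>E {1..} \<and> sum l {..<d} \<le> p. \<Prod>i<d. C i (l i) - C i (l i - 1))
      = (\<Sum>q\<le>p. fps_nth (\<Prod>i<d. Abs_fps (\<lambda>l. C i l - C i (l - 1))) q)"
    unfolding sum_up_to_group by (intro sum.cong refl fps_prod_nth_compositions[symmetric]) simp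
  also have "(\<Prod>i<d. Abs_fps (\<lambda>l. C i l - C i (l - 1))) = (1 - fps_X) ^ d * U"
    unfolding U_def using dif by (simp add: prod.distrib)
  also have "(\<Sum>q\<le>p. fps_nth ((1 - fps_X) ^ d * U) q) = fps_nth (((1 - fps_X) ^ d * U) * A) p"
    by (simp add: fps_mult_nth A_def atMost_atLeast0)
  also have "((1 - fps_X) ^ d * U) * A = (1 - fps_X) ^ (d - 1) * U"
  proof -
    have "((1 - fps_X) ^ d * U) * A = (1 - fps_X) ^ (d - 1) * U * ((1 - fps_X) * A)"
      using d by (cases d) (auto simp: mult_ac)
    then show ?thesis by (simp add: geo)
  qed
  also have "fps_nth \<dots> p = fps_nth (U * (1 - fps_X) ^ (d - 1)) p" by (simp add: mult.commute)
  also have "\<dots> = (\<Sum>q\<le>p. fps_nth U q * ((- 1) ^ (p - q) * real ((d - 1) choose (p - q))))"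
    by (simp add: fps_mult_nth fps_one_minus_X_power_nth atMost_atLeast0)
  also have "\<dots> = (\<Sum>q\<le>p. \<Sum>k\<in>compositions d q. real ((d - 1) choose (p - q)) *
      ((- 1) ^ (p - sum k {..<d}) * (\<Prod>i<d. C i (k i))))"
  proof (rule sum.cong[OF refl])
    fix q
    have "fps_nth U q = (\<Sum>k\<in>compositions d q. \<Prod>i<d. C i (k i))"
      unfolding U_def by (rule fps_prod_nth_compositions[where u = C and d = d]) (rule C)
    moreover have "sum k {..<d} = q" if "k \<in> compositions d q" for k
      using that by (simp add: compositions_def)
    ultimately show "fps_nth U q * ((- 1) ^ (p - q) * real ((d - 1) choose (p - q)))
        = (\<Sum>k\<in>compositions d q. real ((d - 1) choose (p - q)) * ((- 1) ^ (p - sum k {..<d}) * (\<Prod>i<d. C i (k i))))"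
      by (simp add: sum_distrib_left mult_ac cong: sum.cong)
  qed
  finally show ?thesis unfolding level_set_sum[OF d] .
qed

section \<open>Counting levels and the tail sum\<close>

lemma sum_powers_le: "(\<Sum>j<q. real j ^ e) \<le> real q ^ Suc e / real (Suc e)"
proof (induction q)
  case (Suc q)
  \<comment> \<open>The first two terms of the binomial expansion of (q+1)^(e+1).\<close>
  have "real q ^ Suc e + real (Suc e) * real q ^ e \<le> (real q + 1) ^ Suc e"
  proof (induction e)
    case (Suc e)
    have "real q ^ Suc (Suc e) + real (Suc (Suc e)) * real q ^ Suc e
        \<le> (real q + 1) * (real q ^ Suc e + real (Suc e) * real q ^ e)"
      by (simp add: algebra_simps)
    also have "\<dots> \<le> (real q + 1) * (real q + 1) ^ Suc e" by (intro mult_left_mono Suc) auto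
    finally show ?case by simp
  qed auto
  then have "(real q ^ Suc e + real (Suc e) * real q ^ e) / real (Suc e) \<le> (real q + 1) ^ Suc e / real (Suc e)"
    by (rule divide_right_mono) simp
  then have "real q ^ Suc e / real (Suc e) + real q ^ e \<le> (real q + 1) ^ Suc e / real (Suc e)"
    by (simp add: add_divide_distrib del: power_Suc of_nat_Suc)
  then show ?case using Suc by (simp add: add.commute)
qed auto

text \<open>The source of the factorial (d-1)!. Multiplication by \<open>V\<close> replaces each
  coefficient by the sum of the earlier ones, and summing the powers i^e contributes a denominator
  e+1 each time.\<close>

lemma card_compositions_le:
  assumes "d \<ge> 1"
  shows "real (card (compositions d q)) \<le> real q ^ (d - 1) / fact (d - 1)"
proof -
  define V where "V = Abs_fps (\<lambda>l::nat. if l = 0 then 0 else (1::real))"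
  have "fps_nth (V ^ Suc e) q \<le> real q ^ e / fact e" for e
  proof (induction e arbitrary: q)
    case 0
    then show ?case by (simp add: V_def)
  next
    case (Suc e)
    have "fps_nth (V ^ Suc (Suc e)) q = (\<Sum>i=0..q. fps_nth (V ^ Suc e) i * fps_nth V (q - i))"
      by (subst power_Suc2) (simp only: fps_mult_nth)
    also have "\<dots> = (\<Sum>i<q. fps_nth (V ^ Suc e) i)"
      by (rule sum.mono_neutral_cong_right) (auto simp: V_def)
    also have "\<dots> \<le> (\<Sum>i<q. real i ^ e / fact e)" by (intro sum_mono Suc)
    also have "\<dots> = (\<Sum>i<q. real i ^ e) / fact e" by (simp add: sum_divide_distrib)
    also have "\<dots> \<le> (real q ^ Suc e / real (Suc e)) / fact e" by (intro divide_right_mono sum_powers_le) auto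
    also have "\<dots> = real q ^ Suc e / fact (Suc e)" by (simp add: field_simps)
    finally show ?case .
  qed
  from this[of "d - 1"] have "fps_nth (\<Prod>i<d. V) q \<le> real q ^ (d - 1) / fact (d - 1)" using assms by simp
  moreover have "fps_nth (\<Prod>i<d. V) q = (\<Sum>l\<in>compositions d q. \<Prod>i<d. if l i = 0 then 0 else (1::real))"
    unfolding V_def by (subst fps_prod_nth_compositions) auto
  moreover have "\<dots> = (\<Sum>l\<in>compositions d q. 1)"
    using compositions_ge_1 by (intro sum.cong refl prod.neutral) fastforce
  ultimately show ?thesis by simp
qed

text \<open>Each diagonal |k| = q is bounded by the count of compositions; the binomial weights then
  add up to 2^(d-1), rounded up to a d-th power.\<close>

lemma level_set_weight_sum:
  assumes "d \<ge> 1" "p \<ge> d"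
  shows "(\<Sum>k\<in>level_set p d. real ((d - 1) choose (p - sum k {..<d}))) \<le> 2 ^ d * (real p ^ (d - 1) / fact (d - 1))"
proof -
  have "(\<Sum>k\<in>level_set p d. real ((d - 1) choose (p - sum k {..<d})))
      = (\<Sum>q\<le>p. real ((d - 1) choose (p - q)) * real (card (compositions d q)))"
    using level_set_sum[OF assms, of "\<lambda>_. 1"] by (simp add: mult.commute)
  also have "\<dots> \<le> (\<Sum>q\<le>p. real ((d - 1) choose (p - q)) * (real p ^ (d - 1) / fact (d - 1)))"
    using assms by (intro sum_mono mult_left_mono order.trans[OF card_compositions_le] divide_right_mono power_mono) auto
  also have "\<dots> = (\<Sum>j\<le>p. real ((d - 1) choose j)) * (real p ^ (d - 1) / fact (d - 1))"
    by (subst sum.nat_diff_reindex[of _ "Suc p", unfolded lessThan_Suc_atMost, symmetric])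
       (simp add: sum_distrib_right sum_divide_distrib)
  also have "(\<Sum>j\<le>p. real ((d - 1) choose j)) = (\<Sum>j\<le>d - 1. real ((d - 1) choose j))"
    using assms by (intro sum.mono_neutral_right) auto
  also have "\<dots> = 2 ^ (d - 1)" using choose_row_sum[of "d - 1"] by (simp flip: of_nat_sum)
  also have "2 ^ (d - 1) * (real p ^ (d - 1) / fact (d - 1)) \<le> 2 ^ d * (real p ^ (d - 1) / fact (d - 1))"
    by (intro mult_right_mono power_increasing) auto
  finally show ?thesis .
qed

text \<open>As p is at least d, the factor (1 + j/p)^(d-1) is at most (1 + j/d)^d. Bounding this by
  exp(j) would lose against the decay 2^(-j). Replacing 1 + x by 3(1 + x/3) trades a factor 3^d for
  the rate exp(1/3), which is below 3/2.\<close>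

lemma shifted_power_le:
  assumes "d \<ge> 1" "p \<ge> d"
  shows "real (p + j) ^ (d - 1) \<le> real p ^ (d - 1) * (3 ^ d * (3 / 2) ^ j)"
proof -
  \<comment> \<open>Cubing reduces exp(1/3) \<le> 3/2 to e \<le> 27/8.\<close>
  have "exp (1 / 3 :: real) ^ 3 = exp 1" by (simp add: exp_of_nat_mult[symmetric])
  also have "\<dots> \<le> (3 / 2) ^ 3" using exp_le by (simp add: power3_eq_cube)
  finally have "exp (1 / 3 :: real) ^ Suc 2 \<le> (3 / 2) ^ Suc 2" by (simp add: eval_nat_numeral)
  then have e: "exp (1 / 3 :: real) \<le> 3 / 2" by (rule power_le_imp_le_base) simp
  have "1 + real j / real d \<le> 3 * (1 + real j / (3 * real d))" by simp
  also have "\<dots> \<le> 3 * exp (real j / (3 * real d))" by (intro mult_left_mono exp_ge_add_one_self) auto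
  finally have "(1 + real j / real d) ^ d \<le> (3 * exp (real j / (3 * real d))) ^ d" by (intro power_mono) auto
  also have "\<dots> = 3 ^ d * exp (1 / 3) ^ j"
    using assms by (simp add: power_mult_distrib exp_of_nat_mult[symmetric])
  also have "\<dots> \<le> 3 ^ d * (3 / 2) ^ j" by (intro mult_left_mono power_mono e) auto
  finally have b: "(1 + real j / real d) ^ d \<le> 3 ^ d * (3 / 2) ^ j" .
  have "(real p + real j) ^ (d - 1) = real p ^ (d - 1) * (1 + real j / real p) ^ (d - 1)"
    using assms by (simp add: power_mult_distrib[symmetric] field_simps)
  also have "\<dots> \<le> real p ^ (d - 1) * (1 + real j / real d) ^ (d - 1)"
    using assms by (intro mult_left_mono power_mono add_left_mono divide_left_mono) auto
  also have "\<dots> \<le> real p ^ (d - 1) * (1 + real j / real d) ^ d"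
    by (intro mult_left_mono power_increasing) auto
  also have "\<dots> \<le> real p ^ (d - 1) * (3 ^ d * (3 / 2) ^ j)" by (intro mult_left_mono b) auto
  finally show ?thesis by simp
qed

text \<open>The bound is uniform in the truncation \<open>n\<close>. On |l| = p + j the growth
  (3/2)^j of the counts and the decay 2^(-j) combine to a geometric series of ratio 3/4, whose sum
  is the 4.\<close>

lemma tail_sum_le:
  assumes d: "d \<ge> 1" "p \<ge> d" and m: "m \<ge> 1"
  shows "(\<Sum>l | l \<in> {..<d} \<rightarrow>\<^sub>E {1..n} \<and> p < sum l {..<d}. (1 / 2) ^ (m * sum l {..<d}))
    \<le> 4 * 3 ^ d * (real p ^ (d - 1) / fact (d - 1)) * (1 / 2) ^ (m * p)"
proof -
  let ?T = "{l. l \<in> {..<d} \<rightarrow>\<^sub>E {1..n} \<and> p < sum l {..<d}}"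
  have fin: "finite ?T" by (rule finite_subset[of _ "{..<d} \<rightarrow>\<^sub>E {1..n}"]) (auto intro!: finite_PiE)
  have im: "(\<lambda>l. \<Sum>i<d. l i) ` ?T \<subseteq> {p<..p + d * n}"
  proof clarify
    fix l assume l: "l \<in> {..<d} \<rightarrow>\<^sub>E {1..n}" "p < sum l {..<d}"
    have "sum l {..<d} \<le> (\<Sum>i<d. n)" using l(1) by (intro sum_mono) (auto simp: PiE_iff)
    then show "sum l {..<d} \<in> {p<..p + d * n}" using l(2) by simp
  qed
  define P where "P = real p ^ (d - 1) / fact (d - 1) * (1 / 2) ^ (m * p)"
  have P: "P \<ge> 0" by (simp add: P_def)
  have "(\<Sum>l\<in>?T. (1 / 2 :: real) ^ (m * sum l {..<d}))
      = (\<Sum>q\<in>{p<..p + d * n}. \<Sum>l\<in>{l \<in> ?T. sum l {..<d} = q}. (1 / 2) ^ (m * sum l {..<d}))"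
    using fin im by (intro sum.group[symmetric]) auto
  also have "\<dots> \<le> (\<Sum>q\<in>{p<..p + d * n}. real (card (compositions d q)) * (1 / 2) ^ (m * q))"
  proof (rule sum_mono)
    fix q
    have "(\<Sum>l\<in>{l \<in> ?T. sum l {..<d} = q}. (1 / 2 :: real) ^ (m * sum l {..<d}))
        = real (card {l \<in> ?T. sum l {..<d} = q}) * (1 / 2) ^ (m * q)" by simp
    also have "\<dots> \<le> real (card (compositions d q)) * (1 / 2) ^ (m * q)"
      by (intro mult_right_mono of_nat_mono card_mono finite_compositions)
         (auto simp: compositions_def PiE_iff)
    finally show "(\<Sum>l\<in>{l \<in> ?T. sum l {..<d} = q}. (1 / 2 :: real) ^ (m * sum l {..<d}))
        \<le> real (card (compositions d q)) * (1 / 2) ^ (m * q)" .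
  qed
  also have "\<dots> = (\<Sum>j\<in>{0<..d * n}. real (card (compositions d (p + j))) * (1 / 2) ^ (m * (p + j)))"
    by (rule sum.reindex_bij_witness[of _ "\<lambda>j. p + j" "\<lambda>q. q - p"]) auto
  also have "\<dots> \<le> (\<Sum>j\<in>{0<..d * n}. P * 3 ^ d * (3 / 4) ^ j)"
  proof (rule sum_mono)
    fix j
    have "real (card (compositions d (p + j))) \<le> real (p + j) ^ (d - 1) / fact (d - 1)"
      by (rule card_compositions_le[OF d(1)])
    also have "\<dots> \<le> real p ^ (d - 1) * (3 ^ d * (3 / 2) ^ j) / fact (d - 1)"
      by (intro divide_right_mono shifted_power_le d) auto
    finally have 1: "real (card (compositions d (p + j))) \<le> real p ^ (d - 1) * (3 ^ d * (3 / 2) ^ j) / fact (d - 1)" .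
    have "(1 / 2 :: real) ^ (m * (p + j)) = (1 / 2) ^ (m * p) * (1 / 2) ^ (m * j)"
      by (simp add: distrib_left power_add)
    also have "\<dots> \<le> (1 / 2) ^ (m * p) * (1 / 2) ^ j"
      using m by (intro mult_left_mono power_decreasing) auto
    finally have 2: "(1 / 2 :: real) ^ (m * (p + j)) \<le> (1 / 2) ^ (m * p) * (1 / 2) ^ j" .
    have "real (card (compositions d (p + j))) * (1 / 2) ^ (m * (p + j))
        \<le> (real p ^ (d - 1) * (3 ^ d * (3 / 2) ^ j) / fact (d - 1)) * ((1 / 2) ^ (m * p) * (1 / 2) ^ j)"
      by (intro mult_mono 1 2) auto
    also have "\<dots> = P * 3 ^ d * ((3 / 2) ^ j * (1 / 2) ^ j)" by (simp add: P_def)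
    also have "(3 / 2) ^ j * (1 / 2) ^ j = (3 / 4 :: real) ^ j" by (simp add: power_mult_distrib[symmetric])
    finally show "real (card (compositions d (p + j))) * (1 / 2) ^ (m * (p + j)) \<le> P * 3 ^ d * (3 / 4) ^ j" .
  qed
  also have "\<dots> = P * 3 ^ d * (\<Sum>j\<in>{0<..d * n}. (3 / 4) ^ j)" by (simp add: sum_distrib_left)
  also have "\<dots> \<le> P * 3 ^ d * 4"
  proof (intro mult_left_mono)
    have "(\<Sum>j\<in>{0<..d * n}. (3 / 4 :: real) ^ j) \<le> (\<Sum>j. (3 / 4) ^ j)"
      by (intro sum_le_suminf summable_geometric) auto
    then show "(\<Sum>j\<in>{0<..d * n}. (3 / 4 :: real) ^ j) \<le> 4" by (simp add: suminf_geometric)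
  qed (use P in auto)
  finally show ?thesis by (simp add: P_def mult_ac)
qed

section \<open>The sampling inequality\<close>


text \<open>\<open>w l\<close> are the weights of the altered operators, zero below \<open>L\<close>
  and off the nodes. The extension by zero lets operators of different levels be written as sums
  over one common node set.\<close>

locale reproduction_levels =
  fixes lo hi :: real and m L :: nat and w :: "nat \<Rightarrow> real \<Rightarrow> real \<Rightarrow> real"
    and X :: "nat \<Rightarrow> real set" and c n R :: real and \<rho> :: "nat \<Rightarrow> real" and E :: "real \<Rightarrow> real"
  assumes lohi: "lo < hi" and m: "m \<ge> 1" and L: "L \<ge> 2" and c: "c \<ge> 1" and n: "n \<ge> 1" and R: "R > 0"
    and finX: "\<And>l. l \<ge> 1 \<Longrightarrow> finite (X l)" and subX: "\<And>l. l \<ge> 1 \<Longrightarrow> X l \<subseteq> {lo..hi}"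
    and w_coarse: "\<And>l y x. l < L \<Longrightarrow> w l y x = 0"
    and w_off: "\<And>l y x. y \<notin> X l \<Longrightarrow> w l y x = 0"
    and w_sum: "\<And>l x. l \<ge> L \<Longrightarrow> x \<in> {lo..hi} \<Longrightarrow> (\<Sum>y\<in>X l. \<bar>w l y x\<bar>) \<le> c"
    and w_moments: "\<And>l x j. l \<ge> L \<Longrightarrow> x \<in> {lo..hi} \<Longrightarrow> j < m \<Longrightarrow> (\<Sum>y\<in>X l. w l y x * y ^ j) = x ^ j"
    and w_near: "\<And>l x y. l \<ge> L \<Longrightarrow> x \<in> {lo..hi} \<Longrightarrow> w l y x \<noteq> 0 \<Longrightarrow> \<bar>x - y\<bar> \<le> \<rho> l"
    and \<rho>_nonneg: "\<And>l. l \<ge> L \<Longrightarrow> 0 \<le> \<rho> l" and \<rho>_le: "\<And>l. l \<ge> L \<Longrightarrow> \<rho> l \<le> R / 2 ^ l"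
    and count: "\<And>l s. l \<ge> L \<Longrightarrow> real (card {y \<in> X l. \<bar>s - y\<bar> \<le> \<rho> l}) \<le> n"
    and E: "mollifier_primitive m E"
begin

text \<open>At \<open>l = L\<close> this is \<open>w L\<close> itself, since the level below
  vanishes; that is why this one level lacks vanishing moments.\<close>

definition diff_w :: "nat \<Rightarrow> real \<Rightarrow> real \<Rightarrow> real" where
  "diff_w l y x = w l y x - w (l - 1) y x"

definition tensor :: "real set \<Rightarrow> nat \<Rightarrow> ((nat \<Rightarrow> real) \<Rightarrow> real) \<Rightarrow> (nat \<Rightarrow> real \<Rightarrow> real) \<Rightarrow> real" where
  "tensor Z d f v = (\<Sum>z\<in>{..<d} \<rightarrow>\<^sub>E Z. (\<Prod>i<d. v i (z i)) * f z)"

definition nodes :: "nat \<Rightarrow> real set" where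
  "nodes k = (\<Union>l\<in>{1..k}. X l)"

lemma nodes_props: "finite (nodes k)" "nodes k \<subseteq> {lo..hi}" "1 \<le> l \<Longrightarrow> l \<le> k \<Longrightarrow> X l \<subseteq> nodes k"
proof -
  show "finite (nodes k)" using finX unfolding nodes_def by auto
  show "nodes k \<subseteq> {lo..hi}" unfolding nodes_def by (intro UN_least subX) simp
  show "1 \<le> l \<Longrightarrow> l \<le> k \<Longrightarrow> X l \<subseteq> nodes k" unfolding nodes_def by auto
qed

lemma w_extend:
  assumes "finite Z" "X l \<subseteq> Z" "\<And>y. y \<notin> X l \<Longrightarrow> g y = (0::real)"
  shows "(\<Sum>y\<in>Z. g y) = (\<Sum>y\<in>X l. g y)"
  using assms by (intro sum.mono_neutral_right) auto

lemma w_sum_Z: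
  assumes "finite Z" "l \<ge> L \<Longrightarrow> X l \<subseteq> Z" "x \<in> {lo..hi}"
  shows "(\<Sum>y\<in>Z. \<bar>w l y x\<bar>) \<le> c"
proof (cases "l < L")
  case False
  then show ?thesis using w_sum[of l x] assms w_extend[of Z l "\<lambda>y. \<bar>w l y x\<bar>"] w_off by simp
qed (use w_coarse c in simp)

lemma w_moments_Z:
  assumes "finite Z" "X l \<subseteq> Z" "x \<in> {lo..hi}" "l \<ge> L" "j < m"
  shows "(\<Sum>y\<in>Z. w l y x * y ^ j) = x ^ j"
  using w_moments[of l x j] assms w_extend[of Z l "\<lambda>y. w l y x * y ^ j"] w_off by simp

text \<open>\<open>2 * r l * M l\<close> is the price of one coordinate in L2: the kernel size from
  \<open>tensor_kernel_bound\<close> times the box side from \<open>L2_le_local_mass\<close>. On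
  fine levels the size decays like 2^(-(m-1)l) and the radius supplies the remaining 2^(-l).\<close>

lemma level_kernels:
  "\<exists>r M B. B > 0 \<and> (\<forall>l\<ge>1. r l \<ge> 0 \<and> M l \<ge> 0 \<and> 2 * r l * M l \<le> B * (1 / 2) ^ (m * l) \<and>
     (\<forall>Z x. finite Z \<and> Z \<subseteq> {lo..hi} \<and> x \<in> {lo..hi} \<and> (\<forall>k\<in>{1..l}. X k \<subseteq> Z) \<longrightarrow>
        kernel_bound lo hi m E Z (\<lambda>y. diff_w l y x) x (r l) (M l)))"
proof -
  obtain C where C: "C > 0" "\<And>Z b x B. Z \<subseteq> {lo..hi} \<Longrightarrow> x \<in> {lo..hi} \<Longrightarrow> (\<Sum>y\<in>Z. \<bar>b y\<bar>) \<le> B \<Longrightarrow>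
    kernel_bound lo hi m E Z b x (hi - lo) (B * C)"
    using kernel_bound_coarse[OF lohi E m] by blast
  \<comment> \<open>Locality radius of the coarser of the two operators in the difference, times the
    4 of \<open>kernel_bound_moments\<close>.\<close>
  define r where "r l = (if l \<le> L then hi - lo else 4 * (R / 2 ^ (l - 1)))" for l
  define M where "M l = (if l < L then 0 else if l = L then c * C else 2 * c * (8 * (R / 2 ^ (l - 1))) ^ (m - 1))" for l
  \<comment> \<open>The first term serves level \<open>L\<close>, whose missing decay is paid for by
    2^(mL); the second serves finer levels, with 8/2^(l-1) = 16/2^l.\<close>
  define B where "B = 2 * (hi - lo) * (c * C) * 2 ^ (m * L) + 2 * c * (16 * R) ^ m"
  have B1: "2 * (hi - lo) * (c * C) * 2 ^ (m * L) \<ge> 0" and B2: "2 * c * (16 * R) ^ m > 0"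
    using lohi c C R by auto
  have "B > 0" unfolding B_def using B1 B2 by (rule add_nonneg_pos)
  moreover have "r l \<ge> 0 \<and> M l \<ge> 0 \<and> 2 * r l * M l \<le> B * (1 / 2) ^ (m * l) \<and>
     (\<forall>Z x. finite Z \<and> Z \<subseteq> {lo..hi} \<and> x \<in> {lo..hi} \<and> (\<forall>k\<in>{1..l}. X k \<subseteq> Z) \<longrightarrow>
        kernel_bound lo hi m E Z (\<lambda>y. diff_w l y x) x (r l) (M l))" if l: "l \<ge> 1" for l
  proof (intro conjI allI impI)
    show "r l \<ge> 0" using lohi R by (simp add: r_def)
    show "M l \<ge> 0" using C c R by (simp add: M_def)
    consider "l < L" | "l = L" | "l > L" by linarith
    then show "2 * r l * M l \<le> B * (1 / 2) ^ (m * l)"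
    proof cases
      case 1
      then show ?thesis using \<open>B > 0\<close> by (simp add: M_def)
    next
      case 2
      have "2 * (hi - lo) * (c * C) = 2 * (hi - lo) * (c * C) * 2 ^ (m * L) * (1 / 2) ^ (m * L)"
        by (simp add: power_one_over)
      also have "\<dots> \<le> B * (1 / 2) ^ (m * L)" using B2 by (intro mult_right_mono) (auto simp: B_def)
      finally show ?thesis using 2 by (simp add: r_def M_def)
    next
      case 3
      have "2 * r l * M l = 2 * c * ((8 * (R / 2 ^ (l - 1))) * (8 * (R / 2 ^ (l - 1))) ^ (m - 1))"
        using 3 by (simp add: r_def M_def)
      also have "\<dots> = 2 * c * (8 * (R / 2 ^ (l - 1))) ^ m" using m by (cases m) auto
      also have "8 * (R / 2 ^ (l - 1)) = 16 * R * (1 / 2) ^ l" using l by (cases l) (auto simp: power_one_over)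
      also have "2 * c * (16 * R * (1 / 2) ^ l) ^ m = 2 * c * (16 * R) ^ m * (1 / 2) ^ (m * l)"
        by (simp only: power_mult_distrib power_mult[symmetric] mult.commute[of m l] mult.assoc)
      also have "\<dots> \<le> B * (1 / 2) ^ (m * l)" using B1 by (intro mult_right_mono) (auto simp: B_def)
      finally show ?thesis .
    qed
  next
    fix Z x assume Z: "finite Z \<and> Z \<subseteq> {lo..hi} \<and> x \<in> {lo..hi} \<and> (\<forall>k\<in>{1..l}. X k \<subseteq> Z)"
    have XZ: "X l \<subseteq> Z" "l - 1 \<ge> L \<Longrightarrow> X (l - 1) \<subseteq> Z" using Z l L by auto
    consider "l < L" | "l = L" | "l > L" by linarith
    then show "kernel_bound lo hi m E Z (\<lambda>y. diff_w l y x) x (r l) (M l)"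
    proof cases
      case 1
      then show ?thesis by (intro kernel_bound_zero lohi) (auto simp: M_def diff_w_def w_coarse)
    next
      case 2
      have "(\<Sum>y\<in>Z. \<bar>diff_w l y x\<bar>) \<le> c"
        using w_sum_Z[of Z l x] Z XZ 2 L by (simp add: diff_w_def w_coarse)
      then show ?thesis using C(2)[of Z x "\<lambda>y. diff_w l y x" c] Z 2 by (simp add: r_def M_def)
    next
      case 3
      have "(\<Sum>y\<in>Z. \<bar>diff_w l y x\<bar>) \<le> (\<Sum>y\<in>Z. \<bar>w l y x\<bar> + \<bar>w (l - 1) y x\<bar>)"
        by (intro sum_mono) (simp add: diff_w_def)
      also have "\<dots> \<le> c + c" unfolding sum.distrib using Z XZ by (intro add_mono w_sum_Z) auto
      finally have s: "(\<Sum>y\<in>Z. \<bar>diff_w l y x\<bar>) \<le> 2 * c" by simp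
      have "kernel_bound lo hi m E Z (\<lambda>y. diff_w l y x) x (4 * (R / 2 ^ (l - 1))) (2 * c * (8 * (R / 2 ^ (l - 1))) ^ (m - 1))"
      proof (rule kernel_bound_moments[OF lohi _ E m _ s])
        show "Z \<subseteq> {lo..hi}" using Z by simp
        show "0 < R / 2 ^ (l - 1)" using R by simp
        show "(\<Sum>y\<in>Z. diff_w l y x * y ^ j) = 0" if "j < m" for j
          using w_moments_Z[of Z l x j] w_moments_Z[of Z "l - 1" x j] Z XZ 3 that
          by (simp add: diff_w_def left_diff_distrib sum_subtractf)
        show "\<bar>y - x\<bar> \<le> R / 2 ^ (l - 1)" if "y \<in> Z" "diff_w l y x \<noteq> 0" for y
        proof (cases "w l y x = 0")
          case True
          then have "w (l - 1) y x \<noteq> 0" using that by (simp add: diff_w_def)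
          then have "\<bar>x - y\<bar> \<le> \<rho> (l - 1)" using 3 Z by (intro w_near) auto
          also have "\<dots> \<le> R / 2 ^ (l - 1)" using 3 by (intro \<rho>_le) simp
          finally show ?thesis by (simp add: abs_minus_commute)
        next
          case False
          then have "\<bar>x - y\<bar> \<le> \<rho> l" using 3 Z by (intro w_near) auto
          also have "\<dots> \<le> R / 2 ^ l" using 3 by (intro \<rho>_le) simp
          also have "\<dots> \<le> R / 2 ^ (l - 1)" using R by (intro divide_left_mono power_increasing) auto
          finally show ?thesis by (simp add: abs_minus_commute)
        qed
      qed
      then show ?thesis using 3 by (simp add: r_def M_def)
    qed
  qed
  ultimately show ?thesis by blast
qed

text \<open>Reproduction of constants makes the tensor weights sum to 1, stability bounds their
  absolute sum by c^d, and locality confines the active nodes to a neighbourhood where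
  \<open>f\<close> varies little.\<close>

lemma tensor_w_approx:
  assumes f: "continuous_on (cube {lo..hi} d) f" and e: "e > 0"
  shows "\<exists>k0\<ge>1. \<forall>k\<ge>k0. \<forall>x\<in>cube {lo..hi} d. \<bar>f x - tensor (nodes k) d f (\<lambda>i y. w k y (x i))\<bar> \<le> e"
proof -
  have cd: "c ^ d > 0" using c by simp
  obtain \<delta> where \<delta>: "\<delta> > 0" "\<And>x y. x \<in> cube {lo..hi} d \<Longrightarrow> y \<in> cube {lo..hi} d \<Longrightarrow>
    (\<And>i. i < d \<Longrightarrow> \<bar>x i - y i\<bar> \<le> \<delta>) \<Longrightarrow> \<bar>f x - f y\<bar> < e / c ^ d"
    using cube_uniformly_continuous[OF f, of "e / c ^ d"] e cd by auto
  have "(\<lambda>l. R * (1 / 2) ^ l) \<longlonglongrightarrow> R * 0" by (intro tendsto_mult tendsto_const LIMSEQ_power_zero) auto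
  then have "eventually (\<lambda>l. R * (1 / 2) ^ l < \<delta>) sequentially"
    using \<delta>(1) by (intro order_tendstoD(2)) auto
  then obtain k1 where k1: "\<And>l. l \<ge> k1 \<Longrightarrow> R * (1 / 2) ^ l < \<delta>" by (auto simp: eventually_sequentially)
  have "\<bar>f x - tensor (nodes k) d f (\<lambda>i y. w k y (x i))\<bar> \<le> e"
    if k: "k \<ge> max L k1" and x: "x \<in> cube {lo..hi} d" for k x
  proof -
    let ?Z = "nodes k"
    have kL: "k \<ge> L" "k \<ge> 1" using k L by auto
    have Z: "finite ?Z" "?Z \<subseteq> {lo..hi}" "X k \<subseteq> ?Z" using nodes_props kL by auto
    have xi: "x i \<in> {lo..hi}" if "i < d" for i using x that by (auto simp: cube_def PiE_iff)
    have one: "(\<Sum>z\<in>{..<d} \<rightarrow>\<^sub>E ?Z. \<Prod>i<d. w k (z i) (x i)) = 1"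
    proof -
      have "(\<Sum>z\<in>{..<d} \<rightarrow>\<^sub>E ?Z. \<Prod>i<d. w k (z i) (x i)) = (\<Prod>i<d. \<Sum>y\<in>?Z. w k y (x i))"
        using Z(1) by (subst prod_sum_PiE) auto
      also have "\<dots> = (\<Prod>i<d. 1)"
        using w_moments_Z[OF Z(1,3) xi kL(1), of _ 0] m by (intro prod.cong) auto
      finally show ?thesis by simp
    qed
    have abs: "(\<Sum>z\<in>{..<d} \<rightarrow>\<^sub>E ?Z. \<Prod>i<d. \<bar>w k (z i) (x i)\<bar>) \<le> c ^ d"
    proof -
      have "(\<Sum>z\<in>{..<d} \<rightarrow>\<^sub>E ?Z. \<Prod>i<d. \<bar>w k (z i) (x i)\<bar>) = (\<Prod>i<d. \<Sum>y\<in>?Z. \<bar>w k y (x i)\<bar>)"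
        using Z(1) by (subst prod_sum_PiE) auto
      also have "\<dots> \<le> (\<Prod>i<d. c)" using w_sum_Z Z xi by (intro prod_mono) (auto intro!: sum_nonneg)
      finally show ?thesis by simp
    qed
    have "f x - tensor ?Z d f (\<lambda>i y. w k y (x i)) = (\<Sum>z\<in>{..<d} \<rightarrow>\<^sub>E ?Z. (\<Prod>i<d. w k (z i) (x i)) * (f x - f z))"
      using one by (simp add: tensor_def right_diff_distrib sum_subtractf flip: sum_distrib_right)
    also have "\<bar>\<dots>\<bar> \<le> (\<Sum>z\<in>{..<d} \<rightarrow>\<^sub>E ?Z. (\<Prod>i<d. \<bar>w k (z i) (x i)\<bar>) * (e / c ^ d))"
    proof (intro order.trans[OF sum_abs] sum_mono)
      fix z assume z: "z \<in> {..<d} \<rightarrow>\<^sub>E ?Z"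
      then have zc: "z \<in> cube {lo..hi} d" using Z(2) by (auto simp: cube_def PiE_iff)
      show "\<bar>(\<Prod>i<d. w k (z i) (x i)) * (f x - f z)\<bar> \<le> (\<Prod>i<d. \<bar>w k (z i) (x i)\<bar>) * (e / c ^ d)"
      proof (cases "\<exists>i<d. w k (z i) (x i) = 0")
        case True
        then have "(\<Prod>i<d. w k (z i) (x i)) = 0" "(\<Prod>i<d. \<bar>w k (z i) (x i)\<bar>) = 0" by auto
        then show ?thesis by (simp only: mult_zero_left abs_zero order_refl)
      next
        case False
        have "\<bar>x i - z i\<bar> \<le> \<delta>" if "i < d" for i
        proof -
          have "\<bar>x i - z i\<bar> \<le> \<rho> k" using False that xi kL by (intro w_near) auto
          also have "\<dots> \<le> R * (1 / 2) ^ k" using \<rho>_le[OF kL(1)] by (simp add: power_one_over)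
          also have "\<dots> \<le> \<delta>" using k1[of k] k by simp
          finally show ?thesis .
        qed
        then have "\<bar>f x - f z\<bar> \<le> e / c ^ d" using \<delta>(2)[OF x zc] by force
        then show ?thesis unfolding abs_mult abs_prod by (intro mult_left_mono prod_nonneg) auto
      qed
    qed
    also have "\<dots> = (\<Sum>z\<in>{..<d} \<rightarrow>\<^sub>E ?Z. \<Prod>i<d. \<bar>w k (z i) (x i)\<bar>) * (e / c ^ d)" by (simp add: sum_distrib_right sum_divide_distrib)
    also have "\<dots> \<le> c ^ d * (e / c ^ d)" using e cd by (intro mult_right_mono abs) auto
    also have "\<dots> = e" using c by simp
    finally show ?thesis .
  qed
  then show ?thesis using L by (intro exI[of _ "max L k1"]) auto
qed

lemma tensor_sum:
  assumes "finite A"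
  shows "(\<Sum>l\<in>A. g l * tensor Z d f (v l)) = (\<Sum>z\<in>{..<d} \<rightarrow>\<^sub>E Z. (\<Sum>l\<in>A. g l * (\<Prod>i<d. v l i (z i))) * f z)"
  unfolding tensor_def sum_distrib_left sum_distrib_right
  by (subst sum.swap) (simp add: mult.assoc)

text \<open>Telescoping in each coordinate expands the operator of level \<open>k\<close> over the
  levels up to \<open>k\<close>; the combination formula collapses the part with |l| \<le>
  p.\<close>

lemma tensor_w_expand:
  assumes d: "d \<ge> 1" "p \<ge> d" and k: "k \<ge> p"
  shows "tensor Z d f (\<lambda>i y. w k y (x i))
    = (\<Sum>l\<in>level_set p d. real ((d - 1) choose (p - sum l {..<d})) * (- 1) ^ (p - sum l {..<d}) *
         tensor Z d f (\<lambda>i y. w (l i) y (x i)))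
    + (\<Sum>l | l \<in> {..<d} \<rightarrow>\<^sub>E {1..k} \<and> p < sum l {..<d}. tensor Z d f (\<lambda>i y. diff_w (l i) y (x i)))"
proof -
  let ?T = "{..<d} \<rightarrow>\<^sub>E {1..k}"
  let ?A = "{l. l \<in> {..<d} \<rightarrow>\<^sub>E {1..} \<and> sum l {..<d} \<le> p}"
  let ?B = "{l. l \<in> ?T \<and> p < sum l {..<d}}"
  have finT: "finite ?T" by (intro finite_PiE) auto
  have finA: "finite ?A" by (rule finite_subset[OF _ finite_weak_compositions[of d p]]) (auto simp: PiE_iff)
  have finL: "finite (level_set p d)" by (rule finite_level_set)
  \<comment> \<open>As \<open>k \<ge> p\<close>, the whole simplex |l| \<le> p lies inside the box
    of levels up to \<open>k\<close>.\<close>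
  have split: "?T = ?A \<union> ?B"
  proof (intro equalityI subsetI)
    fix l assume "l \<in> ?A \<union> ?B"
    moreover have "l \<in> ?T" if "l \<in> ?A"
    proof -
      have "l i \<le> k" if "i < d" for i
        using member_le_sum[of i "{..<d}" l] that \<open>l \<in> ?A\<close> k by auto
      then show ?thesis using that by (auto simp: PiE_iff)
    qed
    ultimately show "l \<in> ?T" by blast
  qed (auto simp: PiE_iff)
  have finB: "finite ?B" using finT by simp
  have disj: "?A \<inter> ?B = {}" by (rule equals0I) (elim IntE CollectE conjE, linarith)
  have w0: "w 0 y s = 0" for y s using w_coarse L by simp
  have pointwise: "(\<Prod>i<d. w k (z i) (x i))
      = (\<Sum>l\<in>level_set p d. real ((d - 1) choose (p - sum l {..<d})) * (- 1) ^ (p - sum l {..<d}) * (\<Prod>i<d. w (l i) (z i) (x i)))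
      + (\<Sum>l\<in>?B. 1 * (\<Prod>i<d. diff_w (l i) (z i) (x i)))" for z
  proof -
    \<comment> \<open>No initial term remains because \<open>w 0\<close> vanishes.\<close>
    have tel: "w k y s = (\<Sum>l\<in>{1..k}. diff_w l y s)" for y s
      by (induction k) (auto simp: w0 diff_w_def)
    have "(\<Prod>i<d. w k (z i) (x i)) = (\<Sum>l\<in>?T. \<Prod>i<d. diff_w (l i) (z i) (x i))"
      unfolding tel by (subst prod_sum_PiE) auto
    also have "\<dots> = (\<Sum>l\<in>?A. \<Prod>i<d. diff_w (l i) (z i) (x i)) + (\<Sum>l\<in>?B. \<Prod>i<d. diff_w (l i) (z i) (x i))"
      by (rule trans[OF arg_cong[OF split, of "sum _"] sum.union_disjoint[OF finA finB disj]])
    also have "(\<Sum>l\<in>?A. \<Prod>i<d. diff_w (l i) (z i) (x i))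
        = (\<Sum>l\<in>level_set p d. real ((d - 1) choose (p - sum l {..<d})) * ((- 1) ^ (p - sum l {..<d}) * (\<Prod>i<d. w (l i) (z i) (x i))))"
      unfolding diff_w_def by (rule combination_formula[OF _ d, of "\<lambda>i l. w l (z i) (x i)"]) (rule w0)
    finally show ?thesis by (simp add: mult.assoc)
  qed
  show ?thesis
    using tensor_sum[OF finB, of "\<lambda>_. 1" Z d f "\<lambda>l i y. diff_w (l i) y (x i)"]
    unfolding tensor_sum[OF finL] tensor_def[of Z d f "\<lambda>i y. w k y (x i)"] pointwise
    by (simp add: distrib_right sum.distrib)
qed

text \<open>Stability bounds each product of weights by c^d, and locality makes it vanish unless the
  node lies in the box around \<open>x\<close>. If some level is below \<open>L\<close>, the
  operator is 0 and needs no bound.\<close>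

lemma tensor_w_bound:
  assumes l: "\<And>i. i < d \<Longrightarrow> l i \<ge> L" and Z: "finite Z" "\<And>i. i < d \<Longrightarrow> X (l i) \<subseteq> Z"
    and x: "x \<in> cube {lo..hi} d"
  shows "\<bar>tensor Z d f (\<lambda>i y. w (l i) y (x i))\<bar>
    \<le> c ^ d * (\<Sum>z\<in>(\<Pi>\<^sub>E i\<in>{..<d}. X (l i)). box_ind d (\<lambda>i. \<rho> (l i)) z x * \<bar>f z\<bar>)"
proof -
  let ?Y = "\<Pi>\<^sub>E i\<in>{..<d}. X (l i)"
  have xi: "x i \<in> {lo..hi}" if "i < d" for i using x that by (auto simp: cube_def PiE_iff)
  have fin: "finite ({..<d} \<rightarrow>\<^sub>E Z)" using Z by (intro finite_PiE) auto
  have sub: "?Y \<subseteq> {..<d} \<rightarrow>\<^sub>E Z" using Z(2) by (intro PiE_mono) auto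
  have wc: "\<bar>w (l i) y (x i)\<bar> \<le> c" if "i < d" for i y
  proof (cases "y \<in> X (l i)")
    case True
    have "l i \<ge> 1" using l[OF that] L by simp
    then have "\<bar>w (l i) y (x i)\<bar> \<le> (\<Sum>y\<in>X (l i). \<bar>w (l i) y (x i)\<bar>)"
      using True finX by (intro member_le_sum[of y _ "\<lambda>y. \<bar>w (l i) y (x i)\<bar>"]) auto
    also have "\<dots> \<le> c" by (rule w_sum[OF l[OF that] xi[OF that]])
    finally show ?thesis .
  qed (use w_off c in simp)
  have "tensor Z d f (\<lambda>i y. w (l i) y (x i)) = (\<Sum>z\<in>?Y. (\<Prod>i<d. w (l i) (z i) (x i)) * f z)"
    unfolding tensor_def
  proof (rule sum.mono_neutral_right[OF fin sub], rule ballI)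
    fix z assume "z \<in> ({..<d} \<rightarrow>\<^sub>E Z) - ?Y"
    then obtain i where "i < d" "z i \<notin> X (l i)" by (auto simp: PiE_iff)
    then have "(\<Prod>i<d. w (l i) (z i) (x i)) = 0" using w_off by (intro prod_zero) auto
    then show "(\<Prod>i<d. w (l i) (z i) (x i)) * f z = 0" by simp
  qed
  also have "\<bar>\<dots>\<bar> \<le> (\<Sum>z\<in>?Y. c ^ d * (box_ind d (\<lambda>i. \<rho> (l i)) z x * \<bar>f z\<bar>))"
  proof (intro order.trans[OF sum_abs] sum_mono)
    fix z
    have "\<bar>\<Prod>i<d. w (l i) (z i) (x i)\<bar> \<le> c ^ d * box_ind d (\<lambda>i. \<rho> (l i)) z x"
    proof (cases "\<forall>i<d. \<bar>x i - z i\<bar> \<le> \<rho> (l i)")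
      case True
      have "\<bar>\<Prod>i<d. w (l i) (z i) (x i)\<bar> \<le> (\<Prod>i<d. c)"
        unfolding abs_prod using wc by (intro prod_mono) auto
      then show ?thesis unfolding box_ind_def if_P[OF True] by simp
    next
      case False
      then obtain i where i: "i < d" "\<not> \<bar>x i - z i\<bar> \<le> \<rho> (l i)" by blast
      then have "w (l i) (z i) (x i) = 0" using w_near[OF l[OF i(1)] xi[OF i(1)]] by blast
      then have "(\<Prod>i<d. w (l i) (z i) (x i)) = 0" using i(1) by (intro prod_zero) auto
      then show ?thesis unfolding box_ind_def if_not_P[OF False] by simp
    qed
    then show "\<bar>(\<Prod>i<d. w (l i) (z i) (x i)) * f z\<bar> \<le> c ^ d * (box_ind d (\<lambda>i. \<rho> (l i)) z x * \<bar>f z\<bar>)"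
      unfolding abs_mult mult.assoc[symmetric] by (intro mult_right_mono) auto
  qed
  finally show ?thesis by (simp add: sum_distrib_left)
qed

lemma discrete_norm_mono:
  "finite B \<Longrightarrow> A \<subseteq> B \<Longrightarrow> discrete_norm A f \<le> discrete_norm B f"
  unfolding discrete_norm_def by (intro real_sqrt_le_mono sum_mono2) auto

lemma finite_sparse_grid: "finite (sparse_grid X p d)"
proof -
  have "finite (level_set p d)" by (rule finite_level_set)
  moreover have "finite (\<Pi>\<^sub>E i\<in>{..<d}. X (l i))" if "l \<in> level_set p d" for l
    using that finX by (intro finite_PiE) (auto simp: level_set_def PiE_iff)
  ultimately show ?thesis unfolding sparse_grid_def by auto
qed

lemma sampling_inequality:
  "\<exists>A>0. \<forall>d\<ge>1. \<forall>p\<ge>d. \<forall>f\<in>H_mix {lo..hi} d m.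
     L2_cube_norm {lo..hi} d f \<le> real p ^ (d - 1) / fact (d - 1) *
       (A ^ d * (1 / 2) ^ (m * (p - d)) * H_mix_norm {lo..hi} d m f
        + A ^ d * sqrt (1 / 2) ^ (p - d) * discrete_norm (sparse_grid X p d) f)"
  (is "\<exists>A>0. \<forall>d\<ge>1. \<forall>p\<ge>d. \<forall>f\<in>_. ?Q A d p f")
proof -
  obtain r M B where B: "B > 0" and rM: "\<And>l. l \<ge> 1 \<Longrightarrow> r l \<ge> 0 \<and> M l \<ge> 0 \<and> 2 * r l * M l \<le> B * (1 / 2) ^ (m * l) \<and>
     (\<forall>Z x. finite Z \<and> Z \<subseteq> {lo..hi} \<and> x \<in> {lo..hi} \<and> (\<forall>k\<in>{1..l}. X k \<subseteq> Z) \<longrightarrow>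
        kernel_bound lo hi m E Z (\<lambda>y. diff_w l y x) x (r l) (M l))"
    using level_kernels by blast
  \<comment> \<open>\<open>S ^ d\<close> is the square root of n^d and the constant part of the box
    volume in \<open>L2_le_local_discrete_sum\<close>.\<close>
  define S where "S = sqrt (2 * n * R)"
  \<comment> \<open>First term: binomial weights (2), stability (\<open>c\<close>) and
    \<open>S\<close>. Second term: 4 and 3 from \<open>tail_sum_le\<close>, m + 1 orders per
    coordinate, and \<open>B\<close>. Their sum is a common base for both constants.\<close>
  define A where "A = 2 * c * S + 12 * (real m + 1) * B"
  have S: "S > 0" using n R by (simp add: S_def)
  have A1: "0 \<le> 2 * c * S" "2 * c * S \<le> A" and A2: "0 \<le> 12 * (real m + 1) * B" "12 * (real m + 1) * B \<le> A"
    and "A > 0" using c S B by (auto simp: A_def intro!: add_pos_nonneg)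
  have main: "?Q A d p f"
    if d: "d \<ge> 1" "p \<ge> d" and f: "f \<in> H_mix {lo..hi} d m" for d p f
  proof -
    let ?C = "cube_measure {lo..hi} d"
    define P where "P = real p ^ (d - 1) / fact (d - 1)"
    define F where "F = H_mix_norm {lo..hi} d m f"
    define G where "G = discrete_norm (sparse_grid X p d) f"
    have P: "P \<ge> 0" by (simp add: P_def)
    have F: "F \<ge> 0" by (simp add: F_def H_mix_norm_def sum_nonneg)
    have G: "G \<ge> 0" by (simp add: G_def discrete_norm_def sum_nonneg)
    have fc: "continuous_on (cube {lo..hi} d) f" and fsq: "square_integrable {lo..hi} d f"
      using f by (auto simp: H_mix_def)
    define wt where "wt l = real ((d - 1) choose (p - sum l {..<d}))" for l :: "nat \<Rightarrow> nat"
    \<comment> \<open>With some level below \<open>L\<close> the tensor operator is 0, so 0 is a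
      majorant.\<close>
    define disc where "disc l x = (if \<forall>i<d. L \<le> l i then
        c ^ d * (\<Sum>z\<in>(\<Pi>\<^sub>E i\<in>{..<d}. X (l i)). box_ind d (\<lambda>i. \<rho> (l i)) z x * \<bar>f z\<bar>) else 0)" for l x
    define tail where "tail l x = (\<Sum>\<alpha>\<in>multi_indices d m. ennreal (\<Prod>i<d. M (l i)) *
        local_mass lo hi d (\<lambda>i. r (l i)) x (weak_D {lo..hi} d \<alpha> f))" for l x
    have finL: "finite (level_set p d)" by (rule finite_level_set)
    let ?W = "\<lambda>\<alpha>. L2_cube_norm {lo..hi} d (weak_D {lo..hi} d \<alpha> f)"
    let ?v = "c ^ d * (S ^ d * sqrt (1 / 2) ^ (p - d) * G)"
    let ?w = "\<lambda>l. (real m + 1) ^ d * B ^ d * (1 / 2) ^ (m * sum l {..<d}) * F"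
    have disc_L2: "L2_le ?C (\<lambda>x. ennreal (disc l x)) ?v"
      if l: "l \<in> level_set p d" for l
    proof (cases "\<forall>i<d. L \<le> l i")
      case True
      let ?Y = "\<Pi>\<^sub>E i\<in>{..<d}. X (l i)"
      have l1: "l i \<ge> 1" if "i < d" for i using True that L by force
      have "L2_le ?C (\<lambda>x. ennreal (\<Sum>z\<in>?Y. box_ind d (\<lambda>i. \<rho> (l i)) z x * \<bar>f z\<bar>))
          (sqrt (n ^ d * (\<Prod>i<d. 2 * \<rho> (l i))) * discrete_norm ?Y f)"
        using True n by (intro L2_le_local_discrete_sum finX l1 \<rho>_nonneg count) auto
      then have *: "L2_le ?C (\<lambda>x. ennreal (c ^ d) * ennreal (\<Sum>z\<in>?Y. box_ind d (\<lambda>i. \<rho> (l i)) z x * \<bar>f z\<bar>))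
          (c ^ d * (sqrt (n ^ d * (\<Prod>i<d. 2 * \<rho> (l i))) * discrete_norm ?Y f))"
        using c by (intro L2_le_cmult) auto
      have "(\<Prod>i<d. 2 * \<rho> (l i)) \<le> (\<Prod>i<d. 2 * R * (1 / 2) ^ (l i))"
      proof (intro prod_mono conjI)
        fix i assume "i \<in> {..<d}"
        then have i: "L \<le> l i" using True by simp
        show "0 \<le> 2 * \<rho> (l i)" using \<rho>_nonneg[OF i] by simp
        show "2 * \<rho> (l i) \<le> 2 * R * (1 / 2) ^ (l i)" using \<rho>_le[OF i] by (simp add: power_one_over)
      qed
      also have "\<dots> = (2 * R) ^ d * (1 / 2) ^ sum l {..<d}" by (simp add: prod.distrib power_sum power_mult_distrib)
      \<comment> \<open>|l| is at least p - d + 1 for all levels in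
        \<open>level_set\<close>.\<close>
      also have "\<dots> \<le> (2 * R) ^ d * (1 / 2) ^ (p - d)"
        using l R by (intro mult_left_mono power_decreasing) (auto simp: level_set_def)
      finally have "n ^ d * (\<Prod>i<d. 2 * \<rho> (l i)) \<le> n ^ d * ((2 * R) ^ d * (1 / 2) ^ (p - d))"
        using n by (intro mult_left_mono) auto
      then have "sqrt (n ^ d * (\<Prod>i<d. 2 * \<rho> (l i))) \<le> sqrt (n ^ d * ((2 * R) ^ d * (1 / 2) ^ (p - d)))"
        by (rule real_sqrt_le_mono)
      also have "\<dots> = S ^ d * sqrt (1 / 2) ^ (p - d)"
        unfolding S_def by (simp only: real_sqrt_mult real_sqrt_power power_mult_distrib mult_ac)
      finally have sq: "sqrt (n ^ d * (\<Prod>i<d. 2 * \<rho> (l i))) \<le> S ^ d * sqrt (1 / 2) ^ (p - d)" .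
      have "discrete_norm ?Y f \<le> G" unfolding G_def
        using l by (intro discrete_norm_mono finite_sparse_grid) (auto simp: sparse_grid_def)
      then have "c ^ d * (sqrt (n ^ d * (\<Prod>i<d. 2 * \<rho> (l i))) * discrete_norm ?Y f)
          \<le> ?v"
        using c S sq by (intro mult_left_mono mult_mono) (auto simp: discrete_norm_def sum_nonneg)
      moreover have "ennreal (disc l x) = ennreal (c ^ d) * ennreal (\<Sum>z\<in>?Y. box_ind d (\<lambda>i. \<rho> (l i)) z x * \<bar>f z\<bar>)" for x
        unfolding disc_def if_P[OF True] using c
        by (intro ennreal_mult sum_nonneg) (auto simp: box_ind_nonneg)
      ultimately show ?thesis using * by (auto intro: L2_le_weaken)
    next
      case False
      have "disc l x = 0" for x unfolding disc_def if_not_P[OF False] by simp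
      then show ?thesis using L2_le_weaken[OF L2_le_zero, of "?v" ?C] c S G
        by simp
    qed
    have tail_L2: "L2_le ?C (tail l) (?w l)"
      if l: "\<And>i. i < d \<Longrightarrow> l i \<ge> 1" for l
    proof -
      have rl: "r (l i) \<ge> 0" "M (l i) \<ge> 0" "2 * r (l i) * M (l i) \<le> B * (1 / 2) ^ (m * l i)" if "i < d" for i
        using rM[OF l[OF that]] by auto
      have Mp: "(\<Prod>i<d. M (l i)) \<ge> 0" using rl by (intro prod_nonneg) auto
      have rp: "(\<Prod>i<d. 2 * r (l i)) \<ge> 0" using rl by (intro prod_nonneg) auto
      have a: "L2_le ?C (tail l) (\<Sum>\<alpha>\<in>multi_indices d m. (\<Prod>i<d. M (l i)) *
          ((\<Prod>i<d. 2 * r (l i)) * ?W \<alpha>))"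
        unfolding tail_def
        using rl weak_D_properties(1)[OF f] Mp
        by (intro L2_le_sum finite_multi_indices L2_le_cmult L2_le_local_mass) auto
      have b: "(\<Sum>\<alpha>\<in>multi_indices d m. (\<Prod>i<d. M (l i)) *
          ((\<Prod>i<d. 2 * r (l i)) * ?W \<alpha>))
          \<le> (\<Sum>\<alpha>\<in>multi_indices d m. B ^ d * (1 / 2) ^ (m * sum l {..<d}) * F)"
      proof (rule sum_mono)
        fix \<alpha> assume \<alpha>: "\<alpha> \<in> multi_indices d m"
        have "(?W \<alpha>)\<^sup>2
            \<le> (\<Sum>\<alpha>\<in>multi_indices d m. (?W \<alpha>)\<^sup>2)"
          using \<alpha> finite_multi_indices
          by (intro member_le_sum[of \<alpha> _ "\<lambda>\<alpha>. (?W \<alpha>)\<^sup>2"]) auto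
        then have nF: "?W \<alpha> \<le> F"
          unfolding F_def H_mix_norm_def by (rule real_le_rsqrt)
        have "(\<Prod>i<d. M (l i)) * (\<Prod>i<d. 2 * r (l i)) = (\<Prod>i<d. 2 * r (l i) * M (l i))"
          by (simp add: prod.distrib mult_ac)
        also have "\<dots> \<le> (\<Prod>i<d. B * (1 / 2) ^ (m * l i))" using rl by (intro prod_mono) auto
        also have "\<dots> = B ^ d * (1 / 2) ^ (m * sum l {..<d})"
          by (simp add: prod.distrib power_sum sum_distrib_left)
        finally have "(\<Prod>i<d. M (l i)) * (\<Prod>i<d. 2 * r (l i)) \<le> B ^ d * (1 / 2) ^ (m * sum l {..<d})" .
        then have "(\<Prod>i<d. M (l i)) * (\<Prod>i<d. 2 * r (l i)) * ?W \<alpha>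
            \<le> B ^ d * (1 / 2) ^ (m * sum l {..<d}) * F"
          by (rule mult_mono[OF _ nF]) (use B in \<open>auto simp: L2_cube_norm_def\<close>)
        then show "(\<Prod>i<d. M (l i)) * ((\<Prod>i<d. 2 * r (l i)) * ?W \<alpha>)
            \<le> B ^ d * (1 / 2) ^ (m * sum l {..<d}) * F" by (simp only: mult.assoc)
      qed
      have e: "(\<Sum>\<alpha>\<in>multi_indices d m. B ^ d * (1 / 2) ^ (m * sum l {..<d}) * F)
          = ?w l"
        by (simp add: multi_indices_def card_PiE add.commute)
      show ?thesis by (rule L2_le_weaken[OF a b[unfolded e]])
    qed
    have K: "\<exists>K\<ge>0. \<forall>e\<ge>0. L2_le ?C (\<lambda>x. ennreal e) (e * K)" by (rule L2_le_const)
    then obtain K where K: "K \<ge> 0" "\<And>e. e \<ge> 0 \<Longrightarrow> L2_le ?C (\<lambda>x. ennreal e) (e * K)" by blast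
    \<comment> \<open>\<open>e\<close> is the error of replacing \<open>f\<close> by a tensor
      operator of high level \<open>k\<close>. That level depends on \<open>e\<close>, but the other
      terms of the bound do not, so \<open>e\<close> can tend to 0.\<close>
    have bound: "L2_cube_norm {lo..hi} d f \<le> e * K + (A ^ d * P * sqrt (1 / 2) ^ (p - d) * G + A ^ d * P * (1 / 2) ^ (m * (p - d)) * F)"
      if e: "e > 0" for e
    proof -
      obtain k0 where k0: "\<And>k x. k \<ge> k0 \<Longrightarrow> x \<in> cube {lo..hi} d \<Longrightarrow>
          \<bar>f x - tensor (nodes k) d f (\<lambda>i y. w k y (x i))\<bar> \<le> e"
        using tensor_w_approx[OF fc e] by blast
      define k where "k = max k0 p"
      let ?Z = "nodes k"
      let ?T = "\<lambda>x. tensor ?Z d f (\<lambda>i y. w k y (x i))"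
      let ?B = "{l. l \<in> {..<d} \<rightarrow>\<^sub>E {1..k} \<and> p < sum l {..<d}}"
      have finB: "finite ?B" by (rule finite_subset[of _ "{..<d} \<rightarrow>\<^sub>E {1..k}"]) (auto intro!: finite_PiE)
      have lB: "l i \<ge> 1" "l i \<le> k" if "l \<in> ?B" "i < d" for l i using that by (auto simp: PiE_iff)
      have lL: "l i \<ge> 1" "l i \<le> k" if "l \<in> level_set p d" "i < d" for l i
      proof -
        show "l i \<ge> 1" using that by (auto simp: level_set_def PiE_iff)
        have "l i \<le> sum l {..<d}" using that(2) by (intro member_le_sum[of i "{..<d}" l]) auto
        also have "\<dots> \<le> k" using that by (simp add: level_set_def k_def le_max_iff_disj)
        finally show "l i \<le> k" .
      qed
      define total where "total x = ennreal e + ((\<Sum>l\<in>level_set p d. ennreal (wt l) * ennreal (disc l x)) + (\<Sum>l\<in>?B. tail l x))" for x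
      have pw: "ennreal \<bar>f x\<bar> \<le> total x" if x: "x \<in> cube {lo..hi} d" for x
      proof -
        have xi: "x i \<in> {lo..hi}" if "i < d" for i using x that by (auto simp: cube_def PiE_iff)
        let ?D = "\<lambda>l. tensor ?Z d f (\<lambda>i y. w (l i) y (x i))"
        let ?U = "\<lambda>l. tensor ?Z d f (\<lambda>i y. diff_w (l i) y (x i))"
        have 1: "\<bar>f x - ?T x\<bar> \<le> e" using k0[of k x] x by (simp add: k_def)
        have 2: "\<bar>?D l\<bar> \<le> disc l x" if l: "l \<in> level_set p d" for l
        proof (cases "\<forall>i<d. L \<le> l i")
          case True
          show ?thesis unfolding disc_def if_P[OF True]
            using True nodes_props lL[OF l] by (intro tensor_w_bound x) auto
        next
          case False
          then obtain i where i: "i < d" "l i < L" by (auto simp: not_le)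
          have z0: "(\<Prod>i<d. w (l i) (z i) (x i)) = 0" for z
            by (rule prod_zero) (use i w_coarse in auto)
          have "?D l = 0" unfolding tensor_def z0 mult_zero_left by (rule sum.neutral_const)
          then show ?thesis unfolding disc_def if_not_P[OF False] by simp
        qed
        have 3: "ennreal \<bar>?U l\<bar> \<le> tail l x" if l: "l \<in> ?B" for l
          unfolding tensor_def tail_def
        proof (rule tensor_kernel_bound[OF lohi E m f])
          show "finite ?Z" "?Z \<subseteq> {lo..hi}" using nodes_props by auto
          fix i assume i: "i < d"
          have "\<forall>j\<in>{1..l i}. X j \<subseteq> ?Z" using lB[OF l i] nodes_props(3) by auto
          then show "kernel_bound lo hi m E ?Z (\<lambda>y. diff_w (l i) y (x i)) (x i) (r (l i)) (M (l i))"
            using rM[OF lB(1)[OF l i], THEN conjunct2, THEN conjunct2, THEN conjunct2, THEN spec, THEN spec,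
                THEN mp, of ?Z "x i"] xi[OF i] nodes_props by simp
        qed
        have "f x = (f x - ?T x) + ((\<Sum>l\<in>level_set p d. wt l * (- 1) ^ (p - sum l {..<d}) * ?D l) + (\<Sum>l\<in>?B. ?U l))"
          using tensor_w_expand[OF d, of k ?Z f x] by (simp add: k_def wt_def)
        then have "\<bar>f x\<bar> \<le> \<bar>f x - ?T x\<bar> +
            (\<bar>\<Sum>l\<in>level_set p d. wt l * (- 1) ^ (p - sum l {..<d}) * ?D l\<bar> + \<bar>\<Sum>l\<in>?B. ?U l\<bar>)"
          by linarith
        also have "\<dots> \<le> e + ((\<Sum>l\<in>level_set p d. wt l * disc l x) + (\<Sum>l\<in>?B. \<bar>?U l\<bar>))"
        proof (intro add_mono 1 sum_abs)
          show "\<bar>\<Sum>l\<in>level_set p d. wt l * (- 1) ^ (p - sum l {..<d}) * ?D l\<bar> \<le> (\<Sum>l\<in>level_set p d. wt l * disc l x)"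
            using 2 by (intro order.trans[OF sum_abs] sum_mono) (auto simp: abs_mult power_abs wt_def intro!: mult_left_mono)
        qed
        finally have "ennreal \<bar>f x\<bar> \<le> ennreal (e + ((\<Sum>l\<in>level_set p d. wt l * disc l x) + (\<Sum>l\<in>?B. \<bar>?U l\<bar>)))"
          by (rule ennreal_leI)
        also have "\<dots> = ennreal e + (ennreal (\<Sum>l\<in>level_set p d. wt l * disc l x) + ennreal (\<Sum>l\<in>?B. \<bar>?U l\<bar>))"
        proof -
          have "(\<Sum>l\<in>level_set p d. wt l * disc l x) \<ge> 0"
            using 2 by (intro sum_nonneg mult_nonneg_nonneg) (auto simp: wt_def intro: order.trans[OF abs_ge_zero])
          then show ?thesis using e by (simp add: sum_nonneg)
        qed
        also have "ennreal (\<Sum>l\<in>level_set p d. wt l * disc l x) = (\<Sum>l\<in>level_set p d. ennreal (wt l) * ennreal (disc l x))"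
        proof -
          have dp: "disc l x \<ge> 0" if "l \<in> level_set p d" for l using 2[OF that] by linarith
          then have "ennreal (\<Sum>l\<in>level_set p d. wt l * disc l x) = (\<Sum>l\<in>level_set p d. ennreal (wt l * disc l x))"
            by (intro sum_ennreal[symmetric]) (simp add: wt_def)
          also have "\<dots> = (\<Sum>l\<in>level_set p d. ennreal (wt l) * ennreal (disc l x))"
            using dp by (intro sum.cong refl ennreal_mult) (auto simp: wt_def)
          finally show ?thesis .
        qed
        also have "ennreal (\<Sum>l\<in>?B. \<bar>?U l\<bar>) = (\<Sum>l\<in>?B. ennreal \<bar>?U l\<bar>)" by (intro sum_ennreal[symmetric]) auto
        also have "ennreal e + ((\<Sum>l\<in>level_set p d. ennreal (wt l) * ennreal (disc l x)) + (\<Sum>l\<in>?B. ennreal \<bar>?U l\<bar>)) \<le> total x"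
          unfolding total_def by (intro add_left_mono sum_mono 3)
        finally show ?thesis .
      qed
      have "L2_le ?C total (e * K + ((\<Sum>l\<in>level_set p d. wt l * ?v)
          + (\<Sum>l\<in>?B. ?w l)))"
        unfolding total_def
      proof (intro L2_le_add L2_le_sum finL finB L2_le_cmult disc_L2)
        show "L2_le ?C (\<lambda>x. ennreal e) (e * K)" using K e by simp
        show "\<And>l. l \<in> ?B \<Longrightarrow> L2_le ?C (\<lambda>x. tail l x) (?w l)"
          using tail_L2 lB(1) by blast
      qed (auto simp: wt_def)
      then have "L2_cube_norm {lo..hi} d f \<le> e * K + ((\<Sum>l\<in>level_set p d. wt l * ?v)
          + (\<Sum>l\<in>?B. ?w l))"
        by (rule L2_cube_norm_le[OF fsq]) (rule pw)
      also have "(\<Sum>l\<in>level_set p d. wt l * ?v) \<le> A ^ d * P * sqrt (1 / 2) ^ (p - d) * G"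
      proof -
        have "(\<Sum>l\<in>level_set p d. wt l * ?v)
            = (\<Sum>l\<in>level_set p d. wt l) * ?v"
          by (simp add: sum_distrib_right)
        also have "\<dots> \<le> (2 ^ d * P) * ?v"
          unfolding wt_def P_def using c S G by (intro mult_right_mono level_set_weight_sum d) auto
        also have "\<dots> = (2 * c * S) ^ d * (P * sqrt (1 / 2) ^ (p - d) * G)" by (simp add: power_mult_distrib mult_ac)
        also have "\<dots> \<le> A ^ d * (P * sqrt (1 / 2) ^ (p - d) * G)"
          using A1 P G by (intro mult_right_mono power_mono) auto
        finally show ?thesis by (simp only: mult.assoc)
      qed
      also have "(\<Sum>l\<in>?B. ?w l) \<le> A ^ d * P * (1 / 2) ^ (m * (p - d)) * F"
      proof -
        have "(\<Sum>l\<in>?B. ?w l)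
            = (real m + 1) ^ d * B ^ d * (\<Sum>l\<in>?B. (1 / 2) ^ (m * sum l {..<d})) * F"
          by (simp add: sum_distrib_left sum_distrib_right)
        also have "\<dots> \<le> (real m + 1) ^ d * B ^ d * (4 * 3 ^ d * P * (1 / 2) ^ (m * p)) * F"
          unfolding P_def using B F by (intro mult_right_mono mult_left_mono tail_sum_le d m) auto
        \<comment> \<open>4 is raised to 4^d and the exponent mp lowered to m(p-d), to reach a pure
          d-th power.\<close>
        also have "\<dots> \<le> (real m + 1) ^ d * B ^ d * (4 ^ d * 3 ^ d * P * (1 / 2) ^ (m * (p - d))) * F"
          using B F P d by (intro mult_right_mono mult_left_mono mult_mono power_decreasing self_le_power) auto
        also have "\<dots> = (12 * (real m + 1) * B) ^ d * (P * (1 / 2) ^ (m * (p - d)) * F)"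
        proof -
          have "(12::real) ^ d = 4 ^ d * 3 ^ d" by (simp add: power_mult_distrib[symmetric])
          then show ?thesis by (simp only: power_mult_distrib mult_ac)
        qed
        also have "\<dots> \<le> A ^ d * (P * (1 / 2) ^ (m * (p - d)) * F)"
          using A2 P F by (intro mult_right_mono power_mono) auto
        finally show ?thesis by (simp only: mult.assoc)
      qed
      finally show ?thesis by simp
    qed
    have "L2_cube_norm {lo..hi} d f \<le> A ^ d * P * sqrt (1 / 2) ^ (p - d) * G + A ^ d * P * (1 / 2) ^ (m * (p - d)) * F"
    proof (rule field_le_epsilon)
      fix e :: real assume e: "e > 0"
      \<comment> \<open>\<open>K\<close> is only known to be nonnegative, hence the division by K +
        1.\<close>
      have "e / (K + 1) * K \<le> e" using K(1) e by (simp add: field_simps)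
      then show "L2_cube_norm {lo..hi} d f \<le> A ^ d * P * sqrt (1 / 2) ^ (p - d) * G + A ^ d * P * (1 / 2) ^ (m * (p - d)) * F + e"
        using bound[of "e / (K + 1)"] e K(1) by simp
    qed
    also have "\<dots> = P * (A ^ d * (1 / 2) ^ (m * (p - d)) * F + A ^ d * sqrt (1 / 2) ^ (p - d) * G)"
      by (simp add: algebra_simps)
    finally show ?thesis unfolding P_def F_def G_def .
  qed
  show ?thesis
    using \<open>A > 0\<close> main by (intro exI[of _ A]) blast
qed

end

section \<open>Rates in terms of the number of points\<close>


text \<open>The lower bound comes from a single anisotropic grid. The upper bound ignores overlaps:
  each grid has at most 2^p points, and there are at most d p^(d-1) level vectors.\<close>

lemma sparse_grid_card_bounds:
  fixes X :: "nat \<Rightarrow> real set"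
  assumes c1: "card (X 1) = 1" and c2: "\<And>l. l \<ge> 2 \<Longrightarrow> card (X l) = 2 ^ (l - 1) + 1"
    and d: "d \<ge> 1" "p \<ge> d"
  shows "2 ^ (p - d) \<le> card (sparse_grid X p d)"
    and "real (card (sparse_grid X p d)) \<le> real d * 2 ^ d * real p ^ (d - 1) * 2 ^ (p - d)"
proof -
  let ?Y = "\<lambda>l. \<Pi>\<^sub>E i\<in>{..<d}. X (l i)"
  have fin: "finite (X l)" if "l \<ge> 1" for l
    using c1 c2[of l] that by (cases "l = 1") (auto intro!: card_ge_0_finite)
  have cle: "card (X l) \<le> 2 ^ l" and cge: "card (X l) \<ge> 2 ^ (l - 1)" if "l \<ge> 1" for l
  proof -
    have "card (X l) \<le> 2 ^ l \<and> card (X l) \<ge> 2 ^ (l - 1)"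
    proof (cases "l = 1")
      case False
      then have "l \<ge> 2" using that by simp
      moreover have "(2::nat) ^ l = 2 ^ (l - 1) + 2 ^ (l - 1)" using that by (cases l) auto
      moreover have "(2::nat) ^ (l - 1) \<ge> 1" by simp
      ultimately show ?thesis using c2[of l] by linarith
    qed (use c1 in auto)
    then show "card (X l) \<le> 2 ^ l" "card (X l) \<ge> 2 ^ (l - 1)" by auto
  qed
  have finL: "finite (level_set p d)" by (rule finite_level_set)
  have l1: "l i \<ge> 1" if "l \<in> level_set p d" "i < d" for l i
    using that by (auto simp: level_set_def PiE_iff)
  have fY: "finite (?Y l)" if "l \<in> level_set p d" for l
    using l1[OF that] fin by (intro finite_PiE) auto
  show "2 ^ (p - d) \<le> card (sparse_grid X p d)"
  proof -
    \<comment> \<open>The vector (p-d+1, 1, ..., 1): level 1 has one point, so only the first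
      direction contributes.\<close>
    define l where "l = restrict (\<lambda>i. if i = 0 then p - d + 1 else (1::nat)) {..<d}"
    have "sum l {..<d} = (\<Sum>i\<in>{..<d}. if i = 0 then p - d + 1 else 1)"
      unfolding l_def by (intro sum.cong) auto
    also have "\<dots> = p - d + 1 + (\<Sum>i\<in>{..<d} - {0}. 1)" using d by (subst sum.remove[of _ 0]) auto
    also have "\<dots> = p" using d by simp
    finally have s: "sum l {..<d} = p" .
    then have l: "l \<in> level_set p d" using d by (auto simp: level_set_def l_def)
    have "2 ^ (p - d) \<le> card (X (l 0)) * (\<Prod>i\<in>{..<d} - {0}. 1)"
      using cge[of "l 0"] d by (simp add: l_def)
    also have "\<dots> = card (X (l 0)) * (\<Prod>i\<in>{..<d} - {0}. card (X (l i)))"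
      using c1 by (intro arg_cong2[where f = "(*)"] prod.cong) (auto simp: l_def)
    also have "\<dots> = card (?Y l)"
      using d by (simp add: card_PiE prod.remove[of _ 0])
    also have "\<dots> \<le> card (sparse_grid X p d)"
      unfolding sparse_grid_def using finL fY l by (intro card_mono) auto
    finally show ?thesis .
  qed
  have "card (sparse_grid X p d) \<le> (\<Sum>l\<in>level_set p d. card (?Y l))"
    unfolding sparse_grid_def by (rule card_UN_le[OF finL])
  also have "\<dots> \<le> (\<Sum>l\<in>level_set p d. 2 ^ p)"
  proof (rule sum_mono)
    fix l assume l: "l \<in> level_set p d"
    have "card (?Y l) = (\<Prod>i<d. card (X (l i)))" by (simp add: card_PiE)
    also have "\<dots> \<le> (\<Prod>i<d. 2 ^ l i)" using cle l1[OF l] by (intro prod_mono) auto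
    also have "\<dots> = 2 ^ sum l {..<d}" by (simp add: power_sum)
    also have "\<dots> \<le> 2 ^ p" using l by (intro power_increasing) (auto simp: level_set_def)
    finally show "card (?Y l) \<le> 2 ^ p" .
  qed
  finally have "real (card (sparse_grid X p d)) \<le> real (card (level_set p d) * 2 ^ p)" by (intro of_nat_mono) simp
  then have u: "real (card (sparse_grid X p d)) \<le> real (card (level_set p d)) * 2 ^ p" by simp
  have "level_set p d = (\<Union>q\<in>{p - d + 1..p}. compositions d q)"
  proof (intro equalityI subsetI)
    fix l assume "l \<in> level_set p d"
    then have "sum l {..<d} \<in> {p - d + 1..p}" "l \<in> compositions d (sum l {..<d})"
      by (simp_all add: level_set_def compositions_def)
    then show "l \<in> (\<Union>q\<in>{p - d + 1..p}. compositions d q)" by (rule UN_I)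
  next
    fix l assume "l \<in> (\<Union>q\<in>{p - d + 1..p}. compositions d q)"
    then obtain q where "q \<in> {p - d + 1..p}" "l \<in> compositions d q" by (rule UN_E)
    then show "l \<in> level_set p d" by (simp add: level_set_def compositions_def)
  qed
  then have "card (level_set p d) \<le> (\<Sum>q\<in>{p - d + 1..p}. card (compositions d q))"
    by (simp only:) (rule card_UN_le, simp)
  then have "real (card (level_set p d)) \<le> (\<Sum>q\<in>{p - d + 1..p}. real (card (compositions d q)))"
    by (simp only: of_nat_sum[symmetric] of_nat_le_iff)
  also have "\<dots> \<le> (\<Sum>q\<in>{p - d + 1..p}. real p ^ (d - 1))"
  proof (rule sum_mono)
    fix q assume "q \<in> {p - d + 1..p}"
    have "real (card (compositions d q)) \<le> real q ^ (d - 1) / fact (d - 1)" by (rule card_compositions_le[OF d(1)])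
    also have "\<dots> \<le> real p ^ (d - 1) / 1"
      using \<open>q \<in> _\<close> by (intro frac_le power_mono) auto
    finally show "real (card (compositions d q)) \<le> real p ^ (d - 1)" by simp
  qed
  also have "\<dots> = real d * real p ^ (d - 1)" using d by simp
  finally have v: "real (card (level_set p d)) * 2 ^ p \<le> real d * real p ^ (d - 1) * 2 ^ p" by (intro mult_right_mono) auto
  have pw: "(2::real) ^ p = 2 ^ d * 2 ^ (p - d)" using d by (simp add: power_add[symmetric])
  show "real (card (sparse_grid X p d)) \<le> real d * 2 ^ d * real p ^ (d - 1) * 2 ^ (p - d)"
    using order.trans[OF u v] unfolding pw by (simp only: mult_ac)
qed

text \<open>The upper bound on \<open>N\<close> turns 2^(-(p-d)) into K p^(d-1)/N: its m-th power
  supplies m further factors p^(d-1), its square root half a factor, which explains the exponents of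
  the logarithm. The lower bound turns \<open>p\<close> into a multiple of ln N. For sparse grids
  the latter fails at p = d: there is one point and ln N = 0. For d = 1 no logarithm occurs.\<close>

lemma level_rate_le_cardinality_rate:
  fixes N K :: real
  assumes d: "d \<ge> 1" "p \<ge> d" and N1: "2 ^ (p - d) \<le> N" and N2: "N \<le> K * real p ^ (d - 1) * 2 ^ (p - d)"
    and c: "d = 1 \<or> d < p" and K: "K > 0"
  shows "real p ^ (d - 1) * (1 / 2) ^ (m * (p - d))
      \<le> K ^ m * (real (d + 1) / ln 2) ^ ((m + 1) * (d - 1)) * (ln N ^ ((m + 1) * (d - 1)) * N powr (- real m))"
    and "real p ^ (d - 1) * sqrt (1 / 2) ^ (p - d)
      \<le> sqrt K * sqrt (real (d + 1) / ln 2) ^ (3 * (d - 1)) * (sqrt (ln N) ^ (3 * (d - 1)) * N powr (- 1 / 2))"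
proof -
  have N: "N \<ge> 1" using N1 by (rule order.trans[rotated]) simp
  define \<kappa> where "\<kappa> = real (d + 1) / ln 2"
  have \<kappa>: "\<kappa> > 0" by (simp add: \<kappa>_def)
  have lnN: "ln N \<ge> 0" using N by simp
  have pl: "real p \<le> \<kappa> * ln N" if dp: "d < p"
  proof -
    have "real (p - d) * ln 2 = ln (2 ^ (p - d))" by (simp add: ln_realpow)
    also have "\<dots> \<le> ln N" using N1 N by (subst ln_le_cancel_iff) auto
    finally have "real (p - d) \<le> ln N / ln 2" by (simp add: field_simps)
    then have "real (d + 1) * real (p - d) \<le> real (d + 1) * (ln N / ln 2)" by (intro mult_left_mono) auto
    \<comment> \<open>Equality holds in the worst case p = d + 1, which fixes the constant d +
      1.\<close>
    moreover have "p \<le> (d + 1) * (p - d)"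
    proof -
      obtain e where "p = Suc (d + e)" using less_imp_Suc_add[OF dp] by (elim exE)
      then show ?thesis by simp
    qed
    then have "real p \<le> real (d + 1) * real (p - d)" by (metis of_nat_le_iff of_nat_mult)
    ultimately show ?thesis by (simp add: \<kappa>_def)
  qed
  have pk: "real p ^ (e * (d - 1)) \<le> \<kappa> ^ (e * (d - 1)) * ln N ^ (e * (d - 1))" for e
  proof (cases "d = 1")
    case False
    then have "real p ^ (e * (d - 1)) \<le> (\<kappa> * ln N) ^ (e * (d - 1))" using pl c by (intro power_mono) auto
    then show ?thesis by (simp add: power_mult_distrib)
  qed simp
  have half: "(1 / 2) ^ (p - d) \<le> K * real p ^ (d - 1) / N"
    using N2 N by (simp add: power_one_over field_simps)
  have "(1 / 2 :: real) ^ (m * (p - d)) = ((1 / 2) ^ (p - d)) ^ m" by (simp add: power_mult[symmetric] mult.commute)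
  also have "\<dots> \<le> (K * real p ^ (d - 1) / N) ^ m" by (intro power_mono half) simp
  also have "\<dots> = K ^ m * real p ^ (m * (d - 1)) * N powr (- real m)"
    using N by (simp add: power_divide power_mult_distrib power_mult[symmetric] mult.commute[of m] powr_minus powr_realpow divide_inverse power_inverse)
  finally have "real p ^ (d - 1) * (1 / 2) ^ (m * (p - d)) \<le> real p ^ (d - 1) * (K ^ m * real p ^ (m * (d - 1)) * N powr (- real m))"
    by (intro mult_left_mono) auto
  also have "\<dots> = K ^ m * real p ^ ((m + 1) * (d - 1)) * N powr (- real m)"
    by (simp add: add_mult_distrib power_add mult_ac)
  also have "\<dots> \<le> K ^ m * (\<kappa> ^ ((m + 1) * (d - 1)) * ln N ^ ((m + 1) * (d - 1))) * N powr (- real m)"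
    using K by (intro mult_right_mono mult_left_mono pk) auto
  finally show "real p ^ (d - 1) * (1 / 2) ^ (m * (p - d))
      \<le> K ^ m * (real (d + 1) / ln 2) ^ ((m + 1) * (d - 1)) * (ln N ^ ((m + 1) * (d - 1)) * N powr (- real m))"
    by (simp only: \<kappa>_def mult.assoc)
  have "sqrt (1 / 2) ^ (p - d) = sqrt ((1 / 2) ^ (p - d))" by (simp only: real_sqrt_power)
  also have "\<dots> \<le> sqrt (K * real p ^ (d - 1) / N)" by (rule real_sqrt_le_mono[OF half])
  also have "\<dots> = sqrt K * sqrt (real p ^ (d - 1)) * N powr (- 1 / 2)"
  proof -
    have "N powr (- 1 / 2) = inverse (sqrt N)"
      using N powr_minus[of N "1 / 2"] by (simp add: powr_half_sqrt)
    then show ?thesis by (simp only: real_sqrt_mult divide_inverse real_sqrt_inverse)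
  qed
  finally have "real p ^ (d - 1) * sqrt (1 / 2) ^ (p - d)
      \<le> real p ^ (d - 1) * (sqrt K * sqrt (real p ^ (d - 1)) * N powr (- 1 / 2))"
    by (intro mult_left_mono) auto
  also have "real p ^ (d - 1) * (sqrt K * sqrt (real p ^ (d - 1)) * N powr (- 1 / 2))
      = sqrt K * sqrt (real p ^ (3 * (d - 1))) * N powr (- 1 / 2)"
  proof -
    have "real p ^ (3 * (d - 1)) = (real p ^ (d - 1)) ^ 3" by (subst mult.commute) (rule power_mult)
    also have "sqrt \<dots> = real p ^ (d - 1) * sqrt (real p ^ (d - 1))"
      by (simp add: power3_eq_cube real_sqrt_mult)
    finally show ?thesis by (simp only: mult_ac)
  qed
  also have "\<dots> \<le> sqrt K * sqrt (\<kappa> ^ (3 * (d - 1)) * ln N ^ (3 * (d - 1))) * N powr (- 1 / 2)"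
    using K by (intro mult_right_mono mult_left_mono real_sqrt_le_mono pk) auto
  finally show "real p ^ (d - 1) * sqrt (1 / 2) ^ (p - d)
      \<le> sqrt K * sqrt (real (d + 1) / ln 2) ^ (3 * (d - 1)) * (sqrt (ln N) ^ (3 * (d - 1)) * N powr (- 1 / 2))"
    by (simp only: \<kappa>_def[symmetric] real_sqrt_mult real_sqrt_power mult.assoc)
qed

theorem theorem3p6:
  fixes I :: "real set" and lo hi :: real and m :: nat
    and a :: process and X :: "nat \<Rightarrow> real set"
    and AQ :: "nat \<Rightarrow> nat \<Rightarrow> ((nat \<Rightarrow> real) \<Rightarrow> real) \<Rightarrow> (nat \<Rightarrow> real) \<Rightarrow> real"
  assumes "lo < hi" and "I = {lo..hi}"
    and "m \<ge> 1"
    and "local_poly_reproduction I (m - 1) a"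
    and "\<And>p d. AQ p d = smolyak_op a X p d"
    and "\<And>l. l \<ge> 1 \<Longrightarrow> X l \<subseteq> I"
    and "quasi_uniform I X"
    and "card (X 1) = 1"
    and "\<And>l. l \<ge> 2 \<Longrightarrow> card (X l) = 2 ^ (l - 1) + 1"
  shows "\<exists>C1 C2 C3 C4 :: nat \<Rightarrow> real.
    (\<forall>d\<ge>1. C1 d > 0 \<and> C2 d > 0 \<and> C3 d > 0 \<and> C4 d > 0) \<and>
    (\<exists>c>0. \<forall>d\<ge>1. C1 d = c ^ d / fact (d - 1)) \<and>
    (\<exists>c>0. \<forall>d\<ge>1. C3 d = c ^ d / fact (d - 1)) \<and>
    (\<forall>d\<ge>1. \<forall>p\<ge>d. \<forall>f\<in>H_mix I d m.
       let N = real (card (sparse_grid X p d));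
           F = H_mix_norm I d m f;
           G = discrete_norm (sparse_grid X p d) f;
           B = real p ^ (d - 1) *
                 (C1 d * 2 powr (- (real p - real d) * real m) * F
                  + C3 d * 2 powr (- (real p - real d) / 2) * G)
       in L2_cube_norm I d f \<le> B \<and>
          (d = 1 \<or> d < p \<longrightarrow>
             B \<le> C2 d * ln N ^ ((m + 1) * (d - 1)) * N powr (- real m) * F
                 + C4 d * sqrt (ln N) ^ (3 * (d - 1)) * N powr (- 1 / 2) * G))"
proof -
  have X6: "\<forall>l\<ge>1. X l \<subseteq> I" and X9: "\<forall>l\<ge>2. card (X l) = 2 ^ (l - 1) + 1" using assms(6,9) by blast+
  obtain L c n R \<rho> where L: "L \<ge> 2" "c \<ge> 1" "n \<ge> 1" "R > 0" and lev: "\<forall>l\<ge>L.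
    reproducing_level I m (X l) (a (X l)) c (\<rho> l) n \<and> \<rho> l \<le> R / 2 ^ l"
    using univariate_levels[OF assms(1-4) X6 assms(7) X9] by (elim exE conjE) (rule that)
  note lev = lev[unfolded reproducing_level_def]
  obtain E where E: "mollifier_primitive m E" using mollifier_primitive_exists by blast
  \<comment> \<open>Values of \<open>a\<close> at non-nodes are unconstrained, so they are cut off
    together with the coarse levels.\<close>
  define w where "w l y x = (if L \<le> l \<and> y \<in> X l then a (X l) y x else 0)" for l y x
  have fin: "finite (X l)" if "l \<ge> 1" for l
    using assms(8) assms(9)[of l] that by (cases "l = 1") (auto intro!: card_ge_0_finite)
  interpret reproduction_levels lo hi m L w X c n R \<rho> E
  proof
    fix l x assume l: "L \<le> l" and x: "x \<in> {lo..hi}"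
    have "(\<Sum>y\<in>X l. \<bar>w l y x\<bar>) = (\<Sum>y\<in>X l. \<bar>a (X l) y x\<bar>)"
      using l by (intro sum.cong) (auto simp: w_def)
    then show "(\<Sum>y\<in>X l. \<bar>w l y x\<bar>) \<le> c" using lev l x assms(2) by auto
    show "(\<Sum>y\<in>X l. w l y x * y ^ j) = x ^ j" if "j < m" for j
    proof -
      have "(\<Sum>y\<in>X l. w l y x * y ^ j) = (\<Sum>y\<in>X l. a (X l) y x * y ^ j)"
        using l by (intro sum.cong) (auto simp: w_def)
      then show ?thesis using lev l x assms(2) that by auto
    qed
    show "\<bar>x - y\<bar> \<le> \<rho> l" if "w l y x \<noteq> 0" for y
      using lev l x assms(2) that by (auto simp: w_def split: if_splits)
  next
    fix l assume "L \<le> l"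
    then show "0 \<le> \<rho> l" "\<rho> l \<le> R / 2 ^ l" "\<And>s. real (card {y \<in> X l. \<bar>s - y\<bar> \<le> \<rho> l}) \<le> n"
      using lev by auto
  qed (use assms(1,3) L E fin assms(6) in \<open>simp_all add: w_def assms(2)\<close>)
  obtain A where A: "A > 0" and samp: "\<And>d p f. d \<ge> 1 \<Longrightarrow> p \<ge> d \<Longrightarrow> f \<in> H_mix {lo..hi} d m \<Longrightarrow>
     L2_cube_norm {lo..hi} d f \<le> real p ^ (d - 1) / fact (d - 1) *
       (A ^ d * (1 / 2) ^ (m * (p - d)) * H_mix_norm {lo..hi} d m f
        + A ^ d * sqrt (1 / 2) ^ (p - d) * discrete_norm (sparse_grid X p d) f)"
    using sampling_inequality by blast
  \<comment> \<open>Since \<open>A\<close> is a common base for both terms, \<open>C1\<close> also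
    serves as \<open>C3\<close>.\<close>
  define C1 where "C1 d = A ^ d / fact (d - 1)" for d :: nat
  \<comment> \<open>The factor in the upper bound of \<open>sparse_grid_card_bounds\<close>; the
    logarithmic rates inherit its m-th power and its square root.\<close>
  define K where "K d = real d * 2 ^ d" for d :: nat
  define C2 where "C2 d = C1 d * (K d ^ m * (real (d + 1) / ln 2) ^ ((m + 1) * (d - 1)))" for d
  define C4 where "C4 d = C1 d * (sqrt (K d) * sqrt (real (d + 1) / ln 2) ^ (3 * (d - 1)))" for d
  have C1: "C1 d > 0" for d using A by (simp add: C1_def)
  have K: "K d > 0" if "d \<ge> 1" for d using that by (simp add: K_def)
  have pos: "C2 d > 0" "C4 d > 0" if "d \<ge> 1" for d
    using C1 K[OF that] unfolding C2_def C4_def by (auto intro!: mult_pos_pos)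
  have main: "let N = real (card (sparse_grid X p d));
           F = H_mix_norm I d m f;
           G = discrete_norm (sparse_grid X p d) f;
           B = real p ^ (d - 1) *
                 (C1 d * 2 powr (- (real p - real d) * real m) * F
                  + C1 d * 2 powr (- (real p - real d) / 2) * G)
       in L2_cube_norm I d f \<le> B \<and>
          (d = 1 \<or> d < p \<longrightarrow>
             B \<le> C2 d * ln N ^ ((m + 1) * (d - 1)) * N powr (- real m) * F
                 + C4 d * sqrt (ln N) ^ (3 * (d - 1)) * N powr (- 1 / 2) * G)"
    if d: "d \<ge> 1" "p \<ge> d" and f: "f \<in> H_mix I d m" for d p f
  proof -
    define N where "N = real (card (sparse_grid X p d))"
    define F where "F = H_mix_norm I d m f"
    define G where "G = discrete_norm (sparse_grid X p d) f"
    have F: "F \<ge> 0" by (simp add: F_def H_mix_norm_def sum_nonneg)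
    have G: "G \<ge> 0" by (simp add: G_def discrete_norm_def sum_nonneg)
    have r1: "2 powr (- (real p - real d) * real m) = (1 / 2) ^ (m * (p - d))"
    proof -
      have "- (real p - real d) * real m = - real (m * (p - d))" using d by (simp add: of_nat_diff algebra_simps)
      then show ?thesis by (simp only: powr_minus powr_realpow zero_less_numeral power_one_over inverse_eq_divide)
    qed
    have r2: "2 powr (- (real p - real d) / 2) = sqrt (1 / 2) ^ (p - d)"
    proof -
      have "sqrt (1 / 2) = (1 / 2 :: real) powr (1 / 2)" by (simp add: powr_half_sqrt)
      also have "\<dots> = 2 powr (- 1 / 2)" by (simp add: powr_minus powr_divide inverse_eq_divide)
      finally have "sqrt (1 / 2) ^ (p - d) = (2 powr (- 1 / 2)) powr real (p - d)" by (simp add: powr_realpow)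
      also have "\<dots> = 2 powr (- 1 / 2 * real (p - d))" by (rule powr_powr)
      also have "- 1 / 2 * real (p - d) = - (real p - real d) / 2"
      proof -
        have e: "real (p - d) = real p - real d" using d by (simp add: of_nat_diff)
        show ?thesis unfolding e by (simp add: field_simps)
      qed
      finally show ?thesis by simp
    qed
    define B where "B = real p ^ (d - 1) * (C1 d * (1 / 2) ^ (m * (p - d)) * F + C1 d * sqrt (1 / 2) ^ (p - d) * G)"
    have "L2_cube_norm I d f \<le> B"
      using samp[OF d, of f] f unfolding assms(2) B_def F_def G_def C1_def
      by (simp add: field_simps)
    moreover have "B \<le> C2 d * ln N ^ ((m + 1) * (d - 1)) * N powr (- real m) * F
                 + C4 d * sqrt (ln N) ^ (3 * (d - 1)) * N powr (- 1 / 2) * G" if c: "d = 1 \<or> d < p"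
    proof -
      note cb = sparse_grid_card_bounds[of X, OF assms(8,9) d]
      have N1: "2 ^ (p - d) \<le> N" using cb(1) unfolding N_def by (metis of_nat_le_iff of_nat_numeral of_nat_power)
      have N2: "N \<le> K d * real p ^ (d - 1) * 2 ^ (p - d)" using cb(2) by (simp add: N_def K_def)
      note rates = level_rate_le_cardinality_rate[OF d N1 N2 c K[OF d(1)]]
      have "B = C1 d * F * (real p ^ (d - 1) * (1 / 2) ^ (m * (p - d))) + C1 d * G * (real p ^ (d - 1) * sqrt (1 / 2) ^ (p - d))"
        by (simp only: B_def distrib_left mult_ac)
      also have "\<dots> \<le> C1 d * F * (K d ^ m * (real (d + 1) / ln 2) ^ ((m + 1) * (d - 1)) * (ln N ^ ((m + 1) * (d - 1)) * N powr (- real m)))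
          + C1 d * G * (sqrt (K d) * sqrt (real (d + 1) / ln 2) ^ (3 * (d - 1)) * (sqrt (ln N) ^ (3 * (d - 1)) * N powr (- 1 / 2)))"
        using C1[of d] F G by (intro add_mono mult_left_mono rates mult_nonneg_nonneg) auto
      also have "\<dots> = C2 d * ln N ^ ((m + 1) * (d - 1)) * N powr (- real m) * F
                 + C4 d * sqrt (ln N) ^ (3 * (d - 1)) * N powr (- 1 / 2) * G"
        by (simp only: C2_def C4_def mult_ac)
      finally show ?thesis .
    qed
    ultimately show ?thesis
      unfolding Let_def r1 r2 B_def F_def[symmetric] G_def[symmetric] N_def[symmetric] by blast
  qed
  show ?thesis
  proof (rule exI[of _ C1], rule exI[of _ C2], rule exI[of _ C1], rule exI[of _ C4], intro conjI)
    show "\<forall>d\<ge>1. C1 d > 0 \<and> C2 d > 0 \<and> C1 d > 0 \<and> C4 d > 0" using C1 pos by blast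
    show "\<exists>c>0. \<forall>d\<ge>1. C1 d = c ^ d / fact (d - 1)" using A C1_def by blast
    then show "\<exists>c>0. \<forall>d\<ge>1. C1 d = c ^ d / fact (d - 1)" .
  qed (intro allI impI ballI main)
qed

end
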